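(* Let $q\in(-1,1]$, let $\boldsymbol\rho=(\rho_1,\dots,\rho_{d-1})\in((-1,1)\setminus\{0\})^{d-1}$, let $(X_1,\dots,X_d)\sim N_d(\mathbf 0,\mathbf 1,\boldsymbol\rho|q)$, and let $g\in L(q)$. Let $n\in\mathbb N$ and $1\le j_1<j_2<\dots<j_m<i\le d$. (i) If $\mathbb E(g(X_i)|X_{j_1},\dots,X_{j_m})$ is equal to a polynomial of degree at most $n$ in $X_{j_m}$, then the function $g$ must also be a polynomial of degree at most $n$. (ii) (Generalized Gebelein's inequality) If additionally $\mathbb E g(X_i)=0$, then $$\mathbb E\Big(\big(\mathbb E(g(X_i)|X_{j_1},\dots,X_{j_m})\big)^2\Big)\le r^2\,\mathbb E\big(g^2(X_i)\big),\qquad r=\prod_{k=j_m}^{i-1}\rho_k .$$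
   Context: Convention $0^0=1$. $S(q)=[-2/\sqrt{1-q},\,2/\sqrt{1-q}]$ for $|q|<1$, $S(1)=\mathbb R$. For $|q|<1$ and $x\in S(q)$, $$f_N(x|q)=\frac{\sqrt{1-q}}{2\pi\sqrt{4-(1-q)x^2}}\prod_{k=0}^\infty\big((1+q^k)^2-(1-q)x^2q^k\big)\prod_{k=0}^\infty(1-q^{k+1}),$$ and for $|\rho|<1$, $x,y\in S(q)$, $$f_{CN}(x|y,\rho,q)=f_N(x|q)\prod_{k=0}^\infty\frac{1-\rho^2q^k}{(1-\rho^2q^{2k})^2-(1-q)\rho q^k(1+\rho^2q^{2k})xy+(1-q)\rho^2(x^2+y^2)q^{2k}};$$ both are $0$ for $x\notin S(q)$ (and at the endpoints). For $q=1$: $f_N(x|1)=\frac1{\sqrt{2\pi}}e^{-x^2/2}$, $f_{CN}(x|y,\rho,1)=\frac1{\sqrt{2\pi(1-\rho^2)}}\exp\!\big(-\frac{(x-\rho y)^2}{2(1-\rho^2)}\big)$. $N_d(\mathbf 0,\mathbf 1,\boldsymbol\rho|q)$ is the distribution on $\mathbb R^d$ with density $f_N(x_1|q)\prod_{i=1}^{d-1}f_{CN}(x_{i+1}|x_i,\rho_i,q)$ on $S(q)^d$ (zero elsewhere). $L(q)$ is the space of functions $g:\mathbb R\to\mathbb C$ with $\int_{\mathbb R}|g(x)|^2f_N(x|q)\,dx<\infty$. Equalities involving conditional expectations are almost sure, and elements of $L(q)$ are identified when equal almost everywhere on $S(q)$. *)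

theory Defs
  imports
    "HOL-Probability.Probability"
    "HOL-Computational_Algebra.Polynomial"
begin

text \<open>
  All definitions are intended for \<open>-1 < q \<le> 1\<close>.  For \<open>q < 1\<close> the endpoints of \<open>S q\<close> belong to
  \<open>S q\<close>, but both densities vanish there.
\<close>

definition S :: "real \<Rightarrow> real set" where
  "S q = (if q = 1 then UNIV else {- (2 / sqrt (1 - q)) .. 2 / sqrt (1 - q)})"

definition f_N :: "real \<Rightarrow> real \<Rightarrow> real" where
  "f_N q x =
    (if q = 1 then 1 / sqrt (2 * pi) * exp (- (x^2) / 2)
     else if \<bar>x\<bar> < 2 / sqrt (1 - q) then
       sqrt (1 - q) / (2 * pi * sqrt (4 - (1 - q) * x^2))
         * (\<Prod>k. (1 + q^k)^2 - (1 - q) * x^2 * q^k)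
         * (\<Prod>k. 1 - q^(k+1))
     else 0)"

text \<open>\<open>f_CN q \<rho> y x\<close> is the density at \<open>x\<close> conditional on \<open>y\<close>, written \<open>f_CN(x|y,\<rho>,q)\<close>.\<close>

definition f_CN :: "real \<Rightarrow> real \<Rightarrow> real \<Rightarrow> real \<Rightarrow> real" where
  "f_CN q \<rho> y x =
    (if q = 1 then
       1 / sqrt (2 * pi * (1 - \<rho>^2)) * exp (- ((x - \<rho> * y)^2) / (2 * (1 - \<rho>^2)))
     else
       f_N q x * (\<Prod>k. (1 - \<rho>^2 * q^k) /
         ((1 - \<rho>^2 * q^(2*k))^2
          - (1 - q) * \<rho> * q^k * (1 + \<rho>^2 * q^(2*k)) * x * y
          + (1 - q) * \<rho>^2 * (x^2 + y^2) * q^(2*k))))"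

text \<open>
  Density of \<open>N_d(0,1,\<rho>|q)\<close> with respect to Lebesgue measure on \<open>\<real>\<^sup>d\<close>.  Points of \<open>\<real>\<^sup>d\<close> are
  functions on \<open>{1..d}\<close>, and only \<open>\<rho> 1, \<dots>, \<rho> (d - 1)\<close> are used.
\<close>

definition qN_density :: "nat \<Rightarrow> (nat \<Rightarrow> real) \<Rightarrow> real \<Rightarrow> (nat \<Rightarrow> real) \<Rightarrow> real" where
  "qN_density d \<rho> q x =
    (if \<forall>k\<in>{1..d}. x k \<in> S q
     then f_N q (x 1) * (\<Prod>i\<in>{1..<d}. f_CN q (\<rho> i) (x i) (x (i+1)))
     else 0)"

definition qN_distributed ::
  "'a measure \<Rightarrow> nat \<Rightarrow> (nat \<Rightarrow> real) \<Rightarrow> real \<Rightarrow> (nat \<Rightarrow> 'a \<Rightarrow> real) \<Rightarrow> bool" where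
  "qN_distributed M d \<rho> q X \<longleftrightarrow>
    distributed M (\<Pi>\<^sub>M k\<in>{1..d}. lborel) (\<lambda>\<omega>. \<lambda>k\<in>{1..d}. X k \<omega>)
      (\<lambda>x. ennreal (qN_density d \<rho> q x))"

definition L :: "real \<Rightarrow> (real \<Rightarrow> complex) set" where
  "L q = {g \<in> borel_measurable borel. integrable lborel (\<lambda>x. (cmod (g x))^2 * f_N q x)}"

text \<open>
  The library's conditional expectation is real-valued; for complex random variables it is
  taken componentwise.
\<close>

definition complex_cond_exp :: "'a measure \<Rightarrow> 'a measure \<Rightarrow> ('a \<Rightarrow> complex) \<Rightarrow> 'a \<Rightarrow> complex" where
  "complex_cond_exp M F f \<omega> =
    Complex (real_cond_exp M F (\<lambda>x. Re (f x)) \<omega>) (real_cond_exp M F (\<lambda>x. Im (f x)) \<omega>)"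

definition sigma_rv :: "'a measure \<Rightarrow> nat set \<Rightarrow> (nat \<Rightarrow> 'a \<Rightarrow> real) \<Rightarrow> 'a measure" where
  "sigma_rv M J X =
    vimage_algebra (space M) (\<lambda>\<omega>. \<lambda>k\<in>J. X k \<omega>) (\<Pi>\<^sub>M k\<in>J. borel)"

end

theory Submission
  imports Defs
begin

text \<open>
  Write \<open>P\<close> for the operator \<open>g \<mapsto> \<integral> g(x) f\<^sub>C\<^sub>N(x|\<cdot>,\<rho>,q) dx\<close> on the weighted space \<open>L\<^sup>2(f\<^sub>N)\<close>.  The density of
  \<open>N\<^sub>d\<close> is that of a stationary reversible Markov chain, so conditioning \<open>g(X\<^sub>i)\<close> on coordinates up to
  \<open>j\<^sub>m\<close> amounts to applying the operators for \<open>\<rho>\<^sub>k\<close>, \<open>j\<^sub>m \<le> k < i\<close>, one after the other.  Hence it suffices to treat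
  a single \<open>P\<close>, which is self-adjoint and has the \<open>q\<close>-Hermite polynomial of degree \<open>n\<close> as eigenfunction
  with eigenvalue \<open>\<rho>\<^sup>n\<close>.  Polynomials are complete in \<open>L\<^sup>2(f\<^sub>N)\<close> because \<open>f\<^sub>N\<close> has exponential moments.
  If \<open>P g\<close> is a polynomial of degree at most \<open>n\<close>, then all coefficients of \<open>g\<close> beyond \<open>n\<close> vanish, as
  \<open>\<rho> \<noteq> 0\<close>; if \<open>g\<close> has mean zero, the eigenvalues that matter are at most \<open>\<bar>\<rho>\<bar>\<close> in modulus.

  For \<open>|q| < 1\<close> the eigenvalue equation follows from orthogonality and the Poisson--Mehler formula
  \<open>f\<^sub>C\<^sub>N(x|y,\<rho>,q) = f\<^sub>N(x|q) \<Sum>\<^sub>n H\<^sub>n(x) H\<^sub>n(y) \<rho>\<^sup>n / (q;q)\<^sub>n\<close>: the series satisfies the functional equation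
  in \<open>\<rho> \<mapsto> q \<rho>\<close> of the infinite product.
\<close>

section \<open>q-Hermite polynomials\<close>

text \<open>Three obstacles shape the proof. The conditional density is a product from which no
  eigenfunction can be read off; the Poisson--Mehler series diagonalises it, and it converges on the
  support because \<open>qherm\<close> grows only linearly in the degree there. The weight is an
  infinite product too; with \<open>X = 2 cos t\<close> its factors become
  \<open>|1 - q^k e^(2it)|^2\<close>, and the moments of the truncated products have a closed form.
  Completeness has to cover the unbounded support at \<open>q = 1\<close>: exponential moments allow
  \<open>e^(itx)\<close> to be expanded under the integral, so if all moments of
  \<open>g f_N\<close> vanish, its positive and negative parts have the same Fourier transform,
  hence agree. The spectral argument is carried out once, for an abstract reversible kernel; the
  cases \<open>|q| < 1\<close> and \<open>q = 1\<close> differ only in how its hypotheses are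
  checked, the Gaussian eigenvalue equation resting on integration by parts. All operators are real,
  so a complex \<open>g\<close> is treated through its real and imaginary parts.\<close>

definition qpoch :: "real \<Rightarrow> nat \<Rightarrow> real" where
  "qpoch q n = (\<Prod>k<n. 1 - q ^ (k + 1))"

abbreviation qpoch_inf :: "real \<Rightarrow> real" where
  "qpoch_inf q \<equiv> \<Prod>k. 1 - q ^ (k + 1)"

lemma qpoch_0 [simp]: "qpoch q 0 = 1"
  by (simp add: qpoch_def)

lemma qpoch_Suc: "qpoch q (Suc n) = (1 - q ^ (n + 1)) * qpoch q n"
  by (simp add: qpoch_def mult.commute)

text \<open>The argument of \<open>qherm\<close> is \<open>X = sqrt (1 - q) * x\<close>, which is \<open>2 cos \<theta>\<close> for \<open>x\<close> in \<open>S q\<close>; in terms of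
  \<open>x\<close> it is \<open>(1 - q) powr (n / 2)\<close> times the monic \<open>q\<close>-Hermite polynomial.\<close>

fun qherm :: "real \<Rightarrow> real \<Rightarrow> nat \<Rightarrow> real" where
  "qherm q X 0 = 1"
| "qherm q X (Suc 0) = X"
| "qherm q X (Suc (Suc n)) = X * qherm q X (Suc n) - (1 - q ^ Suc n) * qherm q X n"

lemma power_less_one_abs:
  fixes q :: real
  assumes "\<bar>q\<bar> < 1"
  shows "\<bar>q ^ Suc k\<bar> < 1"
  using power_decreasing[of 1 "Suc k" "\<bar>q\<bar>"] assms by (simp add: power_abs del: power_Suc)

lemma qpoch_pos:
  assumes "\<bar>q\<bar> < 1"
  shows "0 < qpoch q n"
  unfolding qpoch_def
proof (rule prod_pos)
  fix k
  show "0 < 1 - q ^ (k + 1)"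
    using power_less_one_abs[OF assms, of k] by simp
qed

lemma convergent_prod_one_minus:
  fixes f :: "nat \<Rightarrow> real"
  assumes "summable (\<lambda>k. norm (f k))"
  shows "convergent_prod (\<lambda>k. 1 + f k)" "convergent_prod (\<lambda>k. 1 - f k)"
  using assms
  by (auto intro!: abs_convergent_prod_imp_convergent_prod summable_imp_abs_convergent_prod)

lemma convergent_qpoch:
  fixes q :: real
  assumes "\<bar>q\<bar> < 1"
  shows "convergent_prod (\<lambda>k. 1 - q ^ (k + 1))"
proof (rule convergent_prod_one_minus)
  show "summable (\<lambda>k. norm (q ^ (k + 1)))"
    using summable_mult[of "\<lambda>n. \<bar>q\<bar> ^ n" "\<bar>q\<bar>"] summable_geometric[of "\<bar>q\<bar>"] assms
    by (simp add: power_abs abs_mult)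
qed

lemma prod_lessThan_tendsto_prodinf:
  fixes f :: "nat \<Rightarrow> real"
  assumes "convergent_prod f"
  shows "(\<lambda>n. \<Prod>k<n. f k) \<longlonglongrightarrow> prodinf f"
  using convergent_prod_LIMSEQ[OF assms] by (simp add: LIMSEQ_lessThan_iff_atMost)

lemma qpoch_tendsto:
  assumes "\<bar>q\<bar> < 1"
  shows "qpoch q \<longlonglongrightarrow> qpoch_inf q"
  using prod_lessThan_tendsto_prodinf[OF convergent_qpoch[OF assms]] by (simp add: qpoch_def[abs_def])

lemma qpoch_inf_pos:
  fixes q :: real
  assumes "\<bar>q\<bar> < 1"
  shows "0 < qpoch_inf q"
proof (rule less_0_prodinf[OF convergent_qpoch[OF assms]])
  fix k
  show "0 < 1 - q ^ (k + 1)"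
    using power_less_one_abs[OF assms, of k] by simp
qed

lemma qpoch_bounds:
  assumes "\<bar>q\<bar> < 1"
  obtains B where "0 < B" "\<And>n. qpoch q n \<le> B" "\<And>n. inverse (qpoch q n) \<le> B"
proof -
  let ?P = "qpoch_inf q"
  have "Bseq (qpoch q)"
    using qpoch_tendsto[OF assms] by (intro convergent_imp_Bseq convergentI)
  then obtain B1 where B1: "0 < B1" "\<And>n. norm (qpoch q n) \<le> B1"
    by (auto elim!: BseqE)
  have "Bseq (\<lambda>n. inverse (qpoch q n))"
    using tendsto_inverse[OF qpoch_tendsto[OF assms]] qpoch_inf_pos[OF assms]
    by (intro convergent_imp_Bseq convergentI) auto
  then obtain B2 where B2: "0 < B2" "\<And>n. norm (inverse (qpoch q n)) \<le> B2"
    by (auto elim!: BseqE)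
  show thesis
  proof (rule that[of "max B1 B2"])
    show "qpoch q n \<le> max B1 B2" for n using B1(2)[of n] by (auto simp: le_max_iff_disj)
    show "inverse (qpoch q n) \<le> max B1 B2" for n
      using B2(2)[of n] qpoch_pos[OF assms, of n] by (auto simp: le_max_iff_disj)
  qed (use B1 in auto)
qed

text \<open>The Gaussian binomial coefficient. The value 0 for \<open>j > n\<close> lets sums of
  different lengths be brought to a common index range.\<close>

definition qbinom :: "real \<Rightarrow> nat \<Rightarrow> nat \<Rightarrow> real" where
  "qbinom q n j = (if j \<le> n then qpoch q n / (qpoch q j * qpoch q (n - j)) else 0)"

text \<open>With \<open>x = q^(j+1)\<close>, \<open>y = q^(k+1)\<close> and
  \<open>n = j + k\<close>, cancelling common factors leaves \<open>(1 - x y) / ((1 - x) (1 - y)) =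
  1 / (1 - x) + 1 / (1 - y) - 1\<close>. This combination of coefficients is the one that the
  recurrence of \<open>qherm\<close> produces.\<close>

lemma qbinom_rec:
  assumes "\<bar>q\<bar> < 1" "j \<le> Suc n"
  shows "qbinom q (Suc (Suc n)) (Suc j) =
    qbinom q (Suc n) (Suc j) + qbinom q (Suc n) j - (1 - q ^ Suc n) * qbinom q n j"
proof (cases "j = Suc n")
  case True
  have "qpoch q m \<noteq> 0" for m
    using qpoch_pos[OF assms(1), of m] by simp
  then show ?thesis
    using True by (simp add: qbinom_def)
next
  case False
  then obtain k where n: "n = j + k"
    using assms(2) by (metis le_SucE nat_le_iff_add)
  have nz: "qpoch q m \<noteq> 0" "1 - q ^ Suc m \<noteq> 0" for m
    using qpoch_pos[OF assms(1), of m] power_less_one_abs[OF assms(1), of m] by auto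
  have a: "qbinom q (Suc (Suc n)) (Suc j) =
      (1 - q ^ Suc (Suc n)) * (1 - q ^ Suc n) * qpoch q n /
        ((1 - q ^ Suc j) * qpoch q j * ((1 - q ^ Suc k) * qpoch q k))"
    by (simp add: qbinom_def n qpoch_Suc Suc_diff_le mult.assoc)
  have b: "qbinom q (Suc n) (Suc j) =
      (1 - q ^ Suc n) * qpoch q n / ((1 - q ^ Suc j) * qpoch q j * qpoch q k)"
    by (simp add: qbinom_def n qpoch_Suc)
  have c: "qbinom q (Suc n) j =
      (1 - q ^ Suc n) * qpoch q n / (qpoch q j * ((1 - q ^ Suc k) * qpoch q k))"
    by (simp add: qbinom_def n qpoch_Suc Suc_diff_le)
  have d: "qbinom q n j = qpoch q n / (qpoch q j * qpoch q k)"
    by (simp add: qbinom_def n)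
  have e: "q ^ Suc (Suc n) = q ^ Suc j * q ^ Suc k"
    by (simp add: n power_add)
  have frac: "(1 - x * y) * A * N / ((1 - x) * J * ((1 - y) * K)) =
      A * N / ((1 - x) * J * K) + A * N / (J * ((1 - y) * K)) - A * (N / (J * K))"
    if "1 - x \<noteq> 0" "1 - y \<noteq> 0" "J \<noteq> 0" "K \<noteq> 0" for x y A N J K :: real
    using that by (simp add: divide_simps) algebra
  show ?thesis
    unfolding a b c d e by (rule frac) (use nz in auto)
qed

text \<open>By \<open>2 cos t cos a = cos (a + t) + cos (a - t)\<close>, multiplication by
  \<open>X\<close> adds the coefficient sequence to its shift by one; \<open>qbinom_rec\<close> then
  matches the three-term recurrence.\<close>

lemma qherm_cos:
  assumes "\<bar>q\<bar> < 1"
  shows "qherm q (2 * cos t) n = (\<Sum>j\<le>n. qbinom q n j * cos ((real n - 2 * real j) * t))"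
proof (induction n rule: induct_nat_012)
  case 0
  then show ?case by (simp add: qbinom_def)
next
  case 1
  have "qpoch q m \<noteq> 0" for m
    using qpoch_pos[OF assms, of m] by simp
  then show ?case by (simp add: qbinom_def)
next
  case (ge2 n)
  note q = assms
    let ?c = "\<lambda>j. cos ((real (Suc (Suc n)) - 2 * real j) * t)"
    let ?B = "qbinom q"
    have nz: "qpoch q m \<noteq> 0" for m
      using qpoch_pos[OF q, of m] by simp
    have prod: "2 * cos t * cos ((real (Suc n) - 2 * real j) * t) = ?c j + ?c (Suc j)" for j
    proof -
      define a where "a = (real (Suc n) - 2 * real j) * t"
      have "?c j = cos (a + t)" "?c (Suc j) = cos (a - t)"
        by (simp_all add: a_def algebra_simps)
      then show ?thesis
        unfolding a_def[symmetric] by (simp add: cos_add cos_diff)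
    qed
    have "2 * cos t * qherm q (2 * cos t) (Suc n) =
        (\<Sum>j\<le>Suc n. ?B (Suc n) j * (2 * cos t * cos ((real (Suc n) - 2 * real j) * t)))"
      using ge2(2) by (simp add: sum_distrib_left mult_ac del: sum.atMost_Suc)
    also have "\<dots> = (\<Sum>j\<le>Suc n. ?B (Suc n) j * ?c j) + (\<Sum>j\<le>Suc n. ?B (Suc n) j * ?c (Suc j))"
      unfolding prod by (simp add: distrib_left sum.distrib del: sum.atMost_Suc)
    also have "(\<Sum>j\<le>Suc n. ?B (Suc n) j * ?c j) = (\<Sum>j\<le>Suc (Suc n). ?B (Suc n) j * ?c j)"
      by (simp add: qbinom_def)
    also have "\<dots> = ?c 0 + (\<Sum>j\<le>Suc n. ?B (Suc n) (Suc j) * ?c (Suc j))"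
      by (subst sum.atMost_Suc_shift) (simp add: qbinom_def nz)
    finally have 1: "2 * cos t * qherm q (2 * cos t) (Suc n) = ?c 0 +
        (\<Sum>j\<le>Suc n. ?B (Suc n) (Suc j) * ?c (Suc j)) + (\<Sum>j\<le>Suc n. ?B (Suc n) j * ?c (Suc j))" .
    have "qherm q (2 * cos t) n = (\<Sum>j\<le>n. ?B n j * ?c (Suc j))"
      using ge2(1) by (simp add: algebra_simps)
    also have "\<dots> = (\<Sum>j\<le>Suc n. ?B n j * ?c (Suc j))"
      by (simp add: qbinom_def)
    finally have 2: "qherm q (2 * cos t) n = (\<Sum>j\<le>Suc n. ?B n j * ?c (Suc j))" .
    have "qherm q (2 * cos t) (Suc (Suc n)) = ?c 0 + (\<Sum>j\<le>Suc n.
        (?B (Suc n) (Suc j) + ?B (Suc n) j - (1 - q ^ Suc n) * ?B n j) * ?c (Suc j))"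
      unfolding qherm.simps 1 unfolding 2
      by (simp add: algebra_simps sum.distrib sum_subtractf sum_distrib_left del: sum.atMost_Suc)
    also have "\<dots> = ?c 0 + (\<Sum>j\<le>Suc n. ?B (Suc (Suc n)) (Suc j) * ?c (Suc j))"
      using qbinom_rec[OF q, of _ n] by (simp del: sum.atMost_Suc)
    also have "\<dots> = (\<Sum>j\<le>Suc (Suc n). ?B (Suc (Suc n)) j * ?c j)"
      by (subst sum.atMost_Suc_shift[of _ "Suc n"]) (simp add: qbinom_def nz)
    finally show "qherm q (2 * cos t) (Suc (Suc n)) = (\<Sum>j\<le>Suc (Suc n). ?B (Suc (Suc n)) j * ?c j)" .
qed

text \<open>The cosine expansion has \<open>n + 1\<close> terms, and its coefficients are uniformly
  bounded because \<open>qpoch q n\<close> converges to a positive limit.\<close>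

lemma qherm_bound:
  assumes "\<bar>q\<bar> < 1"
  obtains B where "0 < B" "\<And>n X. \<bar>X\<bar> \<le> 2 \<Longrightarrow> \<bar>qherm q X n\<bar> \<le> B * real (n + 1)"
proof -
  obtain B where B: "0 < B" "\<And>n. qpoch q n \<le> B" "\<And>n. inverse (qpoch q n) \<le> B"
    using qpoch_bounds[OF assms] by blast
  have qb: "\<bar>qbinom q n j\<bar> \<le> B * (B * B)" for n j
  proof (cases "j \<le> n")
    case True
    have "qbinom q n j = qpoch q n * (inverse (qpoch q j) * inverse (qpoch q (n - j)))"
      using True by (simp add: qbinom_def divide_inverse)
    also have "\<bar>\<dots>\<bar> \<le> B * (B * B)"
      unfolding abs_mult using B qpoch_pos[OF assms]
      by (intro mult_mono) (auto simp: less_imp_le)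
    finally show ?thesis .
  qed (use B in \<open>simp add: qbinom_def\<close>)
  show thesis
  proof (rule that[of "B * (B * B)"])
    fix n and X :: real
    assume "\<bar>X\<bar> \<le> 2"
    then have X: "X = 2 * cos (arccos (X / 2))"
      by (subst cos_arccos) auto
    have "\<bar>qherm q X n\<bar> \<le> (\<Sum>j\<le>n. \<bar>qbinom q n j * cos ((real n - 2 * real j) * arccos (X / 2))\<bar>)"
      by (subst X, subst qherm_cos[OF assms]) (rule sum_abs)
    also have "\<dots> \<le> (\<Sum>j\<le>n. B * (B * B) * 1)"
      unfolding abs_mult using B by (intro sum_mono mult_mono qb) auto
    also have "\<dots> = B * (B * B) * real (n + 1)" by simp
    finally show "\<bar>qherm q X n\<bar> \<le> B * (B * B) * real (n + 1)" .
  qed (use B in auto)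
qed

section \<open>The Poisson--Mehler formula\<close>

text \<open>Dominated by the second derivative of the geometric series.\<close>

lemma summable_Suc_square_power:
  fixes r :: real
  assumes "\<bar>r\<bar> < 1"
  shows "summable (\<lambda>n. real (n + 1) ^ 2 * \<bar>r\<bar> ^ n)"
proof (rule summable_comparison_test')
  have 1: "summable (\<lambda>n. diffs (\<lambda>_. 1 :: real) n * x ^ n)" if "norm x < 1" for x :: real
    using that by (intro termdiff_converges[of _ 1]) (auto intro: summable_geometric)
  have "summable (\<lambda>n. diffs (diffs (\<lambda>_. 1 :: real)) n * \<bar>r\<bar> ^ n)"
    using assms by (intro termdiff_converges[of _ 1] 1) auto
  then show "summable (\<lambda>n. real (n + 1) * real (n + 2) * \<bar>r\<bar> ^ n)"
    by (simp add: diffs_def algebra_simps)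
  show "norm (real (n + 1) ^ 2 * \<bar>r\<bar> ^ n) \<le> real (n + 1) * real (n + 2) * \<bar>r\<bar> ^ n" for n
    by (auto simp: power2_eq_square intro!: mult_right_mono)
qed

definition mehler :: "real \<Rightarrow> real \<Rightarrow> real \<Rightarrow> real \<Rightarrow> real" where
  "mehler q X Y r = (\<Sum>n. qherm q X n * qherm q Y n / qpoch q n * r ^ n)"

text \<open>The \<open>k\<close>-th denominator in \<open>f_CN\<close> is
  \<open>mehler_den X Y (\<rho> q^k)\<close>, with \<open>X\<close> and \<open>Y\<close> the
  arguments scaled by \<open>sqrt (1 - q)\<close>.\<close>

definition mehler_den :: "real \<Rightarrow> real \<Rightarrow> real \<Rightarrow> real" where
  "mehler_den X Y r = (1 - r\<^sup>2)\<^sup>2 - r * (1 + r\<^sup>2) * X * Y + r\<^sup>2 * (X\<^sup>2 + Y\<^sup>2)"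

lemma mehler_term_bound:
  assumes "\<bar>q\<bar> < 1"
  obtains B where "0 < B" "\<And>n X Y r. \<bar>X\<bar> \<le> 2 \<Longrightarrow> \<bar>Y\<bar> \<le> 2 \<Longrightarrow>
    \<bar>qherm q X n * qherm q Y n / qpoch q n * r ^ n\<bar> \<le> B * (real (n + 1) ^ 2 * \<bar>r\<bar> ^ n)"
proof -
  obtain B where B: "0 < B" "\<And>n. qpoch q n \<le> B" "\<And>n. inverse (qpoch q n) \<le> B"
    using qpoch_bounds[OF assms] by blast
  obtain C where C: "0 < C" "\<And>n X. \<bar>X\<bar> \<le> 2 \<Longrightarrow> \<bar>qherm q X n\<bar> \<le> C * real (n + 1)"
    using qherm_bound[OF assms] by blast
  show thesis
  proof (rule that[of "C * C * B"])
    fix n and X Y r :: real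
    assume XY: "\<bar>X\<bar> \<le> 2" "\<bar>Y\<bar> \<le> 2"
    have p: "\<bar>inverse (qpoch q n)\<bar> \<le> B"
      using B(3)[of n] qpoch_pos[OF assms, of n] by simp
    have "\<bar>qherm q X n * qherm q Y n / qpoch q n * r ^ n\<bar> =
        \<bar>qherm q X n\<bar> * \<bar>qherm q Y n\<bar> * \<bar>inverse (qpoch q n)\<bar> * \<bar>r\<bar> ^ n"
      by (simp add: abs_mult divide_inverse power_abs)
    also have "\<dots> \<le> (C * real (n + 1)) * (C * real (n + 1)) * B * \<bar>r\<bar> ^ n"
      using XY B(1) C(1) by (intro mult_mono p C(2)) auto
    also have "\<dots> = C * C * B * (real (n + 1) ^ 2 * \<bar>r\<bar> ^ n)"
      by (simp add: power2_eq_square algebra_simps)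
    finally show "\<bar>qherm q X n * qherm q Y n / qpoch q n * r ^ n\<bar> \<le>
      C * C * B * (real (n + 1) ^ 2 * \<bar>r\<bar> ^ n)" .
  qed (use B C in auto)
qed

lemma mehler_summable:
  assumes "\<bar>q\<bar> < 1" "\<bar>r\<bar> < 1" "\<bar>X\<bar> \<le> 2" "\<bar>Y\<bar> \<le> 2"
  shows "summable (\<lambda>n. qherm q X n * qherm q Y n / qpoch q n * r ^ n)"
proof -
  obtain B where B: "0 < B" "\<And>n X Y r. \<bar>X\<bar> \<le> 2 \<Longrightarrow> \<bar>Y\<bar> \<le> 2 \<Longrightarrow>
    \<bar>qherm q X n * qherm q Y n / qpoch q n * r ^ n\<bar> \<le> B * (real (n + 1) ^ 2 * \<bar>r\<bar> ^ n)"
    using mehler_term_bound[OF assms(1)] by blast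
  show ?thesis
    by (rule summable_comparison_test'[OF summable_mult[OF summable_Suc_square_power[OF assms(2)], of B]])
      (use B(2)[OF assms(3,4)] in simp)
qed

lemma sums_shift_power:
  fixes a :: "nat \<Rightarrow> real"
  assumes "(\<lambda>n. a n * r ^ n) sums s"
  shows "(\<lambda>n. (if n < k then 0 else a (n - k)) * r ^ n) sums (r ^ k * s)"
  using sums_mult[OF assms, of "r ^ k"]
  by (subst sums_zero_iff_shift[of k, symmetric]) (simp_all add: power_add mult_ac)

text \<open>Products of two solutions of the three-term recurrence satisfy a recurrence of order
  four: mixed products such as \<open>h (n+1) * g n\<close> cancel in this combination. It is the
  functional equation of the Mehler series on the level of coefficients, cleared of
  \<open>qpoch\<close>.\<close>

lemma qherm_product_rec:
  fixes n :: nat and q X Y :: real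
  defines "h \<equiv> qherm q X" and "g \<equiv> qherm q Y"
  shows "h (n+4) * g (n+4) - X * Y * (h (n+3) * g (n+3))
      + (X\<^sup>2 + Y\<^sup>2 - 2 + (1 + q) * q ^ (n+2)) * (1 - q ^ (n+3)) * (h (n+2) * g (n+2))
      - X * Y * (1 - q ^ (n+3)) * (1 - q ^ (n+2)) * (h (n+1) * g (n+1))
      + (1 - q ^ (n+1)) * (1 - q ^ (n+3)) * (1 - q ^ (n+2)) * (1 - q ^ (n+1)) * (h n * g n) = 0"
proof -
  have rec: "qherm q Z (n+2) = Z * qherm q Z (n+1) - (1 - q * q ^ n) * qherm q Z n"
       "qherm q Z (n+3) = Z * qherm q Z (n+2) - (1 - q\<^sup>2 * q ^ n) * qherm q Z (n+1)"
       "qherm q Z (n+4) = Z * qherm q Z (n+3) - (1 - q\<^sup>2 * q * q ^ n) * qherm q Z (n+2)" for Z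
    by (simp_all add: numeral_eq_Suc)
  have pw: "q ^ (n+1) = q * q ^ n" "q ^ (n+2) = q\<^sup>2 * q ^ n" "q ^ (n+3) = q\<^sup>2 * q * q ^ n"
    by (simp_all add: numeral_eq_Suc)
  show ?thesis
    unfolding h_def g_def rec pw by algebra
qed

lemma mehler_functional_equation:
  assumes q: "\<bar>q\<bar> < 1" and r: "\<bar>r\<bar> < 1" and X: "\<bar>X\<bar> \<le> 2" and Y: "\<bar>Y\<bar> \<le> 2"
  shows "mehler_den X Y r * mehler q X Y r = (1 - r\<^sup>2) * (1 - q * r\<^sup>2) * mehler q X Y (q * r)"
proof -
  define a where "a n = qherm q X n * qherm q Y n / qpoch q n" for n
  define M M' where "M = mehler q X Y r" and "M' = mehler q X Y (q * r)"
  have nz: "qpoch q n \<noteq> 0" "1 - q ^ Suc n \<noteq> 0" for n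
    using qpoch_pos[OF q, of n] power_less_one_abs[OF q, of n] by auto
  have qr: "\<bar>q * r\<bar> < 1"
    using q r by (metis abs_mult abs_ge_zero mult_strict_mono mult_1 less_eq_real_def zero_less_one)
  have S: "(\<lambda>n. a n * r ^ n) sums M" "(\<lambda>n. a n * (q * r) ^ n) sums M'"
    unfolding a_def M_def M'_def mehler_def
    using mehler_summable[OF q r X Y] mehler_summable[OF q qr X Y] by (simp_all add: summable_sums)
  \<comment> \<open>\<open>?s k\<close> is the coefficient sequence of \<open>r^k\<close> times the
    series at \<open>r\<close>; for the series at \<open>q * r\<close> the further factor
    \<open>q ^ (n - k)\<close> appears.\<close>
  let ?s = "\<lambda>k n. if n < k then 0 else a (n - k)"
  note shift = sums_shift_power[OF S(1)]
  have shift': "(\<lambda>n. ?s k n * q ^ (n - k) * r ^ n) sums (r ^ k * M')" for k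
  proof -
    have "(\<lambda>n. a n * q ^ n * r ^ n) sums M'"
      using S(2) by (simp add: power_mult_distrib mult.assoc)
    moreover have "(if n < k then 0 else a (n - k) * q ^ (n - k)) = ?s k n * q ^ (n - k)" for n
      by simp
    ultimately show ?thesis
      using sums_shift_power[of "\<lambda>n. a n * q ^ n" r M' k] by (simp only:)
  qed
  \<comment> \<open>\<open>?c n\<close> is the coefficient of \<open>r^n\<close> in the difference
    of both sides, with \<open>mehler_den\<close> expanded as
    \<open>1 - X Y r + (X^2 + Y^2 - 2) r^2 - X Y r^3 + r^4\<close> and
    \<open>(1 - r^2) (1 - q r^2)\<close> as \<open>1 - (1 + q) r^2 + q r^4\<close>.\<close>
  let ?c = "\<lambda>n. (?s 0 n - X * Y * ?s 1 n + (X\<^sup>2 + Y\<^sup>2 - 2) * ?s 2 n - X * Y * ?s 3 n + ?s 4 n)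
    - (?s 0 n * q ^ (n - 0) - (1 + q) * (?s 2 n * q ^ (n - 2)) + q * (?s 4 n * q ^ (n - 4)))"
  have "(\<lambda>n. (?s 0 n * r ^ n - X * Y * (?s 1 n * r ^ n) + (X\<^sup>2 + Y\<^sup>2 - 2) * (?s 2 n * r ^ n)
        - X * Y * (?s 3 n * r ^ n) + ?s 4 n * r ^ n)
      - (?s 0 n * q ^ (n - 0) * r ^ n - (1 + q) * (?s 2 n * q ^ (n - 2) * r ^ n)
        + q * (?s 4 n * q ^ (n - 4) * r ^ n)))
    sums ((r ^ 0 * M - X * Y * (r ^ 1 * M) + (X\<^sup>2 + Y\<^sup>2 - 2) * (r ^ 2 * M)
        - X * Y * (r ^ 3 * M) + r ^ 4 * M)
      - (r ^ 0 * M' - (1 + q) * (r ^ 2 * M') + q * (r ^ 4 * M')))" (is "?f sums ?S")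
    by (intro sums_diff sums_add sums_mult shift shift')
  also have "?f = (\<lambda>n. ?c n * r ^ n)"
    by (rule ext) (simp only: algebra_simps)
  also have "(\<lambda>n. ?c n * r ^ n) = (\<lambda>n. 0)"
  proof
    fix n :: nat
    have p: "qpoch q 2 = (1 - q) * (1 - q\<^sup>2)" "qpoch q 3 = (1 - q) * (1 - q\<^sup>2) * (1 - q ^ 3)"
      by (simp_all add: qpoch_def numeral_eq_Suc)
    have p1: "1 - q \<noteq> 0" "1 - q\<^sup>2 \<noteq> 0" "1 - q ^ 3 \<noteq> 0"
      using nz(2)[of 0] nz(2)[of 1] nz(2)[of 2] by (simp_all add: numeral_eq_Suc)
    have a0: "a 0 = 1" by (simp add: a_def)
    have a1: "a 1 * (1 - q) = X * Y" using p1 by (simp add: a_def qpoch_def)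
    have h2: "qherm q Z 2 = Z\<^sup>2 - (1 - q)" "qherm q Z 3 = Z * (Z\<^sup>2 - (1 - q)) - (1 - q\<^sup>2) * Z" for Z
      by (simp_all add: numeral_eq_Suc)
    have a2: "a 2 * (1 - q) * (1 - q\<^sup>2) = (X\<^sup>2 - (1 - q)) * (Y\<^sup>2 - (1 - q))"
      using p1 by (simp add: a_def p h2)
    have a3: "a 3 * (1 - q) * (1 - q\<^sup>2) * (1 - q ^ 3) =
        (X * (X\<^sup>2 - (1 - q)) - (1 - q\<^sup>2) * X) * (Y * (Y\<^sup>2 - (1 - q)) - (1 - q\<^sup>2) * Y)"
      using p1 by (simp add: a_def p h2)
    \<comment> \<open>The recurrence of order four applies from index 4 on; the initial coefficients
      are compared through their explicit values.\<close>
    consider "n = 0" | "n = 1" | "n = 2" | "n = 3" | m where "n = m + 4"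
    proof -
      have "n = 0 \<or> n = 1 \<or> n = 2 \<or> n = 3 \<or> (\<exists>m. n = m + 4)" by presburger
      then show thesis using that by blast
    qed
    then have "?c n = 0"
    proof cases
      case 3
      have c: "?c n = a 2 - X * Y * a 1 + (X\<^sup>2 + Y\<^sup>2 - 2) * a 0 - (a 2 * q\<^sup>2 - (1 + q) * a 0)"
        using 3 by simp
      have "(1 - q) * (?c n) = 0"
        unfolding c using a0 a1 a2 by algebra
      then show ?thesis using p1 by simp
    next
      case 4
      have c: "?c n = a 3 - X * Y * a 2 + (X\<^sup>2 + Y\<^sup>2 - 2) * a 1 - X * Y * a 0
          - (a 3 * q ^ 3 - (1 + q) * (a 1 * q))"
        using 4 by (simp add: numeral_eq_Suc)
      have "(1 - q) * (1 - q\<^sup>2) * (?c n) = 0"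
        unfolding c using a0 a1 a2 a3 by algebra
      then show ?thesis using p1 by simp
    next
      case (5 m)
      define u where "u = qpoch q m"
      have u: "qpoch q (m+1) = (1 - q ^ (m+1)) * u" "qpoch q (m+2) = (1 - q ^ (m+2)) * ((1 - q ^ (m+1)) * u)"
         "qpoch q (m+3) = (1 - q ^ (m+3)) * ((1 - q ^ (m+2)) * ((1 - q ^ (m+1)) * u))"
         "qpoch q (m+4) = (1 - q ^ (m+4)) * ((1 - q ^ (m+3)) * ((1 - q ^ (m+2)) * ((1 - q ^ (m+1)) * u)))"
        by (simp_all add: qpoch_Suc u_def numeral_eq_Suc)
      have f: "1 - q ^ (m+1) \<noteq> 0" "1 - q ^ (m+2) \<noteq> 0" "1 - q ^ (m+3) \<noteq> 0" "1 - q ^ (m+4) \<noteq> 0" "u \<noteq> 0"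
        using nz(2)[of m] nz(2)[of "m+1"] nz(2)[of "m+2"] nz(2)[of "m+3"] nz(1)[of m]
        by (simp_all add: u_def numeral_eq_Suc)
      define h g where "h = qherm q X" and "g = qherm q Y"
      \<comment> \<open>\<open>a (m+4)\<close> enters only with the factor
        \<open>1 - q ^ (m+4)\<close>, the last factor of \<open>qpoch q (m+4)\<close>, so
        \<open>qpoch q (m+3)\<close> clears every denominator.\<close>
      have A: "(1 - q ^ (m+4)) * a (m+4) * qpoch q (m+3) = h (m+4) * g (m+4)"
        "a (m+3) * qpoch q (m+3) = h (m+3) * g (m+3)"
        "a (m+2) * qpoch q (m+3) = (1 - q ^ (m+3)) * (h (m+2) * g (m+2))"
        "a (m+1) * qpoch q (m+3) = (1 - q ^ (m+3)) * (1 - q ^ (m+2)) * (h (m+1) * g (m+1))"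
        "a m * qpoch q (m+3) = (1 - q ^ (m+3)) * (1 - q ^ (m+2)) * (1 - q ^ (m+1)) * (h m * g m)"
        unfolding a_def u h_def g_def u_def[symmetric] using f by simp_all
      have pw: "q * q ^ m = q ^ (m+1)" by simp
      have c: "?c n = (1 - q ^ (m+4)) * a (m+4) - X * Y * a (m+3)
          + (X\<^sup>2 + Y\<^sup>2 - 2 + (1 + q) * q ^ (m+2)) * a (m+2) - X * Y * a (m+1) + (1 - q ^ (m+1)) * a m"
      proof -
        have i: "n - 0 = m + 4" "n - 1 = m + 3" "n - 2 = m + 2" "n - 3 = m + 1" "n - 4 = m"
          "\<not> n < 0" "\<not> n < 1" "\<not> n < 2" "\<not> n < 3" "\<not> n < 4"
          using 5 by auto
        have si: "?s 0 n = a (m+4)" "?s 1 n = a (m+3)" "?s 2 n = a (m+2)" "?s 3 n = a (m+1)" "?s 4 n = a m"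
          by (simp_all only: i if_False)
        show ?thesis
          unfolding si unfolding i(1,3,5) by (simp add: algebra_simps)
      qed
      have "?c n * qpoch q (m+3) = (1 - q ^ (m+4)) * a (m+4) * qpoch q (m+3)
          - X * Y * (a (m+3) * qpoch q (m+3))
          + (X\<^sup>2 + Y\<^sup>2 - 2 + (1 + q) * q ^ (m+2)) * (a (m+2) * qpoch q (m+3))
          - X * Y * (a (m+1) * qpoch q (m+3)) + (1 - q ^ (m+1)) * (a m * qpoch q (m+3))"
        unfolding c by (simp only: algebra_simps)
      also have "\<dots> = 0"
        unfolding A using qherm_product_rec[of q X m Y] unfolding h_def[symmetric] g_def[symmetric]
        by (simp only: mult.assoc)
      finally show ?thesis using nz(1)[of "m+3"] by simp
    qed (use a0 a1 in \<open>simp_all add: algebra_simps\<close>)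
    then show "?c n * r ^ n = 0" by simp
  qed
  finally have "?S = 0"
    using sums_unique2 sums_zero by blast
  then show ?thesis
    unfolding mehler_den_def M_def[symmetric] M'_def[symmetric] by algebra
qed

text \<open>With \<open>X = 2 cos a\<close> and \<open>Y = 2 cos b\<close> the quartic factors as
  \<open>|1 - r e^(i(a+b))|^2 |1 - r e^(i(a-b))|^2\<close>, and neither factor vanishes for
  \<open>|r| < 1\<close>.\<close>

lemma mehler_den_pos:
  assumes "\<bar>X\<bar> \<le> 2" "\<bar>Y\<bar> \<le> 2" "\<bar>r\<bar> < 1"
  shows "0 < mehler_den X Y r"
proof -
  define a b where "a = arccos (X / 2)" and "b = arccos (Y / 2)"
  have XY: "X = 2 * cos a" "Y = 2 * cos b"
    using assms unfolding a_def b_def by (subst cos_arccos, auto)+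
  have pos: "0 < 1 - 2 * r * cos c + r\<^sup>2" for c
  proof -
    have "\<bar>r * cos c\<bar> \<le> \<bar>r\<bar> * 1"
      unfolding abs_mult by (intro mult_left_mono) auto
    moreover have "0 < (1 - \<bar>r\<bar>)\<^sup>2" using assms by simp
    ultimately show ?thesis by (simp add: power2_eq_square algebra_simps abs_le_iff)
  qed
  have "mehler_den X Y r = (1 - 2 * r * cos (a + b) + r\<^sup>2) * (1 - 2 * r * cos (a - b) + r\<^sup>2)"
  proof -
    have s: "(sin a)\<^sup>2 = 1 - (cos a)\<^sup>2" "(sin b)\<^sup>2 = 1 - (cos b)\<^sup>2"
      by (simp_all add: sin_squared_eq)
    show ?thesis
      unfolding mehler_den_def XY cos_add cos_diff using s by algebra
  qed
  then show ?thesis using pos by simp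
qed

lemma summable_power_abs:
  fixes q :: real
  assumes "\<bar>q\<bar> < 1"
  shows "summable (\<lambda>k. \<bar>q\<bar> ^ k)"
  using assms by (simp add: summable_geometric)

lemma convergent_mehler_num:
  fixes q r :: real
  assumes "\<bar>q\<bar> < 1"
  shows "convergent_prod (\<lambda>k. 1 - r\<^sup>2 * q ^ k)"
  by (rule convergent_prod_one_minus)
    (use summable_mult[OF summable_power_abs[OF assms], of "r\<^sup>2"] in \<open>simp add: abs_mult power_abs\<close>)

lemma abs_mult_power_less:
  fixes q r :: real
  assumes "\<bar>q\<bar> < 1" "\<bar>r\<bar> < 1"
  shows "\<bar>r * q ^ k\<bar> < 1"
proof -
  have "\<bar>r\<bar> * \<bar>q\<bar> ^ k \<le> \<bar>r\<bar> * 1"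
    using assms by (intro mult_left_mono power_le_one) auto
  then show ?thesis using assms by (simp add: abs_mult power_abs)
qed

lemma convergent_mehler_den:
  assumes q: "\<bar>q\<bar> < 1" and r: "\<bar>r\<bar> < 1" and X: "\<bar>X\<bar> \<le> 2" and Y: "\<bar>Y\<bar> \<le> 2"
  shows "convergent_prod (\<lambda>k. mehler_den X Y (r * q ^ k))"
proof -
  let ?e = "\<lambda>u. u ^ 4 - 2 * u\<^sup>2 - u * (1 + u\<^sup>2) * X * Y + u\<^sup>2 * (X\<^sup>2 + Y\<^sup>2)"
  \<comment> \<open>The constant is \<open>1 + 2 + 8 + 8\<close>, one summand for each term of
    \<open>?e\<close>.\<close>
  have bd: "\<bar>?e u\<bar> \<le> 19 * \<bar>u\<bar>" if u: "\<bar>u\<bar> < 1" for u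
  proof -
    have u2: "u\<^sup>2 \<le> \<bar>u\<bar>" "u\<^sup>2 \<le> 1"
      using u mult_left_mono[of "\<bar>u\<bar>" 1 "\<bar>u\<bar>"] by (auto simp: power2_eq_square abs_mult_self_eq
         simp flip: abs_mult)
    have u4: "u ^ 4 \<le> u\<^sup>2" using u2(2) mult_left_mono[of "u\<^sup>2" 1 "u\<^sup>2"]
      by (simp add: power2_eq_square power4_eq_xxxx mult.assoc)
    have X2: "X\<^sup>2 \<le> 4" "Y\<^sup>2 \<le> 4"
      using X Y abs_le_square_iff[of X 2] abs_le_square_iff[of Y 2] by auto
    have a: "\<bar>u * (1 + u\<^sup>2) * X * Y\<bar> \<le> \<bar>u\<bar> * 2 * 2 * 2"
      unfolding abs_mult using X Y u2 by (intro mult_mono) auto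
    have b: "u\<^sup>2 * (X\<^sup>2 + Y\<^sup>2) \<le> \<bar>u\<bar> * 8"
      using X2 u2 by (intro mult_mono) auto
    have c: "0 \<le> u\<^sup>2 * (X\<^sup>2 + Y\<^sup>2)" "0 \<le> u ^ 4" "0 \<le> u\<^sup>2" by auto
    show ?thesis
      using a b c u2 u4 by linarith
  qed
  have "summable (\<lambda>k. norm (?e (r * q ^ k)))"
  proof (rule summable_comparison_test'[OF summable_mult[OF summable_power_abs[OF q], of "19"]])
    fix k
    have "\<bar>?e (r * q ^ k)\<bar> \<le> 19 * \<bar>r * q ^ k\<bar>"
      by (rule bd[OF abs_mult_power_less[OF q r]])
    also have "\<dots> \<le> 19 * (1 * \<bar>q\<bar> ^ k)"
      unfolding abs_mult power_abs using r by (intro mult_left_mono mult_right_mono) auto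
    finally show "norm (norm (?e (r * q ^ k))) \<le> 19 * \<bar>q\<bar> ^ k" by simp
  qed
  from convergent_prod_one_minus(1)[OF this]
  moreover have "1 + ?e u = mehler_den X Y u" for u
    unfolding mehler_den_def by algebra
  ultimately show ?thesis by simp
qed

text \<open>Positivity, invisible in the series, is read off from the product; nonnegativity of the
  transition kernel rests on it.\<close>

theorem mehler_formula:
  assumes q: "\<bar>q\<bar> < 1" and r: "\<bar>r\<bar> < 1" and X: "\<bar>X\<bar> \<le> 2" and Y: "\<bar>Y\<bar> \<le> 2"
  shows "mehler q X Y r = (\<Prod>k. (1 - r\<^sup>2 * q ^ k) / mehler_den X Y (r * q ^ k))"
    and "0 < mehler q X Y r"
proof -
  let ?n = "\<lambda>k. 1 - r\<^sup>2 * q ^ k" and ?d = "\<lambda>k. mehler_den X Y (r * q ^ k)"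
  \<comment> \<open>One use of the functional equation at \<open>r q^N\<close> trades one
    denominator for the two numerators with \<open>q^(2N)\<close> and \<open>q^(2N+1)\<close>; hence
    the range \<open>2 * N\<close>.\<close>
  have iter: "(\<Prod>k<N. ?d k) * mehler q X Y r = (\<Prod>k<2*N. ?n k) * mehler q X Y (r * q ^ N)" for N
  proof (induction N)
    case (Suc N)
    have "(\<Prod>k<Suc N. ?d k) * mehler q X Y r = ?d N * ((\<Prod>k<N. ?d k) * mehler q X Y r)" by simp
    also have "\<dots> = (\<Prod>k<2*N. ?n k) * (?d N * mehler q X Y (r * q ^ N))"
      unfolding Suc by simp
    also have "?d N * mehler q X Y (r * q ^ N) =
        (1 - (r * q ^ N)\<^sup>2) * (1 - q * (r * q ^ N)\<^sup>2) * mehler q X Y (q * (r * q ^ N))"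
      by (rule mehler_functional_equation[OF q abs_mult_power_less[OF q r] X Y])
    also have "(r * q ^ N)\<^sup>2 = r\<^sup>2 * q ^ (2 * N)"
      by (simp add: power_mult_distrib flip: power_mult) (simp add: mult.commute)
    finally show ?case by (simp add: mult_ac)
  qed simp
  \<comment> \<open>Any nonzero point of convergence serves here: it makes the power series
    continuous at 0, the limit of \<open>r q^N\<close>.\<close>
  have "summable (\<lambda>n. qherm q X n * qherm q Y n / qpoch q n * (1/2) ^ n)"
    by (rule mehler_summable[OF q _ X Y]) simp
  then have "isCont (\<lambda>r. \<Sum>n. qherm q X n * qherm q Y n / qpoch q n * r ^ n) 0"
    by (rule isCont_powser) simp
  then have cont: "isCont (mehler q X Y) 0"
    by (simp add: mehler_def[abs_def])
  have m0: "mehler q X Y 0 = 1"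
    unfolding mehler_def by (subst powser_zero) simp
  have "(\<lambda>N. r * q ^ N) \<longlonglongrightarrow> r * 0"
    using q by (intro tendsto_mult tendsto_const LIMSEQ_power_zero) simp
  then have lim0: "(\<lambda>N. mehler q X Y (r * q ^ N)) \<longlonglongrightarrow> 1"
    using isCont_tendsto_compose[OF cont] m0 by simp
  have n: "convergent_prod ?n" by (rule convergent_mehler_num[OF q])
  have d: "convergent_prod ?d" by (rule convergent_mehler_den[OF assms])
  have limd: "(\<lambda>N. (\<Prod>k<N. ?d k) * mehler q X Y r) \<longlonglongrightarrow> prodinf ?d * mehler q X Y r"
    by (intro tendsto_mult prod_lessThan_tendsto_prodinf d tendsto_const)
  have "(\<lambda>N. \<Prod>k<2*N. ?n k) \<longlonglongrightarrow> prodinf ?n"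
    using LIMSEQ_subseq_LIMSEQ[OF prod_lessThan_tendsto_prodinf[OF n], of "\<lambda>N. 2 * N"]
    by (simp add: strict_mono_def o_def)
  from tendsto_mult[OF this lim0]
  have "(\<lambda>N. (\<Prod>k<N. ?d k) * mehler q X Y r) \<longlonglongrightarrow> prodinf ?n"
    unfolding iter by simp
  with limd have eq: "prodinf ?d * mehler q X Y r = prodinf ?n"
    using LIMSEQ_unique by blast
  have dpos: "0 < prodinf ?d"
    by (rule less_0_prodinf[OF d mehler_den_pos[OF X Y abs_mult_power_less[OF q r]]])
  have npos: "0 < prodinf ?n"
  proof (rule less_0_prodinf[OF n])
    fix k
    have "\<bar>r * (r * q ^ k)\<bar> < 1"
      unfolding abs_mult[of r "r * q ^ k"]
      using r abs_mult_power_less[OF q r, of k]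
      by (metis abs_ge_zero mult_strict_mono mult_1 less_eq_real_def zero_less_one)
    then show "0 < ?n k" by (simp add: power2_eq_square mult.assoc abs_less_iff)
  qed
  have dnz: "?d k \<noteq> 0" for k
    using mehler_den_pos[OF X Y abs_mult_power_less[OF q r, of k]] by simp
  have eq': "mehler q X Y r = prodinf ?n / prodinf ?d"
    using eq dpos by (simp add: field_simps)
  then show "mehler q X Y r = (\<Prod>k. ?n k / ?d k)"
    using prodinf_divide[OF n d] dnz by simp
  show "0 < mehler q X Y r"
    using eq' dpos npos by simp
qed

section \<open>Orthogonality of the q-Hermite polynomials\<close>

text \<open>At \<open>X = 2 cos t\<close> this is
  \<open>1 - 2 q^k cos (2t) + q^(2k) = |1 - q^k e^(2it)|^2\<close>; for \<open>k = 0\<close> it is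
  \<open>4 - X^2\<close>.\<close>

definition weight_factor :: "real \<Rightarrow> real \<Rightarrow> nat \<Rightarrow> real" where
  "weight_factor q X k = (1 + q ^ k)\<^sup>2 - X\<^sup>2 * q ^ k"

definition weight_upto :: "real \<Rightarrow> nat \<Rightarrow> real \<Rightarrow> real" where
  "weight_upto q N X = (\<Prod>k<N. weight_factor q X k)"

definition theta_moment :: "real \<Rightarrow> nat \<Rightarrow> nat \<Rightarrow> real" where
  "theta_moment q N n = (LBINT t:{0..pi}. weight_upto q N (2 * cos t) * qherm q (2 * cos t) n)"

lemma continuous_on_qherm [continuous_intros]:
  "continuous_on A f \<Longrightarrow> continuous_on A (\<lambda>t. qherm q (f t) n)"
proof (induction n rule: induct_nat_012)
  case (ge2 n)
  then show ?case by (auto intro!: continuous_intros)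
qed auto

lemma continuous_on_weight_upto [continuous_intros]:
  "continuous_on A f \<Longrightarrow> continuous_on A (\<lambda>t. weight_upto q N (f t))"
  unfolding weight_upto_def weight_factor_def by (intro continuous_intros)

lemma set_integrable_theta:
  "set_integrable lborel {0..pi} (\<lambda>t. weight_upto q N (2 * cos t) * qherm q (2 * cos t) n)"
  by (intro borel_integrable_atLeastAtMost' continuous_intros)

text \<open>Each further factor of the weight is quadratic in \<open>X\<close>, so the three-term
  recurrence is used twice.\<close>

lemma qherm_times_square:
  "X\<^sup>2 * qherm q X n = qherm q X (n + 2) + (2 - q ^ n - q ^ (n + 1)) * qherm q X n +
    (if n < 2 then 0 else (1 - q ^ n) * (1 - q ^ (n - 1)) * qherm q X (n - 2))"
proof -
  consider "n = 0" | "n = 1" | m where "n = Suc (Suc m)"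
    by (metis One_nat_def not0_implies_Suc)
  then show ?thesis
  proof cases
    case (3 m)
    have s: "n + 2 = Suc (Suc (Suc (Suc m)))" "n + 1 = Suc (Suc (Suc m))" "n - 1 = Suc m" "n - 2 = m"
      "\<not> n < 2" using 3 by auto
    show ?thesis unfolding s if_False unfolding 3
      by (simp add: algebra_simps power2_eq_square)
  qed (simp_all add: algebra_simps power2_eq_square numeral_eq_Suc)
qed

text \<open>The moments \<open>theta_moment\<close> against the partial products of the weight obey a recurrence in \<open>N\<close>, which
  the closed form \<open>theta_val\<close> solves.  This takes the place of the Jacobi triple product.\<close>

lemma theta_moment_Suc:
  "theta_moment q (Suc N) n =
     (1 + (q ^ N)\<^sup>2 + q ^ N * (q ^ n + q ^ (n + 1))) * theta_moment q N n
     - q ^ N * theta_moment q N (n + 2)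
     - (if n < 2 then 0 else q ^ N * (1 - q ^ n) * (1 - q ^ (n - 1)) * theta_moment q N (n - 2))"
proof -
  let ?I = "\<lambda>n t. weight_upto q N (2 * cos t) * qherm q (2 * cos t) n"
  let ?a = "1 + (q ^ N)\<^sup>2 + q ^ N * (q ^ n + q ^ (n + 1))"
  let ?b = "if n < 2 then 0 else q ^ N * (1 - q ^ n) * (1 - q ^ (n - 1))"
  have "weight_upto q (Suc N) (2 * cos t) * qherm q (2 * cos t) n =
      ?a * ?I n t - q ^ N * ?I (n + 2) t - ?b * ?I (n - 2) t" for t
  proof -
    let ?X = "2 * cos t"
    have "weight_upto q (Suc N) ?X * qherm q ?X n =
        weight_upto q N ?X * ((1 + q ^ N)\<^sup>2 * qherm q ?X n - q ^ N * (?X\<^sup>2 * qherm q ?X n))"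
      by (simp add: weight_upto_def weight_factor_def algebra_simps)
    also have "\<dots> = ?a * ?I n t - q ^ N * ?I (n + 2) t - ?b * ?I (n - 2) t"
      unfolding qherm_times_square by (auto simp: algebra_simps power2_eq_square)
    finally show ?thesis .
  qed
  then have "theta_moment q (Suc N) n =
      (LBINT t:{0..pi}. ?a * ?I n t - q ^ N * ?I (n + 2) t - ?b * ?I (n - 2) t)"
    unfolding theta_moment_def by simp
  also have "\<dots> = ?a * theta_moment q N n - q ^ N * theta_moment q N (n + 2)
      - ?b * theta_moment q N (n - 2)"
    unfolding theta_moment_def
    by (subst set_integral_diff | intro set_integral_diff set_integrable_mult_right set_integrable_theta
        | simp only: set_integral_mult_right)+
  finally show ?thesis by auto
qed

lemma integral_cos_multiple:
  "(LBINT t:{0..pi}. cos (of_int k * t)) = (if k = 0 then pi else 0)"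
proof (cases "k = 0")
  case False
  have "(LBINT t. indicator {0..pi} t *\<^sub>R cos (of_int k * t)) =
      sin (of_int k * pi) / of_int k - sin (of_int k * 0) / of_int k"
    by (rule integral_FTC_Icc)
      (use False in \<open>auto intro!: continuous_intros derivative_eq_intros
        simp: has_real_derivative_iff_has_vector_derivative[symmetric]\<close>)
  then show ?thesis
    using False by (simp add: set_lebesgue_integral_def mult.commute[of _ pi])
qed (simp add: set_lebesgue_integral_def)

text \<open>The empty product has weight 1, so the cosine expansion is integrated termwise and only
  the zero frequency \<open>2 j = n\<close> survives.\<close>

lemma theta_moment_0:
  assumes "\<bar>q\<bar> < 1"
  shows "theta_moment q 0 n = (if even n then pi * qbinom q n (n div 2) else 0)"
proof -
  have "theta_moment q 0 n = (LBINT t:{0..pi}. \<Sum>j\<le>n. qbinom q n j * cos (of_int (int n - 2 * int j) * t))"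
    by (simp add: theta_moment_def weight_upto_def qherm_cos[OF assms])
  also have "\<dots> = (\<Sum>j\<le>n. LBINT t:{0..pi}. qbinom q n j * cos (of_int (int n - 2 * int j) * t))"
    unfolding set_lebesgue_integral_def scaleR_sum_right
    by (rule Bochner_Integration.integral_sum, rule borel_integrable_atLeastAtMost'[unfolded set_integrable_def])
      (intro continuous_intros)
  also have "\<dots> = (\<Sum>j\<le>n. qbinom q n j * (if int n - 2 * int j = 0 then pi else 0))"
    by (simp only: set_integral_mult_right integral_cos_multiple)
  also have "\<dots> = (\<Sum>j\<le>n. if even n \<and> j = n div 2 then pi * qbinom q n (n div 2) else 0)"
    by (intro sum.cong refl) (auto, presburger+)
  also have "\<dots> = (if even n then pi * qbinom q n (n div 2) else 0)"
    by simp
  finally show ?thesis .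
qed

text \<open>At \<open>N = 0\<close> the prefactor \<open>2 / (1 + q^N)\<close> is 1, and what
  remains is \<open>pi\<close> times the central \<open>q\<close>-binomial coefficient. The factor
  \<open>q ^ (N * m)\<close> is what makes the values with \<open>m > 0\<close> vanish as
  \<open>N\<close> grows.\<close>

definition theta_val :: "real \<Rightarrow> nat \<Rightarrow> nat \<Rightarrow> real" where
  "theta_val q N m = pi * 2 * qpoch q (2 * N) * q ^ (N * m) * qpoch q (2 * m) /
     ((1 + q ^ N) * qpoch q N * qpoch q m * qpoch q (N + m))"

lemma one_plus_power_pos:
  fixes q :: real
  assumes "\<bar>q\<bar> < 1"
  shows "0 < 1 + q ^ N"
  using power_less_one_abs[OF assms, of "N - 1"] by (cases N) auto

lemma qpoch_double_Suc:
  "qpoch q (2 * Suc m) =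
    (1 - q ^ (m + 1)) * (1 + q ^ (m + 1)) * (1 - q ^ (2 * m + 1)) * qpoch q (2 * m)"
proof -
  have "2 * m + 2 = (m + 1) * 2" by simp
  then have "q ^ (2 * m + 2) = (q ^ (m + 1))\<^sup>2" by (simp only: power_mult)
  moreover have "qpoch q (2 * Suc m) = (1 - q ^ (2 * m + 2)) * ((1 - q ^ (2 * m + 1)) * qpoch q (2 * m))"
    by (simp add: qpoch_Suc)
  moreover have "1 - (q ^ (m + 1))\<^sup>2 = (1 - q ^ (m + 1)) * (1 + q ^ (m + 1))"
    by (simp add: power2_eq_square algebra_simps)
  ultimately show ?thesis by (simp only: mult.assoc)
qed

text \<open>The ratio of neighbouring values, in \<open>m\<close> here and in \<open>N\<close> in
  the next lemma, is stated without division because \<open>theta_val\<close> may vanish: it does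
  for \<open>q = 0\<close> and positive \<open>N\<close>, \<open>m\<close>.\<close>

lemma theta_val_Suc_right:
  assumes q: "\<bar>q\<bar> < 1"
  shows "theta_val q N (Suc m) * (1 - q ^ (N + m + 1)) =
    theta_val q N m * q ^ N * (1 - q ^ (2 * m + 1)) * (1 + q ^ (m + 1))"
proof -
  have nz: "qpoch q n \<noteq> 0" "1 - q ^ (n + 1) \<noteq> 0" "1 + q ^ n \<noteq> 0" for n
    using qpoch_pos[OF q, of n] power_less_one_abs[OF q, of n] one_plus_power_pos[OF q, of n] by auto
  note e = qpoch_double_Suc[of q m]
  have f: "qpoch q (Suc m) = (1 - q ^ (m + 1)) * qpoch q m"
    "qpoch q (N + Suc m) = (1 - q ^ (N + m + 1)) * qpoch q (N + m)"
    "q ^ (N * Suc m) = q ^ (N * m) * q ^ N"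
    by (simp_all add: qpoch_Suc power_add)
  show ?thesis
    unfolding theta_val_def e f
    using nz(1)[of N] nz(1)[of m] nz(1)[of "N + m"] nz(2)[of m] nz(2)[of "N + m"] nz(3)[of N]
    by (simp add: divide_simps del: power_Suc add_Suc_right)
qed

lemma theta_val_Suc_left:
  assumes q: "\<bar>q\<bar> < 1"
  shows "theta_val q (Suc N) m * (1 - q ^ (N + m + 1)) =
    theta_val q N m * (1 - q ^ (2 * N + 1)) * (1 + q ^ N) * q ^ m"
proof -
  have nz: "qpoch q n \<noteq> 0" "1 - q ^ (n + 1) \<noteq> 0" "1 + q ^ n \<noteq> 0" for n
    using qpoch_pos[OF q, of n] power_less_one_abs[OF q, of n] one_plus_power_pos[OF q, of n] by auto
  note e = qpoch_double_Suc[of q N]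
  have f: "qpoch q (Suc N) = (1 - q ^ (N + 1)) * qpoch q N"
    "qpoch q (Suc N + m) = (1 - q ^ (N + m + 1)) * qpoch q (N + m)"
    "q ^ (Suc N * m) = q ^ (N * m) * q ^ m" "Suc N = N + 1"
    by (simp_all add: qpoch_Suc power_add)
  show ?thesis
    unfolding theta_val_def e f(1-3) unfolding f(4)
    using nz(1)[of N] nz(1)[of m] nz(1)[of "N + m"] nz(2)[of N] nz(2)[of "N + m"] nz(3)[of N] nz(3)[of "N + 1"]
    by (simp add: divide_simps del: power_Suc add_Suc_right)
qed

text \<open>The induction on \<open>N\<close> treats all \<open>m\<close> at once, since the
  recurrence at \<open>m\<close> reaches to \<open>m - 1\<close> and \<open>m + 1\<close>. The case
  \<open>m = 0\<close> stands apart because the lower neighbour is missing.\<close>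

lemma theta_moment_eq:
  assumes q: "\<bar>q\<bar> < 1"
  shows "theta_moment q N (2 * m) = theta_val q N m" "theta_moment q N (2 * m + 1) = 0"
proof -
  have nz: "1 - q ^ (n + 1) \<noteq> 0" for n
    using power_less_one_abs[OF q, of n] by auto
  have "\<forall>m. theta_moment q N (2 * m) = theta_val q N m \<and> theta_moment q N (2 * m + 1) = 0"
  proof (induction N)
    case 0
    have "qpoch q m \<noteq> 0" for m
      using qpoch_pos[OF q, of m] by simp
    then show ?case
      by (simp add: theta_moment_0[OF q] theta_val_def qbinom_def)
  next
    case (Suc N)
    show ?case
    proof (intro allI conjI)
      fix m
      have "theta_moment q N (2 * m + 1 + 2) = 0"
        using Suc[rule_format, of "m + 1"] by (simp add: numeral_eq_Suc)
      moreover have "theta_moment q N (2 * m + 1 - 2) = 0" if "\<not> 2 * m + 1 < 2"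
      proof -
        from that have "2 * m + 1 - 2 = 2 * (m - 1) + 1" by simp
        then show ?thesis using Suc by metis
      qed
      ultimately show "theta_moment q (Suc N) (2 * m + 1) = 0"
        using Suc by (subst theta_moment_Suc) auto
      show "theta_moment q (Suc N) (2 * m) = theta_val q (Suc N) m"
      proof (cases m)
        case 0
        define Q where "Q = q ^ N"
        have pw: "q ^ (N + 0 + 1) = q * Q" "q ^ (2 * 0 + 1) = q" "q ^ (0 + 1) = q" "q ^ (2 * N + 1) = q * Q\<^sup>2"
          by (simp_all add: Q_def power_mult mult.commute[of 2])
        have L2: "theta_val q N (Suc 0) * (1 - q * Q) = theta_val q N 0 * Q * (1 - q) * (1 + q)"
          using theta_val_Suc_right[OF q, of N 0] unfolding pw Q_def[symmetric] .
        have L': "theta_val q (Suc N) 0 * (1 - q * Q) = theta_val q N 0 * (1 - q * Q\<^sup>2) * (1 + Q)"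
          using theta_val_Suc_left[OF q, of N 0] unfolding pw Q_def[symmetric] by simp
        have "theta_moment q (Suc N) 0 = (1 + Q\<^sup>2 + Q * (1 + q)) * theta_val q N 0 - Q * theta_val q N (Suc 0)"
          using Suc[rule_format, of 0] Suc[rule_format, of 1] unfolding Q_def
          by (subst theta_moment_Suc) (simp add: numeral_eq_Suc)
        moreover have "\<dots> * (1 - q * Q) = theta_val q (Suc N) 0 * (1 - q * Q)"
          using L2 L' by algebra
        moreover have "1 - q * Q \<noteq> 0"
          using nz[of N] by (simp add: Q_def)
        ultimately show ?thesis using 0 by simp
      next
        case (Suc k)
        define Q y where "Q = q ^ N" and "y = q ^ k"
        have pw: "q ^ (N + k + 1) = q * Q * y" "q ^ (N + Suc k + 1) = q\<^sup>2 * Q * y" "q ^ (k + 1) = q * y"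
           "q ^ (Suc k + 1) = q\<^sup>2 * y" "q ^ (2 * k + 1) = q * y\<^sup>2" "q ^ (2 * Suc k + 1) = q ^ 3 * y\<^sup>2"
           "q ^ (2 * N + 1) = q * Q\<^sup>2" "q ^ Suc k = q * y" "q ^ (2 * Suc k) = q\<^sup>2 * y\<^sup>2"
           "q ^ (2 * Suc k - 1) = q * y\<^sup>2"
          by (simp_all add: Q_def y_def power_add power_mult mult.commute[of 2] power2_eq_square power3_eq_cube
              mult_ac)
        have L1: "theta_val q N (Suc k) * (1 - q * Q * y) = theta_val q N k * Q * (1 - q * y\<^sup>2) * (1 + q * y)"
          using theta_val_Suc_right[OF q, of N k] unfolding pw Q_def[symmetric] .
        have L2: "theta_val q N (Suc (Suc k)) * (1 - q\<^sup>2 * Q * y) =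
            theta_val q N (Suc k) * Q * (1 - q ^ 3 * y\<^sup>2) * (1 + q\<^sup>2 * y)"
          using theta_val_Suc_right[OF q, of N "Suc k"] unfolding pw Q_def[symmetric] .
        have L': "theta_val q (Suc N) (Suc k) * (1 - q\<^sup>2 * Q * y) =
            theta_val q N (Suc k) * (1 - q * Q\<^sup>2) * (1 + Q) * (q * y)"
          using theta_val_Suc_left[OF q, of N "Suc k"] unfolding pw Q_def[symmetric] .
        have IH: "theta_moment q N (2 * Suc k + 2) = theta_val q N (Suc (Suc k))"
          "theta_moment q N (2 * Suc k - 2) = theta_val q N k" "\<not> 2 * Suc k < 2"
          using Suc.IH[rule_format, of k] Suc.IH[rule_format, of "Suc (Suc k)"] by simp_all
        have "theta_moment q (Suc N) (2 * Suc k) =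
            (1 + Q\<^sup>2 + Q * (q\<^sup>2 * y\<^sup>2 + q ^ 3 * y\<^sup>2)) * theta_val q N (Suc k) - Q * theta_val q N (Suc (Suc k))
            - Q * (1 - q\<^sup>2 * y\<^sup>2) * (1 - q * y\<^sup>2) * theta_val q N k"
          using Suc.IH[rule_format, of "Suc k"]
          by (subst theta_moment_Suc) (simp only: IH if_False pw Q_def[symmetric])
        \<comment> \<open>As \<open>1 - q^2 y^2 = (1 - q y) (1 + q y)\<close>, \<open>L1\<close>
          turns the term at \<open>k\<close> into a multiple of
          \<open>theta_val q N (Suc k)\<close>; \<open>L2\<close> does the same for the term at
          \<open>Suc (Suc k)\<close>. A polynomial identity in \<open>q\<close>, \<open>Q\<close>,
          \<open>y\<close> remains.\<close>
        moreover have "\<dots> * (1 - q\<^sup>2 * Q * y) = theta_val q (Suc N) (Suc k) * (1 - q\<^sup>2 * Q * y)"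
          using L1 L2 L' by algebra
        ultimately show ?thesis
          using nz[of "N + Suc k"] Suc unfolding pw by simp
      qed
    qed
  qed
  then show "theta_moment q N (2 * m) = theta_val q N m" "theta_moment q N (2 * m + 1) = 0"
    by auto
qed

text \<open>The Pochhammer symbols that depend on \<open>N\<close> tend to the infinite product, and
  \<open>q ^ (N * m)\<close> tends to \<open>0 ^ m\<close>, which is 1 only for
  \<open>m = 0\<close>.\<close>

lemma theta_val_tendsto:
  assumes q: "\<bar>q\<bar> < 1"
  shows "(\<lambda>N. theta_val q N m) \<longlonglongrightarrow> (if m = 0 then 2 * pi / qpoch_inf q else 0)"
proof -
  let ?P = "qpoch_inf q"
  note lim = qpoch_tendsto[OF q]
  have l2: "(\<lambda>N. qpoch q (2 * N)) \<longlonglongrightarrow> ?P"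
    using LIMSEQ_subseq_LIMSEQ[OF lim, of "\<lambda>N. 2 * N"] by (simp add: strict_mono_def o_def)
  have lm: "(\<lambda>N. qpoch q (N + m)) \<longlonglongrightarrow> ?P"
    using lim by (rule LIMSEQ_ignore_initial_segment)
  have lq: "(\<lambda>N. q ^ N) \<longlonglongrightarrow> 0"
    using q by (intro LIMSEQ_power_zero) simp
  have "(\<lambda>N. (q ^ N) ^ m) \<longlonglongrightarrow> 0 ^ m"
    by (intro tendsto_power lq)
  then have lqm: "(\<lambda>N. q ^ (N * m)) \<longlonglongrightarrow> 0 ^ m"
    by (simp add: power_mult)
  have nz: "?P \<noteq> 0" "qpoch q m \<noteq> 0" using qpoch_inf_pos[OF q] qpoch_pos[OF q, of m] by auto
  have "(\<lambda>N. theta_val q N m) \<longlonglongrightarrow>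
      pi * 2 * ?P * 0 ^ m * qpoch q (2 * m) / ((1 + 0) * ?P * qpoch q m * ?P)"
    unfolding theta_val_def
    by (intro tendsto_intros lim l2 lm lq lqm) (use nz in auto)
  then show ?thesis
    using nz by (cases "m = 0") (auto simp: mult_ac power_0_left)
qed

section \<open>The full weight: positivity, uniform bounds and passage to the limit\<close>

lemma weight_factor_pos:
  assumes q: "\<bar>q\<bar> < 1" and X: "\<bar>X\<bar> \<le> 2"
  shows "0 \<le> weight_factor q X k" "\<bar>X\<bar> < 2 \<Longrightarrow> 0 < weight_factor q X k"
proof -
  define p where "p = q ^ k"
  have p1: "0 < 1 + p"
    unfolding p_def by (rule one_plus_power_pos[OF q])
  \<comment> \<open>Two forms of the factor, one for each sign of \<open>p = q^k\<close>, so that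
    all summands are nonnegative: \<open>(1 - p)^2 + (4 - X^2) p\<close> and
    \<open>(1 + p)^2 - X^2 p\<close>.\<close>
  have e: "weight_factor q X k = (1 - p)\<^sup>2 + (2 - \<bar>X\<bar>) * (2 + \<bar>X\<bar>) * p"
    by (simp add: weight_factor_def p_def power2_eq_square algebra_simps)
  have e': "weight_factor q X k = (1 + p)\<^sup>2 + X\<^sup>2 * (- p)"
    by (simp add: weight_factor_def p_def)
  show "0 \<le> weight_factor q X k"
  proof (cases "0 \<le> p")
    case True
    then show ?thesis unfolding e using X by simp
  next
    case False
    then show ?thesis unfolding e' by (intro add_nonneg_nonneg mult_nonneg_nonneg) auto
  qed
  assume X2: "\<bar>X\<bar> < 2"
  show "0 < weight_factor q X k"
  proof (cases "0 < p")
    case True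
    have "0 < 2 - \<bar>X\<bar>" "0 < 2 + \<bar>X\<bar>" using X2 by linarith+
    then show ?thesis
      using True unfolding e by (intro add_nonneg_pos[OF zero_le_power2] mult_pos_pos)
  next
    case False
    then show ?thesis unfolding e' using p1 by (intro add_pos_nonneg mult_nonneg_nonneg) auto
  qed
qed

lemma weight_factor_minus_one:
  assumes q: "\<bar>q\<bar> < 1" and X: "\<bar>X\<bar> \<le> 2"
  shows "\<bar>weight_factor q X k - 1\<bar> \<le> 7 * \<bar>q\<bar> ^ k"
proof -
  define p where "p = q ^ k"
  have p1: "\<bar>p\<bar> \<le> 1" using q by (simp add: p_def power_abs power_le_one)
  have X2: "X\<^sup>2 \<le> 4"
    using X abs_le_square_iff[of X 2] by auto
  have "weight_factor q X k - 1 = p * (2 + p - X\<^sup>2)"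
    by (simp add: weight_factor_def p_def power2_eq_square algebra_simps)
  \<comment> \<open>\<open>7 = 2 + 1 + 4\<close> bounds \<open>|2 + p - X^2|\<close>.\<close>
  also have "\<bar>\<dots>\<bar> \<le> \<bar>p\<bar> * 7"
    unfolding abs_mult using p1 X2 zero_le_power2[of X] by (intro mult_left_mono) linarith+
  finally show ?thesis by (simp add: p_def power_abs)
qed

lemma convergent_weight_factor:
  assumes q: "\<bar>q\<bar> < 1" and X: "\<bar>X\<bar> \<le> 2"
  shows "convergent_prod (weight_factor q X)"
proof -
  have "summable (\<lambda>k. norm (weight_factor q X k - 1))"
    by (rule summable_comparison_test'[OF summable_mult[OF summable_power_abs[OF q], of 7]])
      (use weight_factor_minus_one[OF assms] in simp)
  from convergent_prod_one_minus(1)[OF this] show ?thesis by simp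
qed

definition weight :: "real \<Rightarrow> real \<Rightarrow> real" where
  "weight q X = prodinf (weight_factor q X)"

lemma weight_upto_tendsto:
  assumes "\<bar>q\<bar> < 1" "\<bar>X\<bar> \<le> 2"
  shows "(\<lambda>N. weight_upto q N X) \<longlonglongrightarrow> weight q X"
  unfolding weight_upto_def weight_def by (rule prod_lessThan_tendsto_prodinf[OF convergent_weight_factor[OF assms]])

lemma weight_pos:
  assumes "\<bar>q\<bar> < 1" "\<bar>X\<bar> < 2"
  shows "0 < weight q X"
  unfolding weight_def using assms by (intro less_0_prodinf convergent_weight_factor weight_factor_pos) auto

text \<open>The bound is uniform in \<open>N\<close> and \<open>X\<close> and serves as majorant for
  dominated convergence; its exponent is 7 times the geometric series in \<open>|q|\<close>.\<close>

lemma weight_upto_bound: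
  assumes "\<bar>q\<bar> < 1" "\<bar>X\<bar> \<le> 2"
  shows "\<bar>weight_upto q N X\<bar> \<le> exp (7 / (1 - \<bar>q\<bar>))"
proof -
  have "\<bar>weight_upto q N X\<bar> = (\<Prod>k<N. weight_factor q X k)"
    using weight_factor_pos(1)[OF assms] by (simp add: weight_upto_def abs_prod)
  also have "\<dots> \<le> (\<Prod>k<N. 1 + 7 * \<bar>q\<bar> ^ k)"
    using weight_factor_pos(1)[OF assms] weight_factor_minus_one[OF assms]
    by (intro prod_mono) (auto simp: abs_le_iff algebra_simps)
  also have "\<dots> \<le> exp (\<Sum>k<N. 7 * \<bar>q\<bar> ^ k)"
    by (rule prod_le_exp_sum) auto
  also have "\<dots> \<le> exp (7 / (1 - \<bar>q\<bar>))"
  proof -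
    have "(\<Sum>k<N. \<bar>q\<bar> ^ k) \<le> (\<Sum>k. \<bar>q\<bar> ^ k)"
      by (intro sum_le_suminf summable_power_abs assms) auto
    also have "\<dots> = 1 / (1 - \<bar>q\<bar>)" using assms by (simp add: suminf_geometric)
    finally show ?thesis by (simp flip: sum_distrib_left)
  qed
  finally show ?thesis .
qed

lemma weight_bound:
  assumes "\<bar>q\<bar> < 1" "\<bar>X\<bar> \<le> 2"
  shows "\<bar>weight q X\<bar> \<le> exp (7 / (1 - \<bar>q\<bar>))"
  using tendsto_rabs[OF weight_upto_tendsto[OF assms]] weight_upto_bound[OF assms]
  by (intro LIMSEQ_le_const2) auto

lemma weight_minus [simp]: "weight q (- X) = weight q X"
  by (simp add: weight_def weight_factor_def[abs_def])

lemma qherm_minus: "qherm q (- X) n = (- 1) ^ n * qherm q X n"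
  by (induction n rule: induct_nat_012) (auto simp: algebra_simps)

lemma borel_measurable_weight:
  assumes "\<bar>q\<bar> < 1"
  shows "(\<lambda>X. if \<bar>X\<bar> \<le> 2 then weight q X else 0) \<in> borel_measurable borel"
proof (rule borel_measurable_LIMSEQ_real)
  show "(\<lambda>N. if \<bar>X\<bar> \<le> 2 then weight_upto q N X else 0) \<longlonglongrightarrow> (if \<bar>X\<bar> \<le> 2 then weight q X else 0)" for X
    using weight_upto_tendsto[OF assms] by auto
  show "(\<lambda>X. if \<bar>X\<bar> \<le> 2 then weight_upto q N X else 0) \<in> borel_measurable borel" for N
    unfolding weight_upto_def weight_factor_def by measurable
qed

lemma borel_measurable_weight_cos:
  assumes "\<bar>q\<bar> < 1"
  shows "(\<lambda>t. weight q (2 * cos t)) \<in> borel_measurable borel"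
proof -
  have "(\<lambda>t. if \<bar>2 * cos t\<bar> \<le> 2 then weight q (2 * cos t) else 0) \<in> borel_measurable borel"
    by (rule measurable_compose[OF _ borel_measurable_weight[OF assms]]) measurable
  then show ?thesis by (simp add: abs_mult)
qed

lemma borel_measurable_qherm [measurable (raw)]:
  assumes "f \<in> borel_measurable M"
  shows "(\<lambda>x. qherm q (f x) n) \<in> borel_measurable M"
proof (induction n rule: induct_nat_012)
  case (ge2 n)
  then show ?case using assms by simp
qed (use assms in auto)

lemma integral_weight_qherm:
  assumes q: "\<bar>q\<bar> < 1"
  shows "(LBINT t:{0..pi}. weight q (2 * cos t) * qherm q (2 * cos t) n) =
    (if n = 0 then 2 * pi / qpoch_inf q else 0)"
proof -
  let ?P = "qpoch_inf q"
  let ?I = "LBINT t:{0..pi}. weight q (2 * cos t) * qherm q (2 * cos t) n"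
  obtain B where B: "0 < B" "\<And>n X. \<bar>X\<bar> \<le> 2 \<Longrightarrow> \<bar>qherm q X n\<bar> \<le> B * real (n + 1)"
    using qherm_bound[OF q] by blast
  note [measurable] = borel_measurable_weight_cos[OF q]
  have c2: "\<bar>2 * cos t\<bar> \<le> 2" for t :: real by (simp add: abs_mult)
  have "(\<lambda>N. theta_moment q N n) \<longlonglongrightarrow> ?I"
    unfolding theta_moment_def set_lebesgue_integral_def
  proof (rule integral_dominated_convergence[where w = "\<lambda>t. indicator {0..pi} t *
      (exp (7 / (1 - \<bar>q\<bar>)) * (B * real (n + 1)))"])
    show "(\<lambda>t. indicator {0..pi} t *\<^sub>R (weight q (2 * cos t) * qherm q (2 * cos t) n))
        \<in> borel_measurable lborel"
      by measurable
    show "(\<lambda>t. indicator {0..pi} t *\<^sub>R (weight_upto q N (2 * cos t) * qherm q (2 * cos t) n))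
        \<in> borel_measurable lborel" for N
      unfolding weight_upto_def weight_factor_def by measurable
    show "AE t in lborel. (\<lambda>N. indicator {0..pi} t *\<^sub>R (weight_upto q N (2 * cos t) * qherm q (2 * cos t) n))
        \<longlonglongrightarrow> indicator {0..pi} t *\<^sub>R (weight q (2 * cos t) * qherm q (2 * cos t) n)"
      by (intro always_eventually allI tendsto_intros weight_upto_tendsto q c2)
    show "AE t in lborel. norm (indicator {0..pi} t *\<^sub>R (weight_upto q N (2 * cos t) * qherm q (2 * cos t) n))
        \<le> indicator {0..pi} t * (exp (7 / (1 - \<bar>q\<bar>)) * (B * real (n + 1)))" for N
    proof (rule AE_I2)
      fix t :: real
      have "\<bar>weight_upto q N (2 * cos t) * qherm q (2 * cos t) n\<bar> \<le>
          exp (7 / (1 - \<bar>q\<bar>)) * (B * real (n + 1))"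
        unfolding abs_mult[of "weight_upto q N (2 * cos t)"]
        by (intro mult_mono weight_upto_bound q c2 B(2)) auto
      then show "norm (indicator {0..pi} t *\<^sub>R (weight_upto q N (2 * cos t) * qherm q (2 * cos t) n))
        \<le> indicator {0..pi} t * (exp (7 / (1 - \<bar>q\<bar>)) * (B * real (n + 1)))"
        by (simp split: split_indicator)
    qed
  qed simp
  moreover have "(\<lambda>N. theta_moment q N n) \<longlonglongrightarrow> (if n = 0 then 2 * pi / ?P else 0)"
  proof (cases "even n")
    case True
    then obtain m where "n = 2 * m" by blast
    then show ?thesis
      using theta_val_tendsto[OF q, of m] by (simp add: theta_moment_eq[OF q])
  next
    case False
    then obtain m where "n = 2 * m + 1" by (elim oddE)
    then show ?thesis
      by (simp only: theta_moment_eq[OF q]) simp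
  qed
  ultimately show ?thesis
    using LIMSEQ_unique by blast
qed

section \<open>The density \<open>f_N\<close> in the angle variable and its moments\<close>

lemma f_N_lt_1:
  assumes q: "\<bar>q\<bar> < 1"
  shows "f_N q x = (if \<bar>sqrt (1 - q) * x\<bar> < 2 then
     sqrt (1 - q) / (2 * pi * sqrt (4 - (sqrt (1 - q) * x)\<^sup>2)) * weight q (sqrt (1 - q) * x)
     * qpoch_inf q else 0)"
proof -
  have s: "0 < sqrt (1 - q)" "(sqrt (1 - q))\<^sup>2 = 1 - q" "q \<noteq> 1" using q by auto
  have "\<bar>x\<bar> < 2 / sqrt (1 - q) \<longleftrightarrow> \<bar>sqrt (1 - q) * x\<bar> < 2"
    using s by (simp add: abs_mult field_simps)
  then show ?thesis
    using s by (simp add: f_N_def weight_def weight_factor_def[abs_def] power_mult_distrib)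
qed

lemma f_N_measurable_lt_1:
  assumes q: "\<bar>q\<bar> < 1"
  shows "f_N q \<in> borel_measurable borel"
proof -
  have "f_N q = (\<lambda>x. if \<bar>sqrt (1 - q) * x\<bar> < 2 then
     sqrt (1 - q) / (2 * pi * sqrt (4 - (sqrt (1 - q) * x)\<^sup>2)) *
     (if \<bar>sqrt (1 - q) * x\<bar> \<le> 2 then weight q (sqrt (1 - q) * x) else 0)
     * qpoch_inf q else 0)"
    by (rule ext) (simp add: f_N_lt_1[OF q])
  also have "\<dots> \<in> borel_measurable borel"
    using borel_measurable_weight[OF q] by measurable
  finally show ?thesis .
qed

lemma f_N_pos_iff_lt_1:
  assumes q: "\<bar>q\<bar> < 1"
  shows "0 < f_N q x \<longleftrightarrow> \<bar>sqrt (1 - q) * x\<bar> < 2" "0 \<le> f_N q x"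
proof -
  have "0 < f_N q x" if X: "\<bar>sqrt (1 - q) * x\<bar> < 2"
  proof -
    have "(sqrt (1 - q) * x)\<^sup>2 < 4"
      using X abs_le_square_iff[of 2 "sqrt (1 - q) * x"] by auto
    then have s: "0 < sqrt (4 - (sqrt (1 - q) * x)\<^sup>2)" by simp
    show ?thesis
      unfolding f_N_lt_1[OF q] if_P[OF X]
      by (intro mult_pos_pos divide_pos_pos weight_pos qpoch_inf_pos q X s) (use q in auto)
  qed
  moreover have "f_N q x = 0" if "\<not> \<bar>sqrt (1 - q) * x\<bar> < 2"
    using that by (simp add: f_N_lt_1[OF q])
  ultimately show "0 < f_N q x \<longleftrightarrow> \<bar>sqrt (1 - q) * x\<bar> < 2" "0 \<le> f_N q x"
    by (metis less_irrefl, metis less_imp_le order_refl)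
qed

text \<open>The factor with \<open>k = 0\<close> is \<open>4 - X^2\<close>. This settles the points
  with \<open>sin t = 0\<close> in the substitution formula for \<open>f_N\<close>.\<close>

lemma weight_endpoint:
  assumes q: "\<bar>q\<bar> < 1" and X: "\<bar>X\<bar> = 2"
  shows "weight q X = 0"
proof (rule LIMSEQ_unique)
  show "(\<lambda>N. weight_upto q N X) \<longlonglongrightarrow> weight q X"
    using X by (intro weight_upto_tendsto q) simp
  have "X\<^sup>2 = 4"
    using X power2_abs[of X] by simp
  then have "weight_upto q (Suc N) X = 0" for N
    unfolding weight_upto_def prod.lessThan_Suc_shift by (simp add: weight_factor_def)
  then have "(\<lambda>N. weight_upto q (Suc N) X) \<longlonglongrightarrow> 0"
    by simp
  then show "(\<lambda>N. weight_upto q N X) \<longlonglongrightarrow> 0"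
    by (rule LIMSEQ_imp_Suc)
qed

text \<open>The sign in \<open>x = - b cos t\<close> makes the substitution increasing on
  \<open>{0..pi}\<close>. Its derivative \<open>b sin t\<close> cancels the
  \<open>sqrt (4 - X^2) = 2 sin t\<close> in the denominator of \<open>f_N\<close>.\<close>

lemma f_N_substitution:
  fixes q t :: real
  assumes q: "\<bar>q\<bar> < 1"
  defines "b \<equiv> 2 / sqrt (1 - q)"
  assumes t: "t \<in> {0..pi}"
  shows "f_N q (- b * cos t) * (b * sin t) = qpoch_inf q / (2 * pi) * weight q (2 * cos t)"
proof (cases "sin t = 0")
  case True
  then have "\<bar>2 * cos t\<bar> = 2"
    using sin_zero_abs_cos_one[of t] by (simp add: abs_mult)
  then show ?thesis using True weight_endpoint[OF q] by simp
next
  case False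
  have s: "0 < sqrt (1 - q)" using q by auto
  have sb: "sqrt (1 - q) * (- b * cos t) = - (2 * cos t)"
    using s by (simp add: b_def)
  have sin: "0 < sin t" using t False sin_ge_zero[of t] by simp
  have "(cos t)\<^sup>2 < 1"
    using sin sin_cos_squared_add[of t] zero_less_power2[of "sin t"] by linarith
  then have X: "\<bar>2 * cos t\<bar> < 2"
    by (simp add: abs_mult abs_square_less_1)
  have r: "sqrt (4 - (2 * cos t)\<^sup>2) = 2 * sin t"
    using sin by (intro real_sqrt_unique) (auto simp: power_mult_distrib sin_squared_eq)
  show ?thesis
    unfolding f_N_lt_1[OF q] sb abs_minus_cancel if_P[OF X] power2_minus r weight_minus
    using s sin by (simp add: b_def field_simps)
qed

lemma f_N_indicator:
  assumes q: "\<bar>q\<bar> < 1"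
  shows "f_N q x * indicator {- (2 / sqrt (1 - q)) * cos 0..- (2 / sqrt (1 - q)) * cos pi} x = f_N q x"
proof (cases "\<bar>sqrt (1 - q) * x\<bar> < 2")
  case True
  then have "\<bar>x\<bar> < 2 / sqrt (1 - q)" using q by (simp add: abs_mult field_simps)
  then show ?thesis by (auto simp: indicator_def abs_less_iff)
qed (simp add: f_N_lt_1[OF q])

lemma f_N_integrable_lt_1:
  fixes q :: real
  assumes q: "\<bar>q\<bar> < 1"
  shows "integrable lborel (f_N q)"
proof -
  define b P where "b = 2 / sqrt (1 - q)" and "P = qpoch_inf q"
  have b: "0 < b" using q by (simp add: b_def)
  have P: "0 < P" unfolding P_def by (rule qpoch_inf_pos[OF q])
  have M: "f_N q \<in> borel_measurable borel" by (rule f_N_measurable_lt_1[OF q])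
  have "(\<integral>\<^sup>+x. ennreal (f_N q x) \<partial>lborel) =
      (\<integral>\<^sup>+x. ennreal (f_N q x * indicator {- b * cos 0..- b * cos pi} x) \<partial>lborel)"
    unfolding b_def f_N_indicator[OF q] ..
  also have "\<dots> = (\<integral>\<^sup>+t. ennreal (f_N q (- b * cos t) * (b * sin t) * indicator {0..pi} t) \<partial>lborel)"
  proof (rule nn_integral_substitution)
    show "set_borel_measurable borel {- b * cos 0..- b * cos pi} (f_N q)"
      unfolding set_borel_measurable_def using M by measurable
  qed (use b in \<open>auto intro!: derivative_eq_intros continuous_intros sin_ge_zero mult_nonneg_nonneg\<close>)
  also have "\<dots> \<le> (\<integral>\<^sup>+t. ennreal (P / (2 * pi) * exp (7 / (1 - \<bar>q\<bar>))) * indicator {0..pi} t \<partial>lborel)"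
  proof (rule nn_integral_mono)
    fix t :: real
    have "P / (2 * pi) * weight q (2 * cos t) \<le> P / (2 * pi) * exp (7 / (1 - \<bar>q\<bar>))"
      using P weight_bound[OF q, of "2 * cos t"] by (intro mult_left_mono) (auto simp: abs_mult abs_le_iff)
    then show "ennreal (f_N q (- b * cos t) * (b * sin t) * indicator {0..pi} t) \<le>
        ennreal (P / (2 * pi) * exp (7 / (1 - \<bar>q\<bar>))) * indicator {0..pi} t"
      using f_N_substitution[OF q, of t] unfolding b_def P_def
      by (cases "t \<in> {0..pi}") (simp_all add: ennreal_leI)
  qed
  also have "\<dots> < \<infinity>"
    by (simp add: nn_integral_cmult_indicator ennreal_mult_less_top)
  finally show ?thesis
    using M f_N_pos_iff_lt_1(2)[OF q] by (intro integrableI_nonneg) auto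
qed

lemma integrable_bounded_f_N:
  fixes q :: real
  assumes q: "\<bar>q\<bar> < 1" and f: "f \<in> borel_measurable borel"
    and B: "\<And>x. \<bar>sqrt (1 - q) * x\<bar> \<le> 2 \<Longrightarrow> \<bar>f x\<bar> \<le> B"
  shows "integrable lborel (\<lambda>x. f x * f_N q x)"
proof (rule Bochner_Integration.integrable_bound)
  show "integrable lborel (\<lambda>x. B * f_N q x)"
    using f_N_integrable_lt_1[OF q] by simp
  show "AE x in lborel. norm (f x * f_N q x) \<le> norm (B * f_N q x)"
  proof (rule AE_I2)
    fix x
    show "norm (f x * f_N q x) \<le> norm (B * f_N q x)"
    proof (cases "f_N q x = 0")
      case False
      then have "\<bar>sqrt (1 - q) * x\<bar> < 2"
        using f_N_pos_iff_lt_1[OF q, of x] by linarith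
      then have "\<bar>f x\<bar> \<le> \<bar>B\<bar>"
        using B[of x] by linarith
      then show ?thesis
        unfolding norm_mult by (intro mult_right_mono) auto
    qed simp
  qed
qed (use f f_N_measurable_lt_1[OF q] in measurable)

lemma f_N_moment_lt_1:
  fixes q :: real
  assumes q: "\<bar>q\<bar> < 1"
  shows "integrable lborel (\<lambda>x. qherm q (sqrt (1 - q) * x) n * f_N q x)"
    and "(LBINT x. qherm q (sqrt (1 - q) * x) n * f_N q x) = (if n = 0 then 1 else 0)"
proof -
  define b P where "b = 2 / sqrt (1 - q)" and "P = qpoch_inf q"
  have b: "0 < b" and sb: "sqrt (1 - q) * (- b * cos t) = - (2 * cos t)" for t
    using q by (simp_all add: b_def)
  have P: "0 < P" unfolding P_def by (rule qpoch_inf_pos[OF q])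
  obtain B where B: "0 < B" "\<And>n X. \<bar>X\<bar> \<le> 2 \<Longrightarrow> \<bar>qherm q X n\<bar> \<le> B * real (n + 1)"
    using qherm_bound[OF q] by blast
  let ?f = "\<lambda>x. qherm q (sqrt (1 - q) * x) n * f_N q x"
  show int: "integrable lborel ?f"
    by (rule integrable_bounded_f_N[OF q _ B(2)]) auto
  have supp: "?f x * indicator {- b * cos 0..- b * cos pi} x = ?f x" for x
    using f_N_indicator[OF q, of x] unfolding b_def by (simp only: mult.assoc)
  have "(LBINT x. ?f x) = (LBINT x. ?f x * indicator {- b * cos 0..- b * cos pi} x)"
    unfolding supp ..
  also have "\<dots> = (LBINT t. ?f (- b * cos t) * (b * sin t) * indicator {0..pi} t)"
  proof (rule integral_substitution)
    have *: "indicator {- b * cos 0..- b * cos pi} x *\<^sub>R ?f x = ?f x" for x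
      using supp[of x] by (metis mult.commute real_scaleR_def)
    show "set_integrable lborel {- b * cos 0..- b * cos pi} ?f"
      unfolding set_integrable_def * by (rule int)
  qed (use b in \<open>auto intro!: derivative_eq_intros continuous_intros sin_ge_zero mult_nonneg_nonneg\<close>)
  \<comment> \<open>The sign comes from \<open>x = - b cos t\<close> and is harmless, since the
    integral is nonzero for \<open>n = 0\<close> only.\<close>
  also have "\<dots> = (LBINT t. (- 1) ^ n * (P / (2 * pi)) *
      (indicator {0..pi} t *\<^sub>R (weight q (2 * cos t) * qherm q (2 * cos t) n)))"
  proof (intro Bochner_Integration.integral_cong refl)
    fix t :: real
    have "?f (- b * cos t) * (b * sin t) = (- 1) ^ n * (P / (2 * pi)) * (weight q (2 * cos t) * qherm q (2 * cos t) n)"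
      if "t \<in> {0..pi}"
    proof -
      have "?f (- b * cos t) * (b * sin t) =
          (- 1) ^ n * qherm q (2 * cos t) n * (f_N q (- b * cos t) * (b * sin t))"
        unfolding sb qherm_minus by (simp only: mult_ac)
      also have "f_N q (- b * cos t) * (b * sin t) = P / (2 * pi) * weight q (2 * cos t)"
        using f_N_substitution[OF q that] by (simp only: b_def P_def)
      finally show ?thesis by (simp only: mult_ac)
    qed
    then show "?f (- b * cos t) * (b * sin t) * indicator {0..pi} t =
        (- 1) ^ n * (P / (2 * pi)) * (indicator {0..pi} t *\<^sub>R (weight q (2 * cos t) * qherm q (2 * cos t) n))"
      by (cases "t \<in> {0..pi}") simp_all
  qed
  also have "\<dots> = (- 1) ^ n * (P / (2 * pi)) * (if n = 0 then 2 * pi / P else 0)"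
    using integral_weight_qherm[OF q, of n] by (simp add: set_lebesgue_integral_def P_def)
  also have "\<dots> = (if n = 0 then 1 else 0)"
    using P by simp
  finally show "(LBINT x. ?f x) = (if n = 0 then 1 else 0)" .
qed

section \<open>The conditional density for |q| < 1\<close>

text \<open>One recurrence for two families: \<open>s = sqrt (1 - q)\<close>,
  \<open>c n = 1 - q^n\<close> gives the \<open>q\<close>-Hermite polynomials in the variable
  \<open>x\<close>, and \<open>s = 1\<close>, \<open>c n = n\<close> the classical ones. As objects
  of type \<open>poly\<close> they have a degree.\<close>

fun three_term_poly :: "real \<Rightarrow> (nat \<Rightarrow> real) \<Rightarrow> nat \<Rightarrow> real poly" where
  "three_term_poly s c 0 = 1"
| "three_term_poly s c (Suc 0) = [:0, s:]"
| "three_term_poly s c (Suc (Suc n)) =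
    [:0, s:] * three_term_poly s c (Suc n) - smult (c (Suc n)) (three_term_poly s c n)"

lemma degree_three_term_poly:
  assumes "s \<noteq> 0"
  shows "degree (three_term_poly s c n) = n"
proof -
  have "degree (three_term_poly s c n) \<le> n \<and> coeff (three_term_poly s c n) n = s ^ n"
  proof (induction n rule: induct_nat_012)
    case (ge2 n)
    have "coeff (three_term_poly s c n) (Suc (Suc n)) = 0"
      using ge2 by (intro coeff_eq_0) auto
    moreover have "degree ([:0, s:] * three_term_poly s c (Suc n)) \<le> Suc (Suc n)"
      using ge2 by (intro order.trans[OF degree_mult_le]) auto
    moreover have "degree (smult (c (Suc n)) (three_term_poly s c n)) \<le> Suc (Suc n)"
      using ge2 by (intro order.trans[OF degree_smult_le]) auto
    ultimately show ?case
      using ge2 by (auto intro!: degree_diff_le)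
  qed auto
  moreover from this have "n \<le> degree (three_term_poly s c n)"
    using assms by (intro le_degree) simp
  ultimately show ?thesis by simp
qed

lemma poly_orec_qherm:
  "poly (three_term_poly s (\<lambda>n. 1 - q ^ n) n) x = qherm q (s * x) n"
  by (induction n rule: induct_nat_012) auto

lemma integrable_qherm_qherm:
  fixes q :: real
  assumes q: "\<bar>q\<bar> < 1"
  shows "integrable lborel (\<lambda>x. qherm q (sqrt (1 - q) * x) m * qherm q (sqrt (1 - q) * x) n * f_N q x)"
proof -
  obtain B where B: "0 < B" "\<And>n X. \<bar>X\<bar> \<le> 2 \<Longrightarrow> \<bar>qherm q X n\<bar> \<le> B * real (n + 1)"
    using qherm_bound[OF q] by blast
  show ?thesis
    by (rule integrable_bounded_f_N[OF q, where B = "(B * real (m + 1)) * (B * real (n + 1))"])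
      (use B in \<open>auto simp: abs_mult intro!: mult_mono\<close>)
qed

text \<open>The recurrence moves a factor \<open>X\<close> from one polynomial to the other, which
  lowers \<open>m\<close> at the cost of neighbouring \<open>n\<close>, until only the known moments
  against 1 are left.\<close>

lemma qherm_orthogonal:
  fixes q :: real
  assumes q: "\<bar>q\<bar> < 1"
  shows "(LBINT x. qherm q (sqrt (1 - q) * x) m * qherm q (sqrt (1 - q) * x) n * f_N q x) =
    (if m = n then qpoch q n else 0)"
proof -
  define s where "s = sqrt (1 - q)"
  let ?h = "\<lambda>n x. qherm q (s * x) n"
  note int = integrable_qherm_qherm[OF q, folded s_def]
  let ?b = "\<lambda>m n. LBINT x. ?h m x * ?h n x * f_N q x"
  have up: "(LBINT x. s * x * (?h m x * ?h n x * f_N q x)) =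
      ?b m (n + 1) + (if n = 0 then 0 else (1 - q ^ n) * ?b m (n - 1))" for m n
  proof (cases n)
    case 0
    then show ?thesis by (simp add: mult_ac)
  next
    case (Suc k)
    have "(LBINT x. s * x * (?h m x * ?h n x * f_N q x)) =
      (LBINT x. ?h m x * ?h (n + 1) x * f_N q x + (1 - q ^ n) * (?h m x * ?h k x * f_N q x))"
      unfolding Suc by (intro Bochner_Integration.integral_cong) (auto simp: algebra_simps)
    also have "\<dots> = ?b m (n + 1) + (1 - q ^ n) * ?b m k"
      by (subst Bochner_Integration.integral_add) (use int in auto)
    finally show ?thesis using Suc by simp
  qed
  have "\<forall>n. ?b m n = (if m = n then qpoch q n else 0)"
  proof (induction m rule: induct_nat_012)
    case 0
    then show ?case using f_N_moment_lt_1(2)[OF q] by (auto simp: s_def)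
  next
    case 1
    show ?case
    proof
      fix n
      have "?b (Suc 0) n = (LBINT x. s * x * (?h 0 x * ?h n x * f_N q x))"
        by (simp add: mult_ac)
      also have "\<dots> = (if Suc 0 = n then qpoch q n else 0)"
        unfolding up using f_N_moment_lt_1(2)[OF q] f_N_moment_lt_1(2)[OF q, of 0] by (auto simp: s_def qpoch_def)
      finally show "?b (Suc 0) n = (if Suc 0 = n then qpoch q n else 0)" .
    qed
  next
    case (ge2 m)
    show ?case
    proof
      fix n
      have ints: "integrable lborel (\<lambda>x. s * x * (?h (Suc m) x * ?h n x * f_N q x))"
      proof -
        have "integrable lborel (\<lambda>x. ?h (Suc (Suc m)) x * ?h n x * f_N q x
            + (1 - q ^ Suc m) * (?h m x * ?h n x * f_N q x))"
          by (intro Bochner_Integration.integrable_add integrable_mult_right int)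
        then show ?thesis by (simp add: algebra_simps)
      qed
      have "?b (Suc (Suc m)) n = (LBINT x. s * x * (?h (Suc m) x * ?h n x * f_N q x)
          - (1 - q ^ Suc m) * (?h m x * ?h n x * f_N q x))"
        by (intro Bochner_Integration.integral_cong) (auto simp: algebra_simps)
      also have "\<dots> = (LBINT x. s * x * (?h (Suc m) x * ?h n x * f_N q x)) - (1 - q ^ Suc m) * ?b m n"
        by (subst Bochner_Integration.integral_diff) (use int ints in \<open>auto simp del: power_Suc\<close>)
      also have "\<dots> = (if Suc (Suc m) = n then qpoch q n else 0)"
        unfolding up using ge2 by (cases n) (auto simp: qpoch_Suc simp del: qherm.simps)
      finally show "?b (Suc (Suc m)) n = (if Suc (Suc m) = n then qpoch q n else 0)" .
    qed
  qed
  then show ?thesis unfolding s_def by blast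
qed

lemma f_CN_lt_1:
  fixes q r :: real
  assumes q: "\<bar>q\<bar> < 1" and r: "\<bar>r\<bar> < 1" and y: "\<bar>sqrt (1 - q) * y\<bar> \<le> 2"
  shows "f_CN q r y x = f_N q x * mehler q (sqrt (1 - q) * y) (sqrt (1 - q) * x) r"
proof (cases "\<bar>sqrt (1 - q) * x\<bar> \<le> 2")
  case True
  define s where "s = sqrt (1 - q)"
  have s: "1 - q = s\<^sup>2" "q \<noteq> 1" using q by (auto simp: s_def)
  have "(1 - r\<^sup>2 * q ^ (2 * k))\<^sup>2 - (1 - q) * r * q ^ k * (1 + r\<^sup>2 * q ^ (2 * k)) * x * y +
      (1 - q) * r\<^sup>2 * (x\<^sup>2 + y\<^sup>2) * q ^ (2 * k) = mehler_den (s * y) (s * x) (r * q ^ k)" for k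
  proof -
    define p where "p = q ^ k"
    have e: "q ^ (2 * k) = p\<^sup>2" by (simp add: p_def power_mult mult.commute[of 2])
    then show ?thesis unfolding s(1) mehler_den_def e unfolding p_def[symmetric] by algebra
  qed
  then have "f_CN q r y x = f_N q x * (\<Prod>k. (1 - r\<^sup>2 * q ^ k) / mehler_den (s * y) (s * x) (r * q ^ k))"
    using s(2) by (simp add: f_CN_def)
  then show ?thesis
    using mehler_formula(1)[OF q r, of "s * y" "s * x"] y True by (simp add: s_def)
next
  case False
  then have "f_N q x = 0" by (simp add: f_N_lt_1[OF q])
  then show ?thesis using q by (simp add: f_CN_def)
qed

text \<open>The Mehler series is integrated termwise with majorant
  \<open>D (n+1)^2 |r|^n f_N\<close>; orthogonality leaves the term \<open>n = m\<close>, whose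
  squared norm cancels the denominator \<open>qpoch q m\<close>.\<close>

lemma f_CN_eigen_lt_1:
  fixes q r :: real
  assumes q: "\<bar>q\<bar> < 1" and r: "\<bar>r\<bar> < 1" and y: "\<bar>sqrt (1 - q) * y\<bar> \<le> 2"
  shows "integrable lborel (\<lambda>x. f_CN q r y x * qherm q (sqrt (1 - q) * x) m)"
    and "(LBINT x. f_CN q r y x * qherm q (sqrt (1 - q) * x) m) = r ^ m * qherm q (sqrt (1 - q) * y) m"
proof -
  define s where "s = sqrt (1 - q)"
  let ?h = "\<lambda>n x. qherm q (s * x) n"
  let ?f = "\<lambda>n x. ?h n y / qpoch q n * r ^ n * (?h n x * ?h m x * f_N q x)"
  obtain B where B: "0 < B" "\<And>n X Y r. \<bar>X\<bar> \<le> 2 \<Longrightarrow> \<bar>Y\<bar> \<le> 2 \<Longrightarrow>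
    \<bar>qherm q X n * qherm q Y n / qpoch q n * r ^ n\<bar> \<le> B * (real (n + 1) ^ 2 * \<bar>r\<bar> ^ n)"
    using mehler_term_bound[OF q] by blast
  obtain C where C: "0 < C" "\<And>n X. \<bar>X\<bar> \<le> 2 \<Longrightarrow> \<bar>qherm q X n\<bar> \<le> C * real (n + 1)"
    using qherm_bound[OF q] by blast
  define D where "D = B * (C * real (m + 1))"
  have bd: "\<bar>?f n x\<bar> \<le> D * (real (n + 1) ^ 2 * \<bar>r\<bar> ^ n) * f_N q x" for n x
  proof (cases "f_N q x = 0")
    case False
    then have x: "\<bar>s * x\<bar> \<le> 2"
      using f_N_pos_iff_lt_1[OF q, of x] by (auto simp: s_def)
    have "\<bar>?f n x\<bar> = \<bar>?h n y * ?h n x / qpoch q n * r ^ n\<bar> * \<bar>?h m x\<bar> * f_N q x"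
      using f_N_pos_iff_lt_1(2)[OF q, of x] by (simp add: abs_mult)
    also have "\<dots> \<le> B * (real (n + 1) ^ 2 * \<bar>r\<bar> ^ n) * (C * real (m + 1)) * f_N q x"
      using x y B C f_N_pos_iff_lt_1(2)[OF q, of x]
      by (intro mult_right_mono mult_mono B C) (auto simp: s_def)
    finally show ?thesis by (simp add: D_def mult_ac)
  qed simp
  have fint: "integrable lborel (?f n)" for n
    by (intro integrable_mult_right integrable_qherm_qherm[OF q, folded s_def])
  have nint: "integrable lborel (\<lambda>x. norm (?f n x))" for n
    using fint by (rule integrable_norm)
  have Nint: "integrable lborel (\<lambda>x. D * (real (n + 1) ^ 2 * \<bar>r\<bar> ^ n) * f_N q x)" for n
    using f_N_integrable_lt_1[OF q] by simp
  have sum1: "summable (\<lambda>n. D * (real (n + 1) ^ 2 * \<bar>r\<bar> ^ n) * c)" for c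
    by (intro summable_mult summable_mult2 summable_Suc_square_power r)
  have s1: "AE x in lborel. summable (\<lambda>n. norm (?f n x))"
    by (intro always_eventually allI summable_comparison_test'[OF sum1]) (use bd in simp)
  have s2: "summable (\<lambda>n. LBINT x. norm (?f n x))"
  proof (rule summable_comparison_test'[OF sum1[of "LBINT x. f_N q x"]])
    fix n
    have "(LBINT x. norm (?f n x)) \<le> (LBINT x. D * (real (n + 1) ^ 2 * \<bar>r\<bar> ^ n) * f_N q x)"
      by (rule integral_mono[OF nint Nint]) (use bd in simp)
    then show "norm (LBINT x. norm (?f n x)) \<le> D * (real (n + 1) ^ 2 * \<bar>r\<bar> ^ n) * (LBINT x. f_N q x)"
      by simp
  qed
  have eq: "f_CN q r y x * ?h m x = (\<Sum>n. ?f n x)" for x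
  proof (cases "f_N q x = 0")
    case True
    then show ?thesis using f_CN_lt_1[OF assms, of x] by simp
  next
    case False
    then have x: "\<bar>s * x\<bar> \<le> 2"
      using f_N_pos_iff_lt_1[OF q, of x] by (auto simp: s_def)
    have "f_CN q r y x * ?h m x = mehler q (s * y) (s * x) r * (f_N q x * ?h m x)"
      using f_CN_lt_1[OF assms, of x] by (simp add: s_def)
    also have "\<dots> = (\<Sum>n. ?h n y * ?h n x / qpoch q n * r ^ n * (f_N q x * ?h m x))"
      unfolding mehler_def using mehler_summable[OF q r y, of "s * x"] x
      by (subst suminf_mult2) (auto simp: s_def)
    also have "(\<lambda>n. ?h n y * ?h n x / qpoch q n * r ^ n * (f_N q x * ?h m x)) = (\<lambda>n. ?f n x)"
      by (simp add: mult_ac)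
    finally show ?thesis .
  qed
  show "integrable lborel (\<lambda>x. f_CN q r y x * qherm q (sqrt (1 - q) * x) m)"
    using integrable_suminf[OF fint s1 s2] unfolding s_def[symmetric] eq .
  have "(LBINT x. f_CN q r y x * ?h m x) = (\<Sum>n. LBINT x. ?f n x)"
    unfolding eq by (rule integral_suminf[OF fint s1 s2])
  also have "\<dots> = (\<Sum>n. ?h n y / qpoch q n * r ^ n * (if n = m then qpoch q m else 0))"
    using qherm_orthogonal[OF q, folded s_def] by simp
  also have "\<dots> = (\<Sum>n\<in>{m}. ?h n y / qpoch q n * r ^ n * (if n = m then qpoch q m else 0))"
    by (rule suminf_finite) auto
  also have "\<dots> = r ^ m * ?h m y"
    using qpoch_pos[OF q, of m] by simp
  finally show "(LBINT x. f_CN q r y x * qherm q (sqrt (1 - q) * x) m) = r ^ m * qherm q (sqrt (1 - q) * y) m"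
    unfolding s_def .
qed

text \<open>The Mehler series and the eigenvalue equation are at hand only for \<open>y\<close> in
  the support. With the value 0 elsewhere, measurability, nonnegativity and reversibility hold at
  all points.\<close>

definition qkernel :: "real \<Rightarrow> real \<Rightarrow> real \<Rightarrow> real \<Rightarrow> real" where
  "qkernel q r y x = (if 0 < f_N q y then f_CN q r y x else 0)"

lemma qkernel_lt_1:
  fixes q r :: real
  assumes q: "\<bar>q\<bar> < 1" and r: "\<bar>r\<bar> < 1"
  shows "qkernel q r y x =
    (if 0 < f_N q y then f_N q x * mehler q (sqrt (1 - q) * y) (sqrt (1 - q) * x) r else 0)"
  using f_CN_lt_1[OF q r, of y x] f_N_pos_iff_lt_1(1)[OF q, of y] by (auto simp: qkernel_def)

lemma qkernel_measurable_lt_1: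
  fixes q r :: real
  assumes q: "\<bar>q\<bar> < 1" and r: "\<bar>r\<bar> < 1"
  shows "(\<lambda>(y, x). qkernel q r y x) \<in> borel_measurable (borel \<Otimes>\<^sub>M borel)"
  unfolding qkernel_lt_1[OF assms] mehler_def
  using f_N_measurable_lt_1[OF q] by measurable

lemma qkernel_nonneg_lt_1:
  fixes q r :: real
  assumes q: "\<bar>q\<bar> < 1" and r: "\<bar>r\<bar> < 1"
  shows "0 \<le> qkernel q r y x"
proof (cases "0 < f_N q y \<and> 0 < f_N q x")
  case True
  then show ?thesis
    using mehler_formula(2)[OF q r, of "sqrt (1 - q) * y" "sqrt (1 - q) * x"] f_N_pos_iff_lt_1[OF q]
    by (simp add: qkernel_lt_1[OF assms])
next
  case False
  then have "qkernel q r y x = 0"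
    using f_N_pos_iff_lt_1(2)[OF q, of x] by (auto simp: qkernel_lt_1[OF assms])
  then show ?thesis by simp
qed

lemma mehler_commute: "mehler q X Y r = mehler q Y X r"
  by (simp add: mehler_def mult.commute)

text \<open>On the support both sides are \<open>f_N q y * f_N q x\<close> times the symmetric
  Mehler kernel; off it both are 0.\<close>

lemma qkernel_reversible_lt_1:
  fixes q r :: real
  assumes q: "\<bar>q\<bar> < 1" and r: "\<bar>r\<bar> < 1"
  shows "f_N q y * qkernel q r y x = f_N q x * qkernel q r x y"
  using f_N_pos_iff_lt_1(2)[OF q, of x] f_N_pos_iff_lt_1(2)[OF q, of y]
    mehler_commute[of q "sqrt (1 - q) * y" "sqrt (1 - q) * x"]
  by (auto simp: qkernel_lt_1[OF assms])

lemma f_N_exp_moment_lt_1: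
  fixes q :: real
  assumes q: "\<bar>q\<bar> < 1"
  shows "integrable lborel (\<lambda>x. exp (a * \<bar>x\<bar>) * f_N q x)"
proof (rule integrable_bounded_f_N[OF q, where B = "exp (\<bar>a\<bar> * (2 / sqrt (1 - q)))"])
  fix x assume x: "\<bar>sqrt (1 - q) * x\<bar> \<le> 2"
  have "\<bar>x\<bar> \<le> 2 / sqrt (1 - q)"
    using x q by (simp add: abs_mult field_simps)
  then have "a * \<bar>x\<bar> \<le> \<bar>a\<bar> * (2 / sqrt (1 - q))"
    by (intro mult_mono) auto
  then show "\<bar>exp (a * \<bar>x\<bar>)\<bar> \<le> exp (\<bar>a\<bar> * (2 / sqrt (1 - q)))" by simp
qed simp

section \<open>Functions with vanishing moments\<close>

text \<open>Expand \<open>e^(itx)\<close> and integrate termwise: the partial sums of absolute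
  values stay below the integrable function \<open>exp (|t| |x|) |f x|\<close>.\<close>

lemma integral_iexp_eq_0_if_moments_0:
  fixes f :: "real \<Rightarrow> real"
  assumes M [measurable]: "f \<in> borel_measurable borel"
    and exp: "\<And>a. integrable lborel (\<lambda>x. exp (a * \<bar>x\<bar>) * \<bar>f x\<bar>)"
    and mom: "\<And>n. (LBINT x. x ^ n * f x) = 0"
  shows "(LBINT x. f x *\<^sub>R iexp (t * x)) = 0"
proof -
  let ?g = "\<lambda>n x. f x *\<^sub>R ((\<i> * of_real (t * x)) ^ n /\<^sub>R fact n)"
  have nrm: "norm (?g n x) = \<bar>f x\<bar> * (\<bar>t * x\<bar> ^ n / fact n)" for n x
    by (simp add: norm_mult norm_power abs_mult divide_inverse)
  have ge: "(\<Sum>n<N. norm (?g n x)) \<le> exp (\<bar>t\<bar> * \<bar>x\<bar>) * \<bar>f x\<bar>" for N x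
  proof -
    have "(\<Sum>n<N. \<bar>t * x\<bar> ^ n /\<^sub>R fact n) \<le> exp \<bar>t * x\<bar>"
      unfolding exp_def by (intro sum_le_suminf summable_exp_generic) auto
    then have "\<bar>f x\<bar> * (\<Sum>n<N. \<bar>t * x\<bar> ^ n / fact n) \<le> \<bar>f x\<bar> * exp \<bar>t * x\<bar>"
      by (intro mult_left_mono) (simp_all add: divide_inverse mult.commute)
    then show ?thesis
      unfolding nrm by (simp add: sum_distrib_left abs_mult mult.commute)
  qed
  have int: "integrable lborel (?g n)" for n
  proof (rule Bochner_Integration.integrable_bound[OF exp[of "\<bar>t\<bar>"]])
    show "AE x in lborel. norm (?g n x) \<le> norm (exp (\<bar>t\<bar> * \<bar>x\<bar>) * \<bar>f x\<bar>)"
    proof (rule AE_I2)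
      fix x
      have "norm (?g n x) \<le> (\<Sum>k<Suc n. norm (?g k x))"
        by (simp add: sum_nonneg)
      also have "\<dots> \<le> exp (\<bar>t\<bar> * \<bar>x\<bar>) * \<bar>f x\<bar>" by (rule ge)
      finally show "norm (?g n x) \<le> norm (exp (\<bar>t\<bar> * \<bar>x\<bar>) * \<bar>f x\<bar>)" by simp
    qed
  qed measurable
  have s1: "AE x in lborel. summable (\<lambda>n. norm (?g n x))"
    by (intro always_eventually allI summableI_nonneg_bounded[OF _ ge]) auto
  have s2: "summable (\<lambda>n. LBINT x. norm (?g n x))"
  proof (rule summableI_nonneg_bounded)
    fix N
    have "(\<Sum>n<N. LBINT x. norm (?g n x)) = (LBINT x. (\<Sum>n<N. norm (?g n x)))"
      by (rule Bochner_Integration.integral_sum[symmetric]) (rule integrable_norm[OF int])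
    also have "\<dots> \<le> (LBINT x. exp (\<bar>t\<bar> * \<bar>x\<bar>) * \<bar>f x\<bar>)"
      by (rule integral_mono[OF Bochner_Integration.integrable_sum[OF integrable_norm[OF int]] exp ge])
    finally show "(\<Sum>n<N. LBINT x. norm (?g n x)) \<le> (LBINT x. exp (\<bar>t\<bar> * \<bar>x\<bar>) * \<bar>f x\<bar>)" .
  qed simp
  have "f x *\<^sub>R iexp (t * x) = (\<Sum>n. ?g n x)" for x
    unfolding exp_def by (subst suminf_scaleR_right) (auto intro: summable_exp_generic)
  then have "(LBINT x. f x *\<^sub>R iexp (t * x)) = (\<Sum>n. LBINT x. ?g n x)"
    using integral_suminf[OF int s1 s2] by simp
  also have "(\<lambda>n. LBINT x. ?g n x) = (\<lambda>n. 0)"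
  proof
    fix n
    have "?g n = (\<lambda>x. ((\<i> * of_real t) ^ n / fact n) * complex_of_real (x ^ n * f x))"
      by (rule ext) (simp add: scaleR_conv_of_real power_mult_distrib field_simps)
    then have "(LBINT x. ?g n x) =
        ((\<i> * of_real t) ^ n / fact n) * (LBINT x. complex_of_real (x ^ n * f x))"
      by simp
    also have "(LBINT x. complex_of_real (x ^ n * f x)) = 0"
      by (subst integral_complex_of_real) (simp add: mom)
    finally show "(LBINT x. ?g n x) = 0" by simp
  qed
  finally show ?thesis by simp
qed

text \<open>The positive and negative parts of \<open>f\<close> have the same mass \<open>c\<close>,
  by the moment of order 0. Normalised to probability measures they have equal characteristic
  functions, so Levy's uniqueness theorem gives equal densities. If \<open>c = 0\<close> no
  normalisation is possible, but then \<open>f\<close> vanishes anyway.\<close>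

lemma AE_eq_0_if_moments_0:
  fixes f :: "real \<Rightarrow> real"
  assumes M [measurable]: "f \<in> borel_measurable borel"
    and exp: "\<And>a. integrable lborel (\<lambda>x. exp (a * \<bar>x\<bar>) * \<bar>f x\<bar>)"
    and mom: "\<And>n. (LBINT x. x ^ n * f x) = 0"
  shows "AE x in lborel. f x = 0"
proof -
  have absint: "integrable lborel (\<lambda>x. \<bar>f x\<bar>)"
    using exp[of 0] by simp
  then have fint: "integrable lborel f"
    by (simp add: integrable_abs_iff)
  define c where "c = (LBINT x. \<bar>f x\<bar>) / 2"
  have f0: "(LBINT x. f x) = 0"
    using mom[of 0] by simp
  \<comment> \<open>\<open>\<sigma> = 1\<close> selects the positive part and
    \<open>\<sigma> = - 1\<close> the negative part, so that both are treated by one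
    argument.\<close>
  have halves: "(LBINT x. max 0 (\<sigma> * f x)) = c" "integrable lborel (\<lambda>x. max 0 (\<sigma> * f x))"
    if "\<sigma> = 1 \<or> \<sigma> = - 1" for \<sigma>
  proof -
    have e: "max 0 (\<sigma> * f x) = (\<bar>f x\<bar> + \<sigma> * f x) / 2" for x
      using that by (auto simp: max_def)
    show "(LBINT x. max 0 (\<sigma> * f x)) = c" "integrable lborel (\<lambda>x. max 0 (\<sigma> * f x))"
      unfolding e using absint fint f0 by (simp_all add: c_def)
  qed
  have c0: "0 \<le> c" by (simp add: c_def)
  show ?thesis
  proof (cases "c = 0")
    case True
    then have "(LBINT x. \<bar>f x\<bar>) = 0" by (simp add: c_def)
    then have "AE x in lborel. \<bar>f x\<bar> = 0"
      using integral_nonneg_eq_0_iff_AE[OF absint] by simp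
    then show ?thesis by simp
  next
    case False
    with c0 have c: "0 < c" by simp
    define \<mu> where "\<mu> \<sigma> = density lborel (\<lambda>x. ennreal (max 0 (\<sigma> * f x) / c))" for \<sigma>
    have rd: "real_distribution (\<mu> \<sigma>)" if s: "\<sigma> = 1 \<or> \<sigma> = - 1" for \<sigma>
    proof -
      have "emeasure (\<mu> \<sigma>) (space (\<mu> \<sigma>)) = (\<integral>\<^sup>+x. ennreal (max 0 (\<sigma> * f x) / c) \<partial>lborel)"
        by (simp add: \<mu>_def emeasure_density)
      also have "\<dots> = ennreal (LBINT x. max 0 (\<sigma> * f x) / c)"
        using halves[OF s] c by (intro nn_integral_eq_integral) auto
      also have "\<dots> = 1"
        using halves[OF s] c by simp
      finally have "prob_space (\<mu> \<sigma>)" by (rule prob_spaceI)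
      then show ?thesis
        by (auto simp: real_distribution_def real_distribution_axioms_def \<mu>_def)
    qed
    have ch: "char (\<mu> 1) = char (\<mu> (- 1))"
    proof
      fix t
      have char: "char (\<mu> \<sigma>) t = (LBINT x. (max 0 (\<sigma> * f x) / c) *\<^sub>R iexp (t * x))" for \<sigma>
        unfolding char_def \<mu>_def by (subst integral_density) (use c in auto)
      have int: "integrable lborel (\<lambda>x. (max 0 (\<sigma> * f x) / c) *\<^sub>R iexp (t * x))"
        if "\<sigma> = 1 \<or> \<sigma> = - 1" for \<sigma>
      proof (rule Bochner_Integration.integrable_bound)
        show "integrable lborel (\<lambda>x. max 0 (\<sigma> * f x) / c)"
          using halves[OF that] by simp
      qed auto
      have "char (\<mu> 1) t - char (\<mu> (- 1)) t =
        (LBINT x. (max 0 (1 * f x) / c) *\<^sub>R iexp (t * x) - (max 0 (- 1 * f x) / c) *\<^sub>R iexp (t * x))"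
        unfolding char by (intro Bochner_Integration.integral_diff[symmetric] int) simp_all
      also have "\<dots> = (LBINT x. (1 / c) *\<^sub>R (f x *\<^sub>R iexp (t * x)))"
        by (intro Bochner_Integration.integral_cong)
          (auto simp: max_def scaleR_left_diff_distrib[symmetric])
      also have "\<dots> = (1 / c) *\<^sub>R (LBINT x. f x *\<^sub>R iexp (t * x))"
        by (rule integral_scaleR_right)
      also have "\<dots> = 0"
        using integral_iexp_eq_0_if_moments_0[OF assms, of t] by simp
      finally show "char (\<mu> 1) t = char (\<mu> (- 1)) t" by simp
    qed
    have eq: "\<mu> 1 = \<mu> (- 1)"
      by (rule Levy_uniqueness[OF rd rd ch]) auto
    have "AE x in lborel. ennreal (max 0 (1 * f x) / c) = ennreal (max 0 (- 1 * f x) / c)"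
      by (rule sigma_finite_measure.density_unique[OF sigma_finite_lborel _ _ eq[unfolded \<mu>_def]])
        measurable
    then show ?thesis
    proof eventually_elim
      case (elim x)
      then have "max 0 (f x) / c = max 0 (- f x) / c"
        using c by (subst (asm) ennreal_inj) auto
      then show ?case using c by (auto simp: max_def split: if_splits)
    qed
  qed
qed

section \<open>Reversible kernels with polynomial eigenfunctions\<close>

lemma borel_measurable_poly [measurable]: "poly p \<in> borel_measurable borel" for p :: "real poly"
  by (intro borel_measurable_continuous_onI continuous_intros)

abbreviation kernel_op :: "(real \<Rightarrow> real \<Rightarrow> real) \<Rightarrow> (real \<Rightarrow> ennreal) \<Rightarrow> real \<Rightarrow> ennreal" where
  "kernel_op k f y \<equiv> \<integral>\<^sup>+x. f x * ennreal (k y x) \<partial>lborel"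

lemma two_abs_mult_le: "2 * \<bar>a * b\<bar> \<le> a\<^sup>2 + b\<^sup>2" for a b :: real
  using sum_squares_bound[of "\<bar>a\<bar>" "\<bar>b\<bar>"] by (simp add: abs_mult)

text \<open>What the \<open>q\<close>-Hermite and the Gaussian case have in common. The eigenvalue
  equations concern only points with \<open>0 < w y\<close>; for \<open>n = 0\<close>, where
  \<open>h 0 = 1\<close>, they say that \<open>k y\<close> is a probability density. Orthogonality
  of the \<open>h n\<close> follows from the distinct eigenvalues, completeness from
  \<open>w_exp\<close>.\<close>

locale reversible_kernel =
  fixes w :: "real \<Rightarrow> real" and k :: "real \<Rightarrow> real \<Rightarrow> real" and r :: real
    and h :: "nat \<Rightarrow> real poly"
  assumes w_measurable [measurable]: "w \<in> borel_measurable borel"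
    and w_nonneg: "0 \<le> w x"
    and w_exp: "integrable lborel (\<lambda>x. exp (a * \<bar>x\<bar>) * w x)"
    and k_measurable: "(\<lambda>(y, x). k y x) \<in> borel_measurable (borel \<Otimes>\<^sub>M borel)"
    and k_nonneg: "0 \<le> k y x"
    and reversible: "w y * k y x = w x * k x y"
    and degree_h: "degree (h n) = n"
    and h_0: "h 0 = 1"
    and eigen_integrable: "0 < w y \<Longrightarrow> integrable lborel (\<lambda>x. k y x * poly (h n) x)"
    and eigen: "0 < w y \<Longrightarrow> (LBINT x. k y x * poly (h n) x) = r ^ n * poly (h n) y"
    and r_nonzero: "r \<noteq> 0"
    and r_less_1: "\<bar>r\<bar> < 1"
begin

lemma k_measurable_compose [measurable (raw)]:
  assumes "f \<in> borel_measurable M" "g \<in> borel_measurable M"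
  shows "(\<lambda>z. k (f z) (g z)) \<in> borel_measurable M"
proof -
  have "(\<lambda>z. (f z, g z)) \<in> M \<rightarrow>\<^sub>M borel \<Otimes>\<^sub>M borel"
    using assms by measurable
  from measurable_compose[OF this k_measurable] show ?thesis by simp
qed

section \<open>Square-integrable functions with respect to the weight\<close>

definition L2 :: "(real \<Rightarrow> real) \<Rightarrow> bool" where
  "L2 f \<longleftrightarrow> f \<in> borel_measurable borel \<and> integrable lborel (\<lambda>x. (f x)\<^sup>2 * w x)"

definition ip :: "(real \<Rightarrow> real) \<Rightarrow> (real \<Rightarrow> real) \<Rightarrow> real" where
  "ip f g = (LBINT x. f x * g x * w x)"

definition P :: "(real \<Rightarrow> real) \<Rightarrow> real \<Rightarrow> real" where
  "P g y = (LBINT x. g x * k y x)"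

lemma L2_measurable [measurable_dest]: "L2 f \<Longrightarrow> f \<in> borel_measurable borel"
  by (simp add: L2_def)

lemma L2_integrable: "L2 f \<Longrightarrow> integrable lborel (\<lambda>x. (f x)\<^sup>2 * w x)"
  by (simp add: L2_def)

lemma L2_product_integrable:
  assumes "L2 f" "L2 g"
  shows "integrable lborel (\<lambda>x. f x * g x * w x)"
proof (rule Bochner_Integration.integrable_bound)
  show "integrable lborel (\<lambda>x. (f x)\<^sup>2 * w x + (g x)\<^sup>2 * w x)"
    using assms by (simp add: L2_integrable)
  show "AE x in lborel. norm (f x * g x * w x) \<le> norm ((f x)\<^sup>2 * w x + (g x)\<^sup>2 * w x)"
  proof (rule AE_I2)
    fix x
    have "\<bar>f x * g x\<bar> * w x \<le> ((f x)\<^sup>2 + (g x)\<^sup>2) * w x"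
      using two_abs_mult_le[of "f x" "g x"] w_nonneg by (intro mult_right_mono) linarith+
    moreover have "norm (f x * g x * w x) = \<bar>f x * g x\<bar> * w x"
      using w_nonneg[of x] by (simp add: abs_mult)
    ultimately show "norm (f x * g x * w x) \<le> norm ((f x)\<^sup>2 * w x + (g x)\<^sup>2 * w x)"
      by (simp add: distrib_right)
  qed
qed (use assms in measurable)

lemma L2_add: "L2 f \<Longrightarrow> L2 g \<Longrightarrow> L2 (\<lambda>x. f x + g x)"
  using L2_product_integrable[of f g] unfolding L2_def
  by (auto simp: power2_sum distrib_right mult.assoc)

lemma L2_cmult: "L2 f \<Longrightarrow> L2 (\<lambda>x. c * f x)"
  unfolding L2_def by (auto simp: power_mult_distrib mult.assoc)

lemma L2_diff: "L2 f \<Longrightarrow> L2 g \<Longrightarrow> L2 (\<lambda>x. f x - g x)"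
  using L2_add[of f "\<lambda>x. - 1 * g x"] L2_cmult[of g "- 1"] by simp

lemma L2_sum: "(\<And>i. i \<in> I \<Longrightarrow> L2 (f i)) \<Longrightarrow> L2 (\<lambda>x. \<Sum>i\<in>I. f i x)"
proof (induction I rule: infinite_finite_induct)
  case (insert i I)
  then show ?case by (simp add: L2_add)
qed (auto simp: L2_def)

lemma ip_commute: "ip f g = ip g f"
  by (simp add: ip_def mult.commute)

lemma ip_add: "L2 f \<Longrightarrow> L2 f' \<Longrightarrow> L2 g \<Longrightarrow> ip (\<lambda>x. f x + f' x) g = ip f g + ip f' g"
  using L2_product_integrable[of f g] L2_product_integrable[of f' g]
  by (simp add: ip_def distrib_right)

lemma ip_cmult: "ip (\<lambda>x. c * f x) g = c * ip f g"
  by (simp add: ip_def mult.assoc)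

lemma ip_diff: "L2 f \<Longrightarrow> L2 f' \<Longrightarrow> L2 g \<Longrightarrow> ip (\<lambda>x. f x - f' x) g = ip f g - ip f' g"
  using ip_add[of f "\<lambda>x. - 1 * f' x" g] L2_cmult[of f' "- 1"] ip_cmult[of "- 1" f' g] by simp

lemma ip_sum:
  assumes "\<And>i. i \<in> I \<Longrightarrow> L2 (f i)" "L2 g"
  shows "ip (\<lambda>x. \<Sum>i\<in>I. f i x) g = (\<Sum>i\<in>I. ip (f i) g)"
  using assms(1)
proof (induction I rule: infinite_finite_induct)
  case (insert i I)
  then show ?case by (simp add: ip_add L2_sum assms(2))
qed (simp_all add: ip_def)

lemma ip_self_nonneg: "0 \<le> ip f f"
  unfolding ip_def by (rule Bochner_Integration.integral_nonneg) (simp add: w_nonneg)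

lemma ip_self: "ip f f = (LBINT x. (f x)\<^sup>2 * w x)"
  by (simp add: ip_def power2_eq_square)

lemma ip_cong_AE:
  assumes "L2 f" "L2 f'" "L2 g" "AE x in lborel. f x * w x = f' x * w x"
  shows "ip f g = ip f' g"
  unfolding ip_def
  by (rule integral_cong_AE) (use assms in \<open>auto elim: eventually_mono simp: mult_ac\<close>)

lemma monomial_integrable: "integrable lborel (\<lambda>x. x ^ n * w x)"
proof (rule Bochner_Integration.integrable_bound[OF integrable_mult_right[OF w_exp[of 1], of "fact n"]])
  show "AE x in lborel. norm (x ^ n * w x) \<le> norm (fact n * (exp (1 * \<bar>x\<bar>) * w x))"
  proof (rule AE_I2)
    fix x :: real
    have "\<bar>x\<bar> ^ n / fact n \<le> (\<Sum>k<Suc n. \<bar>x\<bar> ^ k /\<^sub>R fact k)"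
      using sum_nonneg[of "{..<n}" "\<lambda>k. \<bar>x\<bar> ^ k /\<^sub>R fact k"]
      by (simp add: divide_inverse mult.commute)
    also have "\<dots> \<le> exp \<bar>x\<bar>"
      unfolding exp_def by (intro sum_le_suminf summable_exp_generic) auto
    finally have "\<bar>x\<bar> ^ n * w x \<le> (fact n * exp \<bar>x\<bar>) * w x"
      using w_nonneg[of x] by (intro mult_right_mono) (simp_all add: field_simps)
    then show "norm (x ^ n * w x) \<le> norm (fact n * (exp (1 * \<bar>x\<bar>) * w x))"
      using w_nonneg[of x] by (simp add: abs_mult power_abs)
  qed
qed simp

lemma poly_integrable: "integrable lborel (\<lambda>x. poly p x * w x)"
proof -
  have "integrable lborel (\<lambda>x. \<Sum>i\<le>degree p. coeff p i * (x ^ i * w x))"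
    by (intro Bochner_Integration.integrable_sum integrable_mult_right monomial_integrable)
  then show ?thesis
    by (simp add: poly_altdef sum_distrib_right mult.assoc)
qed

lemma L2_poly: "L2 (poly p)"
  using poly_integrable[of "p * p"] by (simp add: L2_def power2_eq_square)

text \<open>Tonelli and reversibility reduce the left side to the mass of \<open>k x\<close>, which
  is 1 where \<open>0 < w x\<close>. The \<open>ennreal\<close> form spares integrability
  conditions, so integrability statements can be derived from it.\<close>

lemma nn_stationary:
  assumes [measurable]: "f \<in> borel_measurable borel"
  shows "(\<integral>\<^sup>+y. ennreal (w y) * kernel_op k f y \<partial>lborel) =
    (\<integral>\<^sup>+x. f x * ennreal (w x) \<partial>lborel)"
proof -
  have one: "ennreal (w x) * (\<integral>\<^sup>+y. ennreal (k x y) \<partial>lborel) = ennreal (w x)" for x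
  proof (cases "0 < w x")
    case True
    then have "integrable lborel (k x)" "(LBINT y. k x y) = 1"
      using eigen_integrable[of x 0] eigen[of x 0] by (simp_all add: h_0)
    then have "(\<integral>\<^sup>+y. ennreal (k x y) \<partial>lborel) = 1"
      by (subst nn_integral_eq_integral) (auto simp: k_nonneg)
    then show ?thesis by simp
  next
    case False
    then show ?thesis using w_nonneg[of x] by simp
  qed
  have "(\<integral>\<^sup>+y. ennreal (w y) * kernel_op k f y \<partial>lborel) =
      (\<integral>\<^sup>+y. (\<integral>\<^sup>+x. f x * ennreal (w y * k y x) \<partial>lborel) \<partial>lborel)"
    by (subst nn_integral_cmult[symmetric])
      (auto intro!: nn_integral_cong simp: ennreal_mult' k_nonneg w_nonneg mult_ac)
  also have "\<dots> = (\<integral>\<^sup>+x. (\<integral>\<^sup>+y. f x * ennreal (w y * k y x) \<partial>lborel) \<partial>lborel)"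
    by (rule lborel_pair.Fubini') measurable
  also have "\<dots> = (\<integral>\<^sup>+x. f x * (ennreal (w x) * (\<integral>\<^sup>+y. ennreal (k x y) \<partial>lborel)) \<partial>lborel)"
  proof (rule nn_integral_cong)
    fix x
    have "(\<integral>\<^sup>+y. f x * ennreal (w y * k y x) \<partial>lborel) = (\<integral>\<^sup>+y. f x * ennreal (w x) * ennreal (k x y) \<partial>lborel)"
      by (intro nn_integral_cong) (simp add: reversible[of _ x] ennreal_mult' k_nonneg w_nonneg mult_ac)
    then show "(\<integral>\<^sup>+y. f x * ennreal (w y * k y x) \<partial>lborel) =
        f x * (ennreal (w x) * (\<integral>\<^sup>+y. ennreal (k x y) \<partial>lborel))"
      by (simp add: nn_integral_cmult mult.assoc)
  qed
  finally show ?thesis unfolding one .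
qed

section \<open>The kernel operator on square-integrable functions\<close>

lemma k_integrable: "0 < w y \<Longrightarrow> integrable lborel (k y)"
  using eigen_integrable[of y 0] by (simp add: h_0)

lemma k_integral: "0 < w y \<Longrightarrow> (LBINT x. k y x) = 1"
  using eigen[of y 0] by (simp add: h_0)

text \<open>By stationarity the kernel image of \<open>g^2\<close> has a finite integral against
  \<open>w\<close>, hence is finite almost everywhere on the support.\<close>

lemma AE_square_integrable:
  assumes "L2 g"
  shows "AE y in lborel. 0 < w y \<longrightarrow> integrable lborel (\<lambda>x. (g x)\<^sup>2 * k y x)"
proof -
  note [measurable] = L2_measurable[OF assms]
  have "(\<integral>\<^sup>+y. ennreal (w y) * kernel_op k (\<lambda>x. ennreal ((g x)\<^sup>2)) y \<partial>lborel) =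
    (\<integral>\<^sup>+x. ennreal ((g x)\<^sup>2) * ennreal (w x) \<partial>lborel)"
    by (rule nn_stationary) simp
  also have "\<dots> = (\<integral>\<^sup>+x. ennreal ((g x)\<^sup>2 * w x) \<partial>lborel)"
    by (simp add: ennreal_mult w_nonneg)
  also have "\<dots> < \<infinity>"
    using L2_integrable[OF assms] by (auto simp: integrable_iff_bounded w_nonneg)
  finally have "AE y in lborel. ennreal (w y) * kernel_op k (\<lambda>x. ennreal ((g x)\<^sup>2)) y \<noteq> \<infinity>"
    by (intro nn_integral_PInf_AE) auto
  then show ?thesis
  proof eventually_elim
    case (elim y)
    show ?case
    proof
      assume "0 < w y"
      then have "kernel_op k (\<lambda>x. ennreal ((g x)\<^sup>2)) y < \<infinity>"
        using elim by (auto simp: ennreal_mult_eq_top_iff less_top)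
      then show "integrable lborel (\<lambda>x. (g x)\<^sup>2 * k y x)"
        by (intro integrableI_nonneg) (auto simp: k_nonneg ennreal_mult)
    qed
  qed
qed

lemma integrable_mult_k:
  assumes "L2 g" "0 < w y" "integrable lborel (\<lambda>x. (g x)\<^sup>2 * k y x)"
  shows "integrable lborel (\<lambda>x. g x * k y x)"
proof (rule Bochner_Integration.integrable_bound)
  note [measurable] = L2_measurable[OF assms(1)]
  show "integrable lborel (\<lambda>x. k y x + (g x)\<^sup>2 * k y x)"
    using assms k_integrable by simp
  show "AE x in lborel. norm (g x * k y x) \<le> norm (k y x + (g x)\<^sup>2 * k y x)"
  proof (rule AE_I2)
    fix x
    have "\<bar>g x\<bar> * k y x \<le> (1 + (g x)\<^sup>2) * k y x"
      using two_abs_mult_le[of 1 "g x"] k_nonneg by (intro mult_right_mono) auto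
    then show "norm (g x * k y x) \<le> norm (k y x + (g x)\<^sup>2 * k y x)"
      using k_nonneg[of y x] by (simp add: abs_mult distrib_right)
  qed
qed (use L2_measurable[OF assms(1)] in measurable)

lemma AE_mult_k_integrable:
  assumes "L2 g"
  shows "AE y in lborel. 0 < w y \<longrightarrow> integrable lborel (\<lambda>x. g x * k y x)"
  using AE_square_integrable[OF assms] by eventually_elim (auto intro: integrable_mult_k assms)

lemma P_measurable [measurable]:
  assumes "g \<in> borel_measurable borel"
  shows "P g \<in> borel_measurable borel"
  unfolding P_def[abs_def] using assms by measurable

text \<open>Jensen's inequality for the probability density \<open>k y\<close>: the variance of
  \<open>g\<close> under it is nonnegative.\<close>

lemma P_square_le:
  assumes g: "L2 g" and y: "0 < w y" and int: "integrable lborel (\<lambda>x. (g x)\<^sup>2 * k y x)"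
  shows "(P g y)\<^sup>2 \<le> (LBINT x. (g x)\<^sup>2 * k y x)"
proof -
  let ?c = "P g y"
  note i = int integrable_mult_k[OF g y int] k_integrable[OF y]
  have "0 \<le> (LBINT x. (g x - ?c)\<^sup>2 * k y x)"
    by (rule Bochner_Integration.integral_nonneg) (simp add: k_nonneg)
  also have "\<dots> = (LBINT x. (g x)\<^sup>2 * k y x - 2 * ?c * (g x * k y x) + ?c\<^sup>2 * k y x)"
    by (intro Bochner_Integration.integral_cong) (auto simp: power2_diff algebra_simps)
  also have "\<dots> = (LBINT x. (g x)\<^sup>2 * k y x) - 2 * ?c * ?c + ?c\<^sup>2 * 1"
    using i by (simp add: k_integral[OF y] P_def)
  finally show ?thesis by (simp add: power2_eq_square)
qed

lemma L2_P:
  assumes g: "L2 g"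
  shows "L2 (P g)"
proof -
  note [measurable] = L2_measurable[OF g]
  have "(\<integral>\<^sup>+y. ennreal ((P g y)\<^sup>2 * w y) \<partial>lborel) \<le>
      (\<integral>\<^sup>+y. ennreal (w y) * kernel_op k (\<lambda>x. ennreal ((g x)\<^sup>2)) y \<partial>lborel)"
  proof (rule nn_integral_mono_AE, use AE_square_integrable[OF g] in eventually_elim)
    fix y assume a: "0 < w y \<longrightarrow> integrable lborel (\<lambda>x. (g x)\<^sup>2 * k y x)"
    show "ennreal ((P g y)\<^sup>2 * w y) \<le> ennreal (w y) * kernel_op k (\<lambda>x. ennreal ((g x)\<^sup>2)) y"
    proof (cases "0 < w y")
      case True
      have "kernel_op k (\<lambda>x. ennreal ((g x)\<^sup>2)) y = ennreal (LBINT x. (g x)\<^sup>2 * k y x)"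
        using a True by (subst nn_integral_eq_integral[symmetric]) (auto simp: k_nonneg ennreal_mult)
      moreover have "ennreal ((P g y)\<^sup>2 * w y) \<le> ennreal (w y) * ennreal (LBINT x. (g x)\<^sup>2 * k y x)"
        using P_square_le[OF g True] a True
        by (subst ennreal_mult''[symmetric]) (auto intro!: ennreal_leI mult_left_mono simp: mult.commute[of _ "w y"] k_nonneg)
      ultimately show ?thesis by simp
    next
      case False
      then have "w y = 0" using w_nonneg[of y] by simp
      then show ?thesis by simp
    qed
  qed
  also have "\<dots> = (\<integral>\<^sup>+x. ennreal ((g x)\<^sup>2 * w x) \<partial>lborel)"
    by (subst nn_stationary) (auto simp: ennreal_mult w_nonneg)
  also have "\<dots> < \<infinity>"
    using L2_integrable[OF g] by (auto simp: integrable_iff_bounded w_nonneg)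
  finally show ?thesis
    unfolding L2_def by (auto intro!: integrableI_nonneg simp: w_nonneg)
qed

text \<open>Fubini and reversibility. Joint integrability comes from
  \<open>|g x * f y| \<le> (g x)^2 + (f y)^2\<close>: stationarity bounds the first part directly,
  and the second after reversibility has exchanged the roles of \<open>x\<close> and
  \<open>y\<close>.\<close>

lemma P_self_adjoint:
  assumes f: "L2 f" and g: "L2 g"
  shows "ip (P g) f = ip g (P f)"
proof -
  note [measurable] = L2_measurable[OF f] L2_measurable[OF g]
  let ?F = "\<lambda>x y. g x * f y * k y x * w y"
  have fin: "(\<integral>\<^sup>+x. ennreal ((u x)\<^sup>2 * w x) \<partial>lborel) < \<infinity>" if "L2 u" for u
    using L2_integrable[OF that] by (auto simp: integrable_iff_bounded w_nonneg)
  have int: "integrable (lborel \<Otimes>\<^sub>M lborel) (\<lambda>(x, y). ?F x y)"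
    unfolding integrable_iff_bounded
  proof
    show "(\<lambda>(x, y). ?F x y) \<in> borel_measurable (lborel \<Otimes>\<^sub>M lborel)" by measurable
    have "(\<integral>\<^sup>+z. ennreal (norm (case z of (x, y) \<Rightarrow> ?F x y)) \<partial>(lborel \<Otimes>\<^sub>M lborel)) =
        (\<integral>\<^sup>+y. \<integral>\<^sup>+x. ennreal (norm (?F x y)) \<partial>lborel \<partial>lborel)"
      by (subst lborel_pair.nn_integral_snd[symmetric]) auto
    also have "\<dots> \<le> (\<integral>\<^sup>+y. \<integral>\<^sup>+x. ennreal (w y) * (ennreal ((g x)\<^sup>2) * ennreal (k y x))
        + ennreal ((f y)\<^sup>2) * ennreal (w x * k x y) \<partial>lborel \<partial>lborel)"
    proof (intro nn_integral_mono)
      fix x y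
      have "norm (?F x y) = \<bar>g x * f y\<bar> * (k y x * w y)"
        using k_nonneg[of y x] w_nonneg[of y] by (simp add: abs_mult mult_ac)
      also have "\<dots> \<le> ((g x)\<^sup>2 + (f y)\<^sup>2) * (k y x * w y)"
        using two_abs_mult_le[of "g x" "f y"] k_nonneg w_nonneg
        by (intro mult_right_mono mult_nonneg_nonneg) linarith+
      also have "\<dots> = w y * ((g x)\<^sup>2 * k y x) + (f y)\<^sup>2 * (w x * k x y)"
        using reversible[of y x] by (simp add: algebra_simps)
      finally have "ennreal (norm (?F x y)) \<le> ennreal (w y * ((g x)\<^sup>2 * k y x) + (f y)\<^sup>2 * (w x * k x y))"
        by (rule ennreal_leI)
      also have "\<dots> = ennreal (w y) * (ennreal ((g x)\<^sup>2) * ennreal (k y x)) + ennreal ((f y)\<^sup>2) * ennreal (w x * k x y)"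
        by (simp add: ennreal_plus ennreal_mult w_nonneg k_nonneg)
      finally show "ennreal (norm (?F x y)) \<le>
        ennreal (w y) * (ennreal ((g x)\<^sup>2) * ennreal (k y x)) + ennreal ((f y)\<^sup>2) * ennreal (w x * k x y)" .
    qed
    also have "\<dots> = (\<integral>\<^sup>+y. ennreal (w y) * kernel_op k (\<lambda>x. ennreal ((g x)\<^sup>2)) y \<partial>lborel)
        + (\<integral>\<^sup>+y. \<integral>\<^sup>+x. ennreal ((f y)\<^sup>2) * ennreal (w x * k x y) \<partial>lborel \<partial>lborel)"
      by (simp add: nn_integral_add nn_integral_cmult)
    also have "(\<integral>\<^sup>+y. \<integral>\<^sup>+x. ennreal ((f y)\<^sup>2) * ennreal (w x * k x y) \<partial>lborel \<partial>lborel) =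
        (\<integral>\<^sup>+x. \<integral>\<^sup>+y. ennreal ((f y)\<^sup>2) * ennreal (w x * k x y) \<partial>lborel \<partial>lborel)"
      by (rule lborel_pair.Fubini') measurable
    also have "\<dots> = (\<integral>\<^sup>+x. ennreal (w x) * kernel_op k (\<lambda>y. ennreal ((f y)\<^sup>2)) x \<partial>lborel)"
      by (subst nn_integral_cmult[symmetric])
        (auto intro!: nn_integral_cong simp: ennreal_mult' k_nonneg w_nonneg mult_ac)
    also have "(\<integral>\<^sup>+y. ennreal (w y) * kernel_op k (\<lambda>x. ennreal ((g x)\<^sup>2)) y \<partial>lborel) + \<dots> < \<infinity>"
      using fin[OF f] fin[OF g] by (subst (1 2) nn_stationary) (auto simp: ennreal_mult w_nonneg)
    finally show "(\<integral>\<^sup>+z. ennreal (norm (case z of (x, y) \<Rightarrow> ?F x y)) \<partial>(lborel \<Otimes>\<^sub>M lborel)) < \<infinity>" .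
  qed
  have "ip (P g) f = (\<integral>y. \<integral>x. ?F x y \<partial>lborel \<partial>lborel)"
    unfolding ip_def P_def
  proof (intro Bochner_Integration.integral_cong refl)
    fix y
    have "(LBINT x. ?F x y) = (LBINT x. (f y * w y) * (g x * k y x))"
      by (intro Bochner_Integration.integral_cong) (auto simp: mult_ac)
    then show "(LBINT x. g x * k y x) * f y * w y = (LBINT x. ?F x y)"
      by (simp only: integral_mult_right_zero) (simp only: mult_ac)
  qed
  also have "\<dots> = (\<integral>x. \<integral>y. ?F x y \<partial>lborel \<partial>lborel)"
    by (rule lborel_pair.Fubini_integral[OF int])
  also have "\<dots> = (\<integral>x. \<integral>y. g x * w x * (f y * k x y) \<partial>lborel \<partial>lborel)"
  proof (intro Bochner_Integration.integral_cong refl)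
    fix x y
    have "?F x y = g x * f y * (w y * k y x)" by (simp add: mult_ac)
    then show "?F x y = g x * w x * (f y * k x y)" by (simp add: reversible[of y x] mult_ac)
  qed
  also have "\<dots> = ip g (P f)"
    unfolding ip_def P_def
    by (intro Bochner_Integration.integral_cong refl)
      (simp only: integral_mult_right_zero, simp only: mult_ac)
  finally show ?thesis .
qed

lemma P_h: "0 < w y \<Longrightarrow> P (poly (h n)) y = r ^ n * poly (h n) y"
  using eigen[of y n] by (simp add: P_def mult.commute)

text \<open>Self-adjointness moves \<open>P\<close> onto the eigenpolynomial, so the inner products
  of \<open>P g\<close> are known without an expansion of \<open>g\<close>.\<close>

lemma ip_P_h:
  assumes g: "L2 g"
  shows "ip (P g) (poly (h n)) = r ^ n * ip g (poly (h n))"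
proof -
  have "ip (P g) (poly (h n)) = ip (P (poly (h n))) g"
    using P_self_adjoint[OF L2_poly g, of "h n"] by (simp add: ip_commute)
  also have "\<dots> = ip (\<lambda>x. r ^ n * poly (h n) x) g"
  proof (rule ip_cong_AE)
    have "P (poly (h n)) x * w x = r ^ n * poly (h n) x * w x" for x
      using P_h[of x n] w_nonneg[of x] by (cases "0 < w x") auto
    then show "AE x in lborel. P (poly (h n)) x * w x = r ^ n * poly (h n) x * w x" by simp
  qed (intro L2_P L2_cmult L2_poly g)+
  also have "\<dots> = r ^ n * ip g (poly (h n))"
    by (simp add: ip_cmult ip_commute)
  finally show ?thesis .
qed

text \<open>Eigenfunctions of a self-adjoint operator for different eigenvalues;
  \<open>r ^ m\<close> and \<open>r ^ n\<close> differ because their absolute values do, which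
  covers negative \<open>r\<close>.\<close>

lemma h_orthogonal:
  assumes "m \<noteq> n"
  shows "ip (poly (h m)) (poly (h n)) = 0"
proof -
  have "r ^ m * ip (poly (h m)) (poly (h n)) = ip (P (poly (h n))) (poly (h m))"
    using ip_P_h[OF L2_poly, of "h n" m] by (simp add: ip_commute)
  also have "\<dots> = ip (P (poly (h m))) (poly (h n))"
    using P_self_adjoint[OF L2_poly L2_poly, of "h m" "h n"] by (simp add: ip_commute)
  also have "\<dots> = r ^ n * ip (poly (h m)) (poly (h n))"
    by (rule ip_P_h[OF L2_poly])
  finally have e: "r ^ m * ip (poly (h m)) (poly (h n)) = r ^ n * ip (poly (h m)) (poly (h n))" .
  have "\<bar>r\<bar> ^ m \<noteq> \<bar>r\<bar> ^ n"
    using assms r_nonzero r_less_1 by (metis zero_less_abs_iff linorder_neqE_nat order_less_irrefl power_strict_decreasing)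
  then have "r ^ m \<noteq> r ^ n" by (metis power_abs)
  then show ?thesis using e by simp
qed

section \<open>Expansions in the eigenpolynomials and completeness\<close>

definition partial :: "(nat \<Rightarrow> real) \<Rightarrow> nat \<Rightarrow> real \<Rightarrow> real" where
  "partial b N x = (\<Sum>n<N. b n * poly (h n) x)"

lemma L2_partial: "L2 (partial b N)"
  unfolding partial_def[abs_def] by (intro L2_sum L2_cmult L2_poly)

lemma ip_partial:
  assumes "L2 g"
  shows "ip (partial b N) g = (\<Sum>n<N. b n * ip g (poly (h n)))"
  unfolding partial_def[abs_def] using assms
  by (subst ip_sum) (auto intro: L2_cmult L2_poly simp: ip_cmult ip_commute[of g])

text \<open>\<open>h (Suc N)\<close> has exact degree \<open>Suc N\<close>, so a multiple of it
  removes the leading term. The bound \<open>Suc N\<close> arises because \<open>partial b N\<close>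
  stops before index \<open>N\<close>.\<close>

lemma poly_eq_partial:
  assumes "degree p \<le> N"
  shows "\<exists>b. poly p = partial b (Suc N)"
  using assms
proof (induction N arbitrary: p)
  case 0
  then obtain a where "p = [:a:]" by (auto elim: degree_eq_zeroE)
  then have "poly p = partial (\<lambda>_. a) (Suc 0)"
    by (auto simp: partial_def h_0)
  then show ?case by blast
next
  case (Suc N)
  let ?h = "h (Suc N)"
  define c where "c = coeff p (Suc N) / coeff ?h (Suc N)"
  have "?h \<noteq> 0" using degree_h[of "Suc N"] by auto
  then have nz: "coeff ?h (Suc N) \<noteq> 0"
    using degree_h[of "Suc N"] leading_coeff_neq_0 by metis
  have "degree (p - smult c ?h) \<le> N"
  proof (rule degree_le, intro allI impI)
    fix i assume "N < i"
    then consider "i = Suc N" | "Suc N < i" by linarith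
    then show "coeff (p - smult c ?h) i = 0"
    proof cases
      case 1
      then show ?thesis using nz by (simp add: c_def)
    next
      case 2
      then show ?thesis using Suc.prems degree_h[of "Suc N"] by (simp add: coeff_eq_0)
    qed
  qed
  from Suc.IH[OF this] obtain b where b: "poly (p - smult c ?h) = partial b (Suc N)" by blast
  have "poly p = partial (b(Suc N := c)) (Suc (Suc N))"
  proof
    fix x
    have "poly p x = poly (p - smult c ?h) x + c * poly ?h x" by simp
    then show "poly p x = partial (b(Suc N := c)) (Suc (Suc N)) x"
      unfolding b by (simp add: partial_def)
  qed
  then show ?case by blast
qed

lemma poly_partial: "\<exists>p. degree p \<le> N \<and> poly p = partial b (Suc N)"
proof (intro exI conjI)
  show "degree (\<Sum>n<Suc N. smult (b n) (h n)) \<le> N"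
    by (intro degree_sum_le order.trans[OF degree_smult_le]) (auto simp: degree_h)
  show "poly (\<Sum>n<Suc N. smult (b n) (h n)) = partial b (Suc N)"
    by (rule ext) (simp add: partial_def poly_sum)
qed

lemma ip_poly_eq_0:
  assumes g: "L2 g" and orth: "\<And>n. ip g (poly (h n)) = 0"
  shows "ip g (poly p) = 0"
proof -
  obtain b where "poly p = partial b (Suc (degree p))"
    using poly_eq_partial[of p "degree p"] by blast
  then show ?thesis
    using ip_partial[OF g, of b "Suc (degree p)"] orth by (simp add: ip_commute[of g])
qed

text \<open>Completeness: \<open>exp (a |x|)\<close> is in \<open>L2\<close> by
  \<open>w_exp\<close>, so its product with \<open>g\<close> is integrable against \<open>w\<close>,
  and the vanishing moments of \<open>g w\<close> force it to be 0.\<close>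

lemma AE_eq_0_if_orthogonal:
  assumes g: "L2 g" and orth: "\<And>n. ip g (poly (h n)) = 0"
  shows "AE x in lborel. g x * w x = 0"
proof (rule AE_eq_0_if_moments_0)
  note [measurable] = L2_measurable[OF g]
  show "(\<lambda>x. g x * w x) \<in> borel_measurable borel" by measurable
  show "integrable lborel (\<lambda>x. exp (a * \<bar>x\<bar>) * \<bar>g x * w x\<bar>)" for a
  proof -
    have "(exp (a * \<bar>x\<bar>))\<^sup>2 = exp (2 * a * \<bar>x\<bar>)" for x :: real
      by (simp flip: exp_double add: mult.assoc)
    then have "L2 (\<lambda>x. exp (a * \<bar>x\<bar>))"
      using w_exp[of "2 * a"] by (simp add: L2_def)
    from integrable_norm[OF L2_product_integrable[OF this g]] show ?thesis
      by (simp add: abs_mult mult.assoc)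
  qed
  show "(LBINT x. x ^ n * (g x * w x)) = 0" for n
    using ip_poly_eq_0[OF g orth, of "monom 1 n"] by (simp add: ip_def poly_monom mult_ac)
qed

definition norm_sq :: "nat \<Rightarrow> real" where
  "norm_sq n = ip (poly (h n)) (poly (h n))"

definition coef :: "(real \<Rightarrow> real) \<Rightarrow> nat \<Rightarrow> real" where
  "coef g n = ip g (poly (h n)) / norm_sq n"

text \<open>If \<open>norm_sq n\<close> vanishes, the junk value \<open>coef g n = 0\<close> is the right one.\<close>

lemma coef_norm_sq:
  assumes "L2 g"
  shows "coef g n * norm_sq n = ip g (poly (h n))"
proof (cases "norm_sq n = 0")
  case True
  then have "AE x in lborel. (poly (h n) x)\<^sup>2 * w x = 0"
    using L2_integrable[OF L2_poly, of "h n"] unfolding norm_sq_def ip_self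
    by (subst (asm) integral_nonneg_eq_0_iff_AE) (auto simp: w_nonneg)
  then have "AE x in lborel. poly (h n) x * w x = 0 * w x"
    by eventually_elim auto
  from ip_cong_AE[OF L2_poly _ assms this] have "ip (poly (h n)) g = ip (\<lambda>_. 0) g"
    by (simp add: L2_def)
  then show ?thesis
    using True by (simp add: ip_commute[of g]) (simp add: ip_def)
qed (simp add: coef_def)

lemma ip_partial_h:
  "ip (partial b N) (poly (h n)) = (if n < N then b n * norm_sq n else 0)"
proof -
  have "ip (partial b N) (poly (h n)) = (\<Sum>m<N. if m = n then b n * norm_sq n else 0)"
    unfolding ip_partial[OF L2_poly] using h_orthogonal[of n]
    by (intro sum.cong) (auto simp: norm_sq_def)
  then show ?thesis by simp
qed

lemma ip_partial_self: "ip (partial b N) (partial b N) = (\<Sum>n<N. (b n)\<^sup>2 * norm_sq n)"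
  unfolding ip_partial[OF L2_partial] ip_partial_h
  by (intro sum.cong) (auto simp: power2_eq_square)

text \<open>The squared norm of \<open>g\<close> minus its partial expansion is nonnegative.\<close>

lemma bessel:
  assumes g: "L2 g"
  shows "(\<Sum>n<N. (coef g n)\<^sup>2 * norm_sq n) \<le> ip g g"
proof -
  let ?S = "partial (coef g) N"
  have 1: "ip ?S g = (\<Sum>n<N. (coef g n)\<^sup>2 * norm_sq n)"
    unfolding ip_partial[OF g]
    by (intro sum.cong refl) (simp add: coef_norm_sq[OF g, symmetric] power2_eq_square)
  have D: "L2 (\<lambda>x. g x - ?S x)" by (intro L2_diff g L2_partial)
  have "0 \<le> ip (\<lambda>x. g x - ?S x) (\<lambda>x. g x - ?S x)" by (rule ip_self_nonneg)
  also have "\<dots> = ip g (\<lambda>x. g x - ?S x) - ip ?S (\<lambda>x. g x - ?S x)"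
    by (rule ip_diff[OF g L2_partial D])
  also have "\<dots> = (ip g g - ip ?S g) - (ip g ?S - ip ?S ?S)"
    using ip_diff[OF g L2_partial g] ip_diff[OF g L2_partial L2_partial]
      ip_commute[of g "\<lambda>x. g x - ?S x"] ip_commute[of ?S "\<lambda>x. g x - ?S x"]
    by (simp only:)
  also have "\<dots> = ip g g - (\<Sum>n<N. (coef g n)\<^sup>2 * norm_sq n)"
    using 1 by (simp add: ip_commute[of g ?S] ip_partial_self)
  finally show ?thesis by simp
qed

lemma bessel_single:
  assumes g: "L2 g"
  shows "(coef g n)\<^sup>2 * norm_sq n \<le> ip g g"
proof -
  have "(coef g n)\<^sup>2 * norm_sq n \<le> (\<Sum>n<Suc n. (coef g n)\<^sup>2 * norm_sq n)"
    by (simp add: sum_nonneg norm_sq_def ip_self_nonneg)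
  then show ?thesis using bessel[OF g, of "Suc n"] by linarith
qed

text \<open>The spectral expansion of \<open>P g\<close> converges in \<open>L\<^sup>1\<close> by geometric decay of the eigenvalues, so
  no completeness of \<open>L\<^sup>2\<close> is needed; its limit has the Fourier coefficients of \<open>P g\<close> and, by Fatou,
  norm at most \<open>\<bar>r\<bar>\<close> times that of \<open>g\<close>.\<close>

theorem P_contraction:
  assumes g: "L2 g" and g0: "ip g (\<lambda>_. 1) = 0"
  shows "ip (P g) (P g) \<le> r\<^sup>2 * ip g g"
proof -
  note [measurable] = L2_measurable[OF g]
  \<comment> \<open>The coefficients that \<open>P g\<close> must have by
    \<open>ip_P_h\<close>.\<close>
  define b where "b n = r ^ n * coef g n" for n
  let ?p = "\<lambda>n x. coef g n * poly (h n) x"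
  have pL2: "L2 (?p n)" for n by (intro L2_cmult L2_poly)
  have pnorm: "ip (?p n) (?p n) \<le> ip g g" for n
  proof -
    have "ip (?p n) (?p n) = (coef g n)\<^sup>2 * norm_sq n"
      using ip_cmult[of "coef g n" "poly (h n)" "?p n"] ip_cmult[of "coef g n" "poly (h n)" "poly (h n)"]
        ip_commute[of "poly (h n)" "?p n"]
      by (simp add: norm_sq_def power2_eq_square)
    then show ?thesis using bessel_single[OF g] by simp
  qed
  have fint: "integrable lborel (\<lambda>x. b n * poly (h n) x * f x * w x)" if "L2 f" for f n
    using L2_product_integrable[OF L2_cmult[OF L2_poly] that] .
  \<comment> \<open>Bounding the product by the sum of squares keeps the geometric factor outside,
    as each \<open>?p n\<close> has norm at most that of \<open>g\<close>.\<close>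
  have bound: "(LBINT x. norm (b n * poly (h n) x * f x * w x)) \<le> \<bar>r\<bar> ^ n * (ip g g + ip f f)"
    if f: "L2 f" for f n
  proof -
    note [measurable] = L2_measurable[OF f]
    have "(LBINT x. norm (b n * poly (h n) x * f x * w x)) \<le>
        (LBINT x. \<bar>r\<bar> ^ n * ((?p n x)\<^sup>2 * w x + (f x)\<^sup>2 * w x))"
    proof (rule integral_mono[OF integrable_norm[OF fint[OF f]]])
      show "integrable lborel (\<lambda>x. \<bar>r\<bar> ^ n * ((?p n x)\<^sup>2 * w x + (f x)\<^sup>2 * w x))"
        using L2_integrable[OF pL2] L2_integrable[OF f] by simp
      fix x
      have "norm (b n * poly (h n) x * f x * w x) = \<bar>r\<bar> ^ n * (\<bar>?p n x * f x\<bar> * w x)"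
        using w_nonneg[of x] by (simp add: b_def abs_mult power_abs mult_ac)
      also have "\<dots> \<le> \<bar>r\<bar> ^ n * (((?p n x)\<^sup>2 + (f x)\<^sup>2) * w x)"
      proof (intro mult_left_mono mult_right_mono)
        show "\<bar>?p n x * f x\<bar> \<le> (?p n x)\<^sup>2 + (f x)\<^sup>2"
          using two_abs_mult_le[of "?p n x" "f x"] by linarith
      qed (auto simp: w_nonneg)
      finally show "norm (b n * poly (h n) x * f x * w x) \<le> \<bar>r\<bar> ^ n * ((?p n x)\<^sup>2 * w x + (f x)\<^sup>2 * w x)"
        by (simp add: distrib_right)
    qed
    also have "\<dots> = \<bar>r\<bar> ^ n * (ip (?p n) (?p n) + ip f f)"
      using L2_integrable[OF pL2, of n] L2_integrable[OF f] by (simp add: ip_self)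
    also have "\<dots> \<le> \<bar>r\<bar> ^ n * (ip g g + ip f f)"
      using pnorm by (intro mult_left_mono) auto
    finally show ?thesis .
  qed
  have sumint: "summable (\<lambda>n. LBINT x. norm (b n * poly (h n) x * f x * w x))" if "L2 f" for f
  proof (rule summable_comparison_test')
    show "summable (\<lambda>n. \<bar>r\<bar> ^ n * (ip g g + ip f f))"
      using r_less_1 by (intro summable_mult2 summable_geometric) simp
  qed (use bound[OF that] in simp)
  have one: "L2 (\<lambda>_. 1)" using L2_poly[of "[:1:]"] by (simp add: poly_pCons[abs_def])
  \<comment> \<open>The bound with \<open>f = 1\<close> yields absolute convergence almost
    everywhere.\<close>
  have AEsum: "AE x in lborel. summable (\<lambda>n. \<bar>b n * poly (h n) x\<bar> * w x)"
  proof -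
    have "(\<integral>\<^sup>+x. (\<Sum>n. ennreal (\<bar>b n * poly (h n) x\<bar> * w x)) \<partial>lborel) =
        (\<Sum>n. \<integral>\<^sup>+x. ennreal (norm (b n * poly (h n) x * 1 * w x)) \<partial>lborel)"
      by (subst nn_integral_suminf) (simp_all add: abs_mult w_nonneg)
    also have "\<dots> = (\<Sum>n. ennreal (LBINT x. norm (b n * poly (h n) x * 1 * w x)))"
      by (subst nn_integral_eq_integral[OF integrable_norm[OF fint[OF one]]]) auto
    also have "\<dots> < \<infinity>"
      using sumint[OF one] by (subst suminf_ennreal2) auto
    finally have "AE x in lborel. (\<Sum>n. ennreal (\<bar>b n * poly (h n) x\<bar> * w x)) \<noteq> \<infinity>"
      by (intro nn_integral_PInf_AE) auto
    then show ?thesis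
      by eventually_elim (auto intro!: summable_suminf_not_top simp: w_nonneg)
  qed
  have Fsum: "AE x in lborel. w x \<noteq> 0 \<longrightarrow> summable (\<lambda>n. b n * poly (h n) x)"
    using AEsum
  proof eventually_elim
    case (elim x)
    show ?case
    proof
      assume "w x \<noteq> 0"
      then have "summable (\<lambda>n. \<bar>b n * poly (h n) x\<bar>)"
        using summable_mult2[OF elim, of "1 / w x"] by simp
      then show "summable (\<lambda>n. b n * poly (h n) x)" by (rule summable_rabs_cancel)
    qed
  qed
  define F where "F x = (\<Sum>n. b n * poly (h n) x)" for x
  have [measurable]: "F \<in> borel_measurable borel" unfolding F_def[abs_def] by measurable
  have lim: "AE x in lborel. (\<lambda>N. (partial b N x)\<^sup>2 * w x) \<longlonglongrightarrow> (F x)\<^sup>2 * w x"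
    using Fsum
  proof eventually_elim
    case (elim x)
    show ?case
    proof (cases "w x = 0")
      case False
      with elim have "(\<lambda>N. partial b N x) \<longlonglongrightarrow> F x"
        unfolding partial_def F_def by (intro summable_LIMSEQ) simp
      then show ?thesis by (intro tendsto_intros)
    qed simp
  qed
  have part: "ip (partial b N) (partial b N) \<le> r\<^sup>2 * ip g g" for N
  proof -
    have "poly (h 0) = (\<lambda>_. 1)" by (simp add: h_0 fun_eq_iff)
    \<comment> \<open>Mean zero removes the index 0, the only one whose eigenvalue exceeds
      \<open>|r|\<close> in modulus.\<close>
    then have c0: "coef g 0 = 0" using g0 by (simp add: coef_def)
    have "(b n)\<^sup>2 * norm_sq n \<le> r\<^sup>2 * ((coef g n)\<^sup>2 * norm_sq n)" for n
    proof (cases n)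
      case 0
      then show ?thesis using c0 by (simp add: b_def)
    next
      case (Suc m)
      have "(r ^ n)\<^sup>2 \<le> r\<^sup>2"
      proof -
        have "\<bar>r ^ m\<bar> \<le> 1" using r_less_1 by (simp add: power_abs power_le_one)
        then have "\<bar>r * r ^ m\<bar> \<le> \<bar>r\<bar> * 1" unfolding abs_mult by (intro mult_left_mono) auto
        then show ?thesis using Suc by (simp add: abs_le_square_iff[symmetric])
      qed
      then have "(r ^ n)\<^sup>2 * ((coef g n)\<^sup>2 * norm_sq n) \<le> r\<^sup>2 * ((coef g n)\<^sup>2 * norm_sq n)"
        by (intro mult_right_mono) (auto simp: norm_sq_def ip_self_nonneg)
      then show ?thesis by (simp add: b_def power_mult_distrib mult_ac)
    qed
    then have "ip (partial b N) (partial b N) \<le> (\<Sum>n<N. r\<^sup>2 * ((coef g n)\<^sup>2 * norm_sq n))"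
      unfolding ip_partial_self by (intro sum_mono)
    also have "\<dots> \<le> r\<^sup>2 * ip g g"
      using bessel[OF g, of N] by (simp flip: sum_distrib_left add: mult_left_mono)
    finally show ?thesis .
  qed
  have Fnn: "(\<integral>\<^sup>+x. ennreal ((F x)\<^sup>2 * w x) \<partial>lborel) \<le> ennreal (r\<^sup>2 * ip g g)"
  proof -
    have "(\<integral>\<^sup>+x. ennreal ((F x)\<^sup>2 * w x) \<partial>lborel) =
        (\<integral>\<^sup>+x. liminf (\<lambda>N. ennreal ((partial b N x)\<^sup>2 * w x)) \<partial>lborel)"
    proof (rule nn_integral_cong_AE, use lim in eventually_elim)
      case (elim x)
      then have "(\<lambda>N. ennreal ((partial b N x)\<^sup>2 * w x)) \<longlonglongrightarrow> ennreal ((F x)\<^sup>2 * w x)"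
        by (rule tendsto_ennrealI)
      then show ?case by (intro lim_imp_Liminf[symmetric]) auto
    qed
    also have "\<dots> \<le> liminf (\<lambda>N. \<integral>\<^sup>+x. ennreal ((partial b N x)\<^sup>2 * w x) \<partial>lborel)"
    proof (rule nn_integral_liminf)
      fix N
      have [measurable]: "partial b N \<in> borel_measurable borel" by (rule L2_measurable[OF L2_partial])
      show "(\<lambda>x. ennreal ((partial b N x)\<^sup>2 * w x)) \<in> borel_measurable lborel" by measurable
    qed
    also have "\<dots> \<le> liminf (\<lambda>N :: nat. ennreal (r\<^sup>2 * ip g g))"
    proof (intro Liminf_mono always_eventually allI)
      fix N
      have "(\<integral>\<^sup>+x. ennreal ((partial b N x)\<^sup>2 * w x) \<partial>lborel) = ennreal (ip (partial b N) (partial b N))"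
        unfolding ip_self using L2_integrable[OF L2_partial]
        by (intro nn_integral_eq_integral) (auto simp: w_nonneg)
      then show "(\<integral>\<^sup>+x. ennreal ((partial b N x)\<^sup>2 * w x) \<partial>lborel) \<le> ennreal (r\<^sup>2 * ip g g)"
        using part by (simp add: ennreal_leI)
    qed
    also have "\<dots> = ennreal (r\<^sup>2 * ip g g)" by (simp add: Liminf_const)
    finally show ?thesis .
  qed
  have FL2: "L2 F"
    unfolding L2_def
    using Fnn by (auto intro!: integrableI_nonneg simp: w_nonneg intro: order.strict_trans1)
  have "ennreal (ip F F) \<le> ennreal (r\<^sup>2 * ip g g)"
    using Fnn L2_integrable[OF FL2] unfolding ip_self[of F]
    by (subst nn_integral_eq_integral[symmetric]) (auto simp: w_nonneg)
  then have FF: "ip F F \<le> r\<^sup>2 * ip g g"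
    by (subst (asm) ennreal_le_iff) (auto simp: ip_self_nonneg)
  have Fh: "ip F (poly (h m)) = r ^ m * ip g (poly (h m))" for m
  proof -
    let ?f = "poly (h m)"
    have s1: "AE x in lborel. summable (\<lambda>n. norm (b n * poly (h n) x * ?f x * w x))"
      using AEsum
    proof eventually_elim
      case (elim x)
      from summable_mult2[OF this, of "\<bar>?f x\<bar>"] show ?case
        using w_nonneg[of x] by (simp add: abs_mult mult_ac)
    qed
    have "ip F ?f = (LBINT x. (\<Sum>n. b n * poly (h n) x * ?f x * w x))"
      unfolding ip_def
    proof (rule integral_cong_AE)
      show "AE x in lborel. F x * ?f x * w x = (\<Sum>n. b n * poly (h n) x * ?f x * w x)"
        using Fsum
      proof eventually_elim
        case (elim x)
        show ?case
        proof (cases "w x = 0")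
          case False
          from suminf_mult2[OF elim[rule_format, OF this], of "?f x * w x"] show ?thesis
            unfolding F_def by (simp add: mult.assoc)
        qed simp
      qed
    qed measurable
    also have "\<dots> = (\<Sum>n. LBINT x. b n * poly (h n) x * ?f x * w x)"
      by (rule integral_suminf[OF fint[OF L2_poly] s1 sumint[OF L2_poly]])
    also have "\<dots> = (\<Sum>n. if n = m then b m * norm_sq m else 0)"
    proof (rule arg_cong[where f = suminf], rule ext)
      fix n
      have "(LBINT x. b n * poly (h n) x * ?f x * w x) = b n * ip (poly (h n)) ?f"
        using ip_cmult[of "b n" "poly (h n)" ?f] by (simp add: ip_def)
      then show "(LBINT x. b n * poly (h n) x * ?f x * w x) = (if n = m then b m * norm_sq m else 0)"
        using h_orthogonal[of n m] by (auto simp: norm_sq_def)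
    qed
    also have "\<dots> = b m * norm_sq m"
      by (subst suminf_finite[of "{m}"]) auto
    also have "\<dots> = r ^ m * ip g ?f"
      using coef_norm_sq[OF g, of m] by (simp add: b_def)
    finally show ?thesis .
  qed
  have D: "L2 (\<lambda>x. P g x - F x)" by (intro L2_diff L2_P g FL2)
  \<comment> \<open>\<open>P g\<close> and \<open>F\<close> have the same inner product with every
    \<open>h m\<close>, so completeness identifies them on the support.\<close>
  have "AE x in lborel. (P g x - F x) * w x = 0"
    by (rule AE_eq_0_if_orthogonal[OF D])
      (simp add: ip_diff[OF L2_P[OF g] FL2 L2_poly] Fh ip_P_h[OF g])
  then have eq: "AE x in lborel. P g x * w x = F x * w x"
    by eventually_elim (simp add: algebra_simps)
  have "ip (P g) (P g) = ip F (P g)" by (rule ip_cong_AE[OF L2_P[OF g] FL2 L2_P[OF g] eq])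
  also have "\<dots> = ip (P g) F" by (rule ip_commute)
  also have "\<dots> = ip F F" by (rule ip_cong_AE[OF L2_P[OF g] FL2 FL2 eq])
  finally show ?thesis using FF by simp
qed

lemma ip_P_1:
  assumes "L2 g"
  shows "ip (P g) (\<lambda>_. 1) = ip g (\<lambda>_. 1)"
proof -
  have "poly (h 0) = (\<lambda>_. 1)" by (simp add: h_0 fun_eq_iff)
  then show ?thesis using ip_P_h[OF assms, of 0] by simp
qed

text \<open>The polynomial obtained is the orthogonal projection of \<open>g\<close> to degrees up
  to \<open>n\<close>; what is left of \<open>g\<close> is orthogonal to every
  \<open>h m\<close>.\<close>

theorem P_poly_imp_poly:
  assumes g: "L2 g" and eq: "AE y in lborel. 0 < w y \<longrightarrow> P g y = poly p y" and deg: "degree p \<le> n"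
  shows "\<exists>p'. degree p' \<le> n \<and> (AE x in lborel. 0 < w x \<longrightarrow> g x = poly p' x)"
proof -
  have eq': "AE y in lborel. P g y * w y = poly p y * w y"
    using eq by eventually_elim (metis w_nonneg less_eq_real_def mult_zero_right)
  have high: "ip g (poly (h m)) = 0" if "n < m" for m
  proof -
    have "r ^ m * ip g (poly (h m)) = ip (poly p) (poly (h m))"
      using ip_P_h[OF g, of m] ip_cong_AE[OF L2_P[OF g] L2_poly L2_poly eq', of "h m"] by simp
    also have "\<dots> = 0"
    proof -
      obtain b where "poly p = partial b (Suc n)"
        using poly_eq_partial[OF deg] by blast
      then show ?thesis using that by (simp add: ip_partial_h)
    qed
    finally show ?thesis using r_nonzero by simp
  qed
  have D: "AE x in lborel. (g x - partial (coef g) (Suc n) x) * w x = 0"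
  proof (rule AE_eq_0_if_orthogonal[OF L2_diff[OF g L2_partial]])
    fix m
    show "ip (\<lambda>x. g x - partial (coef g) (Suc n) x) (poly (h m)) = 0"
      using high[of m] by (simp add: ip_diff[OF g L2_partial L2_poly] ip_partial_h coef_norm_sq[OF g])
  qed
  obtain p' where p': "degree p' \<le> n" "poly p' = partial (coef g) (Suc n)"
    using poly_partial by blast
  have "AE x in lborel. 0 < w x \<longrightarrow> g x = poly p' x"
    using D by eventually_elim (auto simp: p')
  then show ?thesis using p' by blast
qed

end

section \<open>The Gaussian case\<close>

lemma f_N_1: "f_N 1 x = std_normal_density x"
  by (simp add: f_N_def std_normal_density_def)

lemma f_CN_1:
  assumes "\<bar>r\<bar> < 1"
  shows "f_CN 1 r y x = normal_density (r * y) (sqrt (1 - r\<^sup>2)) x"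
  using assms by (simp add: f_CN_def normal_density_def abs_square_le_1 less_imp_le)

text \<open>Viewed as a linear functional on polynomials, so that Gaussian integration by parts can
  be verified on monomials.\<close>

definition gauss_mean :: "real poly \<Rightarrow> real" where
  "gauss_mean p = (LBINT z. std_normal_density z * poly p z)"

lemma std_normal_monomial_integrable: "integrable lborel (\<lambda>z. std_normal_density z * z ^ n)"
proof (cases "even n")
  case True
  then obtain m where "n = 2 * m" by blast
  then show ?thesis using std_normal_moment_even[of m] by (simp add: has_bochner_integral_iff)
next
  case False
  then obtain m where "n = 2 * m + 1" by (elim oddE)
  then show ?thesis using std_normal_moment_odd[of m] by (simp add: has_bochner_integral_iff)
qed

lemma std_normal_poly_integrable: "integrable lborel (\<lambda>z. std_normal_density z * poly p z)"
proof -
  have "integrable lborel (\<lambda>z. \<Sum>i\<le>degree p. coeff p i * (std_normal_density z * z ^ i))"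
    by (intro Bochner_Integration.integrable_sum integrable_mult_right std_normal_monomial_integrable)
  then show ?thesis
    by (simp add: poly_altdef sum_distrib_left mult_ac)
qed

lemma gauss_mean_add: "gauss_mean (p + p') = gauss_mean p + gauss_mean p'"
  using std_normal_poly_integrable[of p] std_normal_poly_integrable[of p']
  by (simp add: gauss_mean_def distrib_left)

lemma gauss_mean_smult: "gauss_mean (smult c p) = c * gauss_mean p"
proof -
  have "gauss_mean (smult c p) = (LBINT z. c * (std_normal_density z * poly p z))"
    unfolding gauss_mean_def by (intro Bochner_Integration.integral_cong) auto
  then show ?thesis by (simp add: gauss_mean_def)
qed

text \<open>For even \<open>n\<close> both sides are odd moments and vanish; for odd
  \<open>n\<close> this is the recurrence of the values \<open>(2m)! / (2^m m!)\<close>.\<close>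

lemma gauss_mean_monom_rec: "gauss_mean (monom 1 (Suc n)) = gauss_mean (pderiv (monom 1 n))"
proof (cases "even n")
  case True
  then obtain m where n: "n = 2 * m" by blast
  have odd: "gauss_mean (monom 1 (2 * m + 1)) = 0" for m
    using std_normal_moment_odd[of m] by (simp add: gauss_mean_def poly_monom has_bochner_integral_iff)
  show ?thesis
  proof (cases m)
    case 0
    then show ?thesis
      using odd[of 0] n by (simp add: pderiv_monom) (simp add: gauss_mean_def)
  next
    case (Suc l)
    have "pderiv (monom 1 n) = smult (real n) (monom 1 (2 * l + 1))"
      by (simp add: pderiv_monom n Suc smult_monom)
    then show ?thesis
      using odd[of m] odd[of l] n by (simp add: gauss_mean_smult)
  qed
next
  case False
  then obtain m where n: "n = 2 * m + 1" by (elim oddE)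
  have 1: "gauss_mean (monom 1 (2 * m)) = fact (2 * m) / (2 ^ m * fact m)" for m
    using std_normal_moment_even[of m] by (simp add: gauss_mean_def poly_monom has_bochner_integral_iff)
  have "pderiv (monom 1 n) = smult (real n) (monom 1 (2 * m))"
    by (simp add: pderiv_monom n smult_monom)
  then have "gauss_mean (pderiv (monom 1 n)) = real n * (fact (2 * m) / (2 ^ m * fact m))"
    by (simp add: gauss_mean_smult 1)
  moreover have "gauss_mean (monom 1 (Suc n)) = fact (2 * Suc m) / (2 ^ Suc m * fact (Suc m))"
    using 1[of "Suc m"] by (simp add: n)
  moreover have "fact (2 * Suc m) / (2 ^ Suc m * fact (Suc m)) = real n * (fact (2 * m) / (2 ^ m * fact m))"
  proof -
    have "fact (2 * Suc m) = (2 * real (Suc m)) * (real n * fact (2 * m))"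
      "2 ^ Suc m * fact (Suc m) = (2 * real (Suc m)) * (2 ^ m * fact m :: real)"
      by (simp_all add: n algebra_simps)
    then show ?thesis by (simp only: mult_divide_mult_cancel_left_if) simp
  qed
  ultimately show ?thesis by simp
qed

text \<open>Stein's identity, extended from monomials by linearity.\<close>

lemma gauss_mean_stein: "gauss_mean ([:0, 1:] * p) = gauss_mean (pderiv p)"
proof -
  have "gauss_mean ([:0, 1:] * (\<Sum>i\<le>n. smult (c i) (monom 1 i))) =
      gauss_mean (pderiv (\<Sum>i\<le>n. smult (c i) (monom 1 i)))" for c and n
  proof (induction n)
    case 0
    then show ?case
      using gauss_mean_monom_rec[of 0] gauss_mean_smult[of "c 0" "monom 1 1"] gauss_mean_smult[of "c 0" "pderiv (monom 1 0)"]
      by (simp add: monom_Suc monom_0 pderiv_pCons)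
  next
    case (Suc n)
    have "[:0, 1:] * smult (c (Suc n)) (monom 1 (Suc n)) = smult (c (Suc n)) (monom 1 (Suc (Suc n)))"
      by (simp add: monom_Suc)
    moreover have "pderiv (smult (c (Suc n)) (monom 1 (Suc n))) = smult (c (Suc n)) (pderiv (monom 1 (Suc n)))"
      by (rule pderiv_smult)
    ultimately show ?case
      using Suc gauss_mean_monom_rec[of "Suc n"]
      by (simp only: sum.atMost_Suc distrib_left gauss_mean_add pderiv_add gauss_mean_smult)
  qed
  from this[where n = "degree p" and c = "coeff p"] show ?thesis
    by (simp add: smult_monom poly_as_sum_of_monoms)
qed

text \<open>The Ornstein--Uhlenbeck operator: the mean of \<open>p\<close> at \<open>r y + sqrt (1 - r\<^sup>2) Z\<close> with \<open>Z\<close> standard normal.\<close>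

definition normal_op :: "real \<Rightarrow> real poly \<Rightarrow> real \<Rightarrow> real" where
  "normal_op r p y = gauss_mean (pcompose p [:r * y, sqrt (1 - r\<^sup>2):])"

text \<open>Stein's identity for \<open>p (r y + s Z)\<close> with \<open>s^2 = 1 - r^2\<close>: one
  factor \<open>s\<close> multiplies \<open>Z\<close>, the chain rule supplies the other.\<close>

lemma normal_op_X:
  assumes "\<bar>r\<bar> < 1"
  shows "normal_op r ([:0, 1:] * p) y = r * y * normal_op r p y + (1 - r\<^sup>2) * normal_op r (pderiv p) y"
proof -
  let ?L = "[:r * y, sqrt (1 - r\<^sup>2):]"
  have s: "sqrt (1 - r\<^sup>2) * sqrt (1 - r\<^sup>2) = 1 - r\<^sup>2"
    using assms by (simp add: abs_square_le_1 less_imp_le)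
  have "pcompose ([:0, 1:] * p) ?L =
      smult (r * y) (pcompose p ?L) + smult (sqrt (1 - r\<^sup>2)) ([:0, 1:] * pcompose p ?L)"
    by (simp add: pcompose_mult pcompose_pCons mult_pCons_left)
  then have "normal_op r ([:0, 1:] * p) y = r * y * normal_op r p y +
      sqrt (1 - r\<^sup>2) * gauss_mean (pderiv (pcompose p ?L))"
    unfolding normal_op_def by (simp only: gauss_mean_add gauss_mean_smult gauss_mean_stein)
  also have "pderiv (pcompose p ?L) = smult (sqrt (1 - r\<^sup>2)) (pcompose (pderiv p) ?L)"
    by (simp add: pderiv_pcompose pderiv_pCons mult.commute)
  finally show ?thesis
    unfolding gauss_mean_smult normal_op_def[symmetric] using s by algebra
qed

lemma normal_op_diff: "normal_op r (p - p') y = normal_op r p y - normal_op r p' y"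
  using gauss_mean_add[of "pcompose p [:r * y, sqrt (1 - r\<^sup>2):]" "smult (- 1) (pcompose p' [:r * y, sqrt (1 - r\<^sup>2):])"]
    gauss_mean_smult[of "- 1" "pcompose p' [:r * y, sqrt (1 - r\<^sup>2):]"]
  by (simp add: normal_op_def pcompose_diff)

lemma normal_op_smult: "normal_op r (smult c p) y = c * normal_op r p y"
  by (simp add: normal_op_def pcompose_smult gauss_mean_smult)

text \<open>The probabilists' Hermite polynomials.\<close>

abbreviation hermite :: "nat \<Rightarrow> real poly" where
  "hermite \<equiv> three_term_poly 1 real"

lemma pderiv_hermite: "pderiv (hermite (Suc n)) = smult (real (Suc n)) (hermite n)"
proof (induction n rule: induct_nat_012)
  case (ge2 n)
  have "pderiv (hermite (Suc (Suc (Suc n)))) =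
      hermite (Suc (Suc n)) + [:0, 1:] * pderiv (hermite (Suc (Suc n)))
      - smult (real (Suc (Suc n))) (pderiv (hermite (Suc n)))"
    by (simp only: three_term_poly.simps(3)[of _ _ "Suc n"] pderiv_diff pderiv_mult pderiv_smult)
      (simp add: pderiv_pCons)
  also have "\<dots> = smult (real (Suc (Suc (Suc n)))) (hermite (Suc (Suc n)))"
    unfolding ge2 by (rule poly_eqI) (simp add: algebra_simps coeff_pCons split: nat.splits)
  finally show ?case .
qed (auto simp: pderiv_pCons pderiv_mult pderiv_diff pderiv_smult smult_add_right numeral_eq_Suc)

text \<open>After \<open>normal_op_X\<close>, the two multiples of the image of
  \<open>hermite n\<close> combine to the factor \<open>- r^2 (n + 1)\<close>, so the recurrence
  reproduces itself with one factor \<open>r\<close> per degree.\<close>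

lemma normal_op_hermite:
  assumes "\<bar>r\<bar> < 1"
  shows "normal_op r (hermite n) y = r ^ n * poly (hermite n) y"
proof (induction n rule: induct_nat_012)
  case 0
  then show ?case by (simp add: normal_op_def gauss_mean_def pcompose_1)
next
  case 1
  have "normal_op r ([:0, 1:] * 1) y = r * y * normal_op r 1 y + (1 - r\<^sup>2) * normal_op r (pderiv 1) y"
    by (rule normal_op_X[OF assms])
  then show ?case by (simp add: normal_op_def gauss_mean_def pcompose_1)
next
  case (ge2 n)
  have "normal_op r (hermite (Suc (Suc n))) y =
      r * y * normal_op r (hermite (Suc n)) y + (1 - r\<^sup>2) * (real (Suc n) * normal_op r (hermite n) y)
      - real (Suc n) * normal_op r (hermite n) y"
    by (simp only: three_term_poly.simps(3) normal_op_diff normal_op_X[OF assms] normal_op_smult pderiv_hermite)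
  also have "\<dots> = r ^ Suc (Suc n) * poly (hermite (Suc (Suc n))) y"
    unfolding ge2 by (simp add: algebra_simps power2_eq_square)
  finally show ?case .
qed

text \<open>The substitution \<open>x = r y + sqrt (1 - r^2) z\<close> standardises the conditional
  density.\<close>

lemma f_CN_eigen_1:
  assumes "\<bar>r\<bar> < 1"
  shows "integrable lborel (\<lambda>x. f_CN 1 r y x * poly p x)"
    and "(LBINT x. f_CN 1 r y x * poly p x) = normal_op r p y"
proof -
  define s where "s = sqrt (1 - r\<^sup>2)"
  have s: "0 < s" using assms by (simp add: s_def abs_square_less_1)
  have tr: "f_CN 1 r y (r * y + s * z) * poly p (r * y + s * z) =
      inverse s * (std_normal_density z * poly (pcompose p [:r * y, s:]) z)" for z
    using s unfolding f_CN_1[OF assms] s_def[symmetric]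
    by (simp add: normal_density_def poly_pcompose power_mult_distrib real_sqrt_mult field_simps)
  show i: "integrable lborel (\<lambda>x. f_CN 1 r y x * poly p x)"
    using s by (subst lborel_integrable_real_affine_iff[symmetric, of s _ "r * y"])
      (simp_all add: tr std_normal_poly_integrable)
  show "(LBINT x. f_CN 1 r y x * poly p x) = normal_op r p y"
    using s by (subst lborel_integral_real_affine[of s _ "r * y"])
      (simp_all add: tr normal_op_def gauss_mean_def s_def[symmetric])
qed

text \<open>Since \<open>exp (a |x|) \<le> exp (a x) + exp (- a x)\<close>, completing the square
  bounds the integrand by multiples of two shifted normal densities.\<close>

lemma f_N_exp_moment_1: "integrable lborel (\<lambda>x. exp (a * \<bar>x\<bar>) * f_N 1 x)"
proof (rule Bochner_Integration.integrable_bound)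
  have e: "exp (b * x) * std_normal_density x = exp (b\<^sup>2 / 2) * normal_density b 1 x" for b x :: real
    by (simp add: normal_density_def flip: exp_add) (simp add: power2_eq_square field_simps)
  show "integrable lborel (\<lambda>x. exp (a\<^sup>2 / 2) * normal_density a 1 x + exp ((- a)\<^sup>2 / 2) * normal_density (- a) 1 x)"
    by simp
  show "AE x in lborel. norm (exp (a * \<bar>x\<bar>) * f_N 1 x) \<le>
      norm (exp (a\<^sup>2 / 2) * normal_density a 1 x + exp ((- a)\<^sup>2 / 2) * normal_density (- a) 1 x)"
  proof (rule AE_I2)
    fix x :: real
    have "exp (a * \<bar>x\<bar>) \<le> exp (a * x) + exp (- a * x)"
      by (cases "0 \<le> x") (auto simp: abs_if)
    then have "exp (a * \<bar>x\<bar>) * std_normal_density x \<le> (exp (a * x) + exp (- a * x)) * std_normal_density x"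
      by (rule mult_right_mono) simp
    then show "norm (exp (a * \<bar>x\<bar>) * f_N 1 x) \<le>
        norm (exp (a\<^sup>2 / 2) * normal_density a 1 x + exp ((- a)\<^sup>2 / 2) * normal_density (- a) 1 x)"
      unfolding e[symmetric] f_N_1 distrib_right by (simp add: abs_mult)
  qed
qed (simp add: f_N_1)

lemma f_N_measurable:
  assumes "- 1 < q" "q \<le> 1"
  shows "f_N q \<in> borel_measurable borel"
  using assms f_N_measurable_lt_1[of q] by (cases "q = 1") (auto simp: f_N_1[abs_def])

lemma f_N_nonneg:
  assumes "- 1 < q" "q \<le> 1"
  shows "0 \<le> f_N q x"
  using assms f_N_pos_iff_lt_1(2)[of q x] by (cases "q = 1") (auto simp: f_N_1)

lemma f_N_1_pos: "0 < f_N 1 x"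
  by (simp add: f_N_1 normal_density_pos)

text \<open>At \<open>q = 1\<close> the scaled recurrence degenerates, as both
  \<open>sqrt (1 - q)\<close> and \<open>1 - q^n\<close> become 0; hence the separate
  choice.\<close>

definition qherm_poly :: "real \<Rightarrow> nat \<Rightarrow> real poly" where
  "qherm_poly q = (if q = 1 then hermite else three_term_poly (sqrt (1 - q)) (\<lambda>n. 1 - q ^ n))"

lemma reversible_kernel_qkernel:
  assumes q: "- 1 < q" "q \<le> 1" and r: "r \<noteq> 0" "\<bar>r\<bar> < 1"
  shows "reversible_kernel (f_N q) (qkernel q r) r (qherm_poly q)"
proof (cases "q = 1")
  case True
  have k: "qkernel 1 r y x = normal_density (r * y) (sqrt (1 - r\<^sup>2)) x" for y x
    by (simp add: qkernel_def f_N_1_pos f_CN_1[OF r(2)])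
  have r2: "0 < 1 - r\<^sup>2" using r by (simp add: abs_square_less_1)
  show ?thesis unfolding True
  proof
    show "f_N 1 \<in> borel_measurable borel" by (rule f_N_measurable) auto
    show "0 \<le> f_N 1 x" for x using f_N_1_pos[of x] by simp
    show "integrable lborel (\<lambda>x. exp (a * \<bar>x\<bar>) * f_N 1 x)" for a by (rule f_N_exp_moment_1)
    show "(\<lambda>(y, x). qkernel 1 r y x) \<in> borel_measurable (borel \<Otimes>\<^sub>M borel)"
      unfolding k normal_density_def by measurable
    show "0 \<le> qkernel 1 r y x" for y x by (simp add: k)
    show "f_N 1 y * qkernel 1 r y x = f_N 1 x * qkernel 1 r x y" for y x
    proof -
      have "- y\<^sup>2 / 2 + - (x - r * y)\<^sup>2 / (2 * (1 - r\<^sup>2)) = - x\<^sup>2 / 2 + - (y - r * x)\<^sup>2 / (2 * (1 - r\<^sup>2))"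
        using r2 by (simp add: field_simps) algebra
      then show ?thesis
        using r2 by (simp add: k f_N_1 normal_density_def flip: exp_add)
    qed
    show "degree (qherm_poly 1 n) = n" for n by (simp add: qherm_poly_def degree_three_term_poly)
    show "qherm_poly 1 0 = 1" by (simp add: qherm_poly_def)
    show "integrable lborel (\<lambda>x. qkernel 1 r y x * poly (qherm_poly 1 n) x)" for y n
      using f_CN_eigen_1(1)[OF r(2), of y "hermite n"] by (simp add: qkernel_def f_N_1_pos qherm_poly_def)
    show "(LBINT x. qkernel 1 r y x * poly (qherm_poly 1 n) x) = r ^ n * poly (qherm_poly 1 n) y" for y n
      using f_CN_eigen_1(2)[OF r(2), of y "hermite n"] normal_op_hermite[OF r(2), of n y]
      by (simp add: qkernel_def f_N_1_pos qherm_poly_def)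
  qed (use r in auto)
next
  case False
  with q have q1: "\<bar>q\<bar> < 1" by auto
  have h: "poly (qherm_poly q n) x = qherm q (sqrt (1 - q) * x) n" for n x
    using False by (simp add: qherm_poly_def poly_orec_qherm)
  show ?thesis
  proof
    show "f_N q \<in> borel_measurable borel" by (rule f_N_measurable[OF q])
    show "0 \<le> f_N q x" for x by (rule f_N_nonneg[OF q])
    show "integrable lborel (\<lambda>x. exp (a * \<bar>x\<bar>) * f_N q x)" for a by (rule f_N_exp_moment_lt_1[OF q1])
    show "(\<lambda>(y, x). qkernel q r y x) \<in> borel_measurable (borel \<Otimes>\<^sub>M borel)"
      by (rule qkernel_measurable_lt_1[OF q1 r(2)])
    show "0 \<le> qkernel q r y x" for y x by (rule qkernel_nonneg_lt_1[OF q1 r(2)])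
    show "f_N q y * qkernel q r y x = f_N q x * qkernel q r x y" for y x
      by (rule qkernel_reversible_lt_1[OF q1 r(2)])
    show "degree (qherm_poly q n) = n" for n using False q1 by (simp add: qherm_poly_def degree_three_term_poly)
    show "qherm_poly q 0 = 1" by (simp add: qherm_poly_def)
    fix y n assume y: "0 < f_N q y"
    then have Y: "\<bar>sqrt (1 - q) * y\<bar> \<le> 2" using f_N_pos_iff_lt_1(1)[OF q1, of y] by simp
    show "integrable lborel (\<lambda>x. qkernel q r y x * poly (qherm_poly q n) x)"
      using f_CN_eigen_lt_1(1)[OF q1 r(2) Y, of n] y by (simp add: qkernel_def h)
    show "(LBINT x. qkernel q r y x * poly (qherm_poly q n) x) = r ^ n * poly (qherm_poly q n) y"
      using f_CN_eigen_lt_1(2)[OF q1 r(2) Y, of n] y by (simp add: qkernel_def h)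
  qed (use r in auto)
qed

section \<open>Reversible Markov chains\<close>

text \<open>All kernels share the weight \<open>w\<close>, which makes the chain stationary, and the
  polynomials \<open>h\<close>. With \<open>K_zero\<close> and reversibility the path density
  vanishes once a coordinate leaves the support.\<close>

locale reversible_chain = prob_space M
  for M :: "'a measure" +
  fixes d :: nat and X :: "nat \<Rightarrow> 'a \<Rightarrow> real" and w :: "real \<Rightarrow> real"
    and K :: "nat \<Rightarrow> real \<Rightarrow> real \<Rightarrow> real" and \<rho> :: "nat \<Rightarrow> real" and h :: "nat \<Rightarrow> real poly"
  assumes kernel: "1 \<le> s \<Longrightarrow> s < d \<Longrightarrow> reversible_kernel w (K s) (\<rho> s) h"
    and K_zero: "\<not> 0 < w y \<Longrightarrow> K s y x = 0"
    and d_ge_2: "2 \<le> d"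
    and density: "distributed M (\<Pi>\<^sub>M k\<in>{1..d}. lborel) (\<lambda>\<omega>. \<lambda>k\<in>{1..d}. X k \<omega>)
      (\<lambda>x. ennreal (w (x 1) * (\<Prod>i\<in>{1..<d}. K i (x i) (x (i + 1)))))"
begin

lemma kernel_1: "reversible_kernel w (K 1) (\<rho> 1) h"
  using kernel[of 1] d_ge_2 by simp

lemma w_measurable_chain [measurable]: "w \<in> borel_measurable borel"
  using reversible_kernel.w_measurable[OF kernel_1] .

lemma w_nonneg_chain: "0 \<le> w x"
  using reversible_kernel.w_nonneg[OF kernel_1] .

lemma K_zero_right: "1 \<le> s \<Longrightarrow> s < d \<Longrightarrow> \<not> 0 < w x \<Longrightarrow> K s y x = 0"
  using reversible_kernel.reversible[OF kernel, of s y x] K_zero[of y s x] K_zero[of x s y] w_nonneg_chain[of x]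
  by (cases "0 < w y") auto

lemma K_measurable [measurable (raw)]:
  assumes "1 \<le> s" "s < d" "f \<in> borel_measurable N" "g \<in> borel_measurable N"
  shows "(\<lambda>z. K s (f z) (g z)) \<in> borel_measurable N"
  using reversible_kernel.k_measurable_compose[OF kernel[OF assms(1,2)] assms(3,4)] .

section \<open>Marginals of initial path segments and the Markov property\<close>

abbreviation lborel_upto :: "nat \<Rightarrow> (nat \<Rightarrow> real) measure" where
  "lborel_upto t \<equiv> \<Pi>\<^sub>M k\<in>{1..t}. lborel"

abbreviation path :: "nat \<Rightarrow> 'a \<Rightarrow> nat \<Rightarrow> real" where
  "path t \<omega> \<equiv> \<lambda>k\<in>{1..t}. X k \<omega>"

lemma restrict_upto: "(\<lambda>x. restrict x {1..t}) \<in> measurable (lborel_upto (Suc t)) (lborel_upto t)"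
  by (rule measurable_restrict_subset) auto

lemma restrict_path: "restrict (path (Suc t) \<omega>) {1..t} = path t \<omega>"
  by (auto simp: restrict_def fun_eq_iff)

definition chain_density :: "nat \<Rightarrow> (nat \<Rightarrow> real) \<Rightarrow> ennreal" where
  "chain_density t x = ennreal (w (x 1) * (\<Prod>i\<in>{1..<t}. K i (x i) (x (i + 1))))"

lemma chain_density_measurable:
  assumes "1 \<le> t" "t \<le> d"
  shows "chain_density t \<in> borel_measurable (lborel_upto t)"
proof -
  have "(\<lambda>x. K i (x i) (x (i + 1))) \<in> borel_measurable (lborel_upto t)" if "i \<in> {1..<t}" for i
    using that assms by (intro K_measurable) auto
  then have "(\<lambda>x. \<Prod>i\<in>{1..<t}. K i (x i) (x (i + 1))) \<in> borel_measurable (lborel_upto t)"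
    by (rule borel_measurable_prod)
  moreover have "(\<lambda>x. w (x 1)) \<in> borel_measurable (lborel_upto t)"
    using measurable_compose[OF measurable_component_singleton[of 1 "{1..t}" "\<lambda>_. lborel"], of w borel] assms
    by simp
  ultimately show ?thesis
    unfolding chain_density_def[abs_def] by measurable
qed

lemma chain_density_Suc:
  assumes "1 \<le> t" "t < d"
  shows "chain_density (Suc t) (x(Suc t := y)) = chain_density t x * ennreal (K t (x t) y)"
proof -
  have e: "(\<Prod>i\<in>{1..<Suc t}. K i ((x(Suc t := y)) i) ((x(Suc t := y)) (i + 1))) =
      (\<Prod>i\<in>{1..<t}. K i (x i) (x (i + 1))) * K t (x t) y"
    using assms(1) by (simp add: atLeastLessThanSuc mult.commute)
  have nn: "0 \<le> K i y z" if "1 \<le> i" "i < d" for i y z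
    using reversible_kernel.k_nonneg[OF kernel[OF that]] .
  have "0 \<le> w (x 1) * (\<Prod>i\<in>{1..<t}. K i (x i) (x (i + 1)))"
    using assms nn by (intro mult_nonneg_nonneg prod_nonneg w_nonneg_chain) auto
  then show ?thesis
    unfolding chain_density_def e using assms nn by (simp add: ennreal_mult' mult.assoc[symmetric])
qed

text \<open>Where \<open>w (x t) = 0\<close> the next kernel has mass 0 instead of 1. Integrating it
  out is still correct, because the path density is 0 there.\<close>

lemma chain_density_zero:
  assumes "1 \<le> t" "t \<le> d" "\<not> 0 < w (x t)"
  shows "chain_density t x = 0"
proof (cases "t = 1")
  case True
  then show ?thesis using assms(3) w_nonneg_chain[of "x 1"] by (simp add: chain_density_def)
next
  case False
  then have "K (t - 1) (x (t - 1)) (x (t - 1 + 1)) = 0"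
    using assms by (intro K_zero_right) auto
  then have "(\<Prod>i\<in>{1..<t}. K i (x i) (x (i + 1))) = 0"
    using False assms(1) by (intro prod_zero) (auto intro!: bexI[of _ "t - 1"])
  then show ?thesis by (simp only: chain_density_def mult_zero_right ennreal_0)
qed

lemma K_nn_integral:
  assumes "1 \<le> s" "s < d" "0 < w y"
  shows "(\<integral>\<^sup>+x. ennreal (K s y x) \<partial>lborel) = 1"
  using reversible_kernel.k_integrable[OF kernel[OF assms(1,2)] assms(3)]
    reversible_kernel.k_integral[OF kernel[OF assms(1,2)] assms(3)]
    reversible_kernel.k_nonneg[OF kernel[OF assms(1,2)]]
  by (subst nn_integral_eq_integral) auto

lemma nn_integral_last:
  assumes t: "1 \<le> t" "t < d" and F: "F \<in> borel_measurable (lborel_upto t)"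
    and f [measurable]: "f \<in> borel_measurable borel"
  shows "(\<integral>\<^sup>+x. chain_density (Suc t) x * (F (restrict x {1..t}) * f (x (Suc t))) \<partial>(lborel_upto (Suc t))) =
    (\<integral>\<^sup>+x. chain_density t x * (F x * kernel_op (K t) f (x t)) \<partial>(lborel_upto t))"
proof -
  interpret product_sigma_finite "\<lambda>k :: nat. lborel :: real measure" ..
  have ins: "{1..Suc t} = insert (Suc t) {1..t}" using t by auto
  have m1: "(\<lambda>x. F (restrict x {1..t})) \<in> borel_measurable (lborel_upto (Suc t))"
    by (rule measurable_compose[OF restrict_upto F])
  have m2: "(\<lambda>x. f (x (Suc t))) \<in> borel_measurable (lborel_upto (Suc t))"
    by measurable
  have meas: "(\<lambda>x. chain_density (Suc t) x * (F (restrict x {1..t}) * f (x (Suc t))))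
      \<in> borel_measurable (\<Pi>\<^sub>M k\<in>insert (Suc t) {1..t}. lborel)"
    unfolding ins[symmetric] using t by (intro borel_measurable_times_ennreal chain_density_measurable m1 m2) auto
  have "(\<integral>\<^sup>+x. chain_density (Suc t) x * (F (restrict x {1..t}) * f (x (Suc t))) \<partial>(lborel_upto (Suc t))) =
    (\<integral>\<^sup>+x. (\<integral>\<^sup>+y. chain_density (Suc t) (x(Suc t := y)) * (F (restrict (x(Suc t := y)) {1..t}) * f ((x(Suc t := y)) (Suc t)))
      \<partial>lborel) \<partial>(lborel_upto t))"
    unfolding ins by (rule product_nn_integral_insert[OF _ _ meas]) auto
  also have "\<dots> = (\<integral>\<^sup>+x. chain_density t x * (F x * kernel_op (K t) f (x t)) \<partial>(lborel_upto t))"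
  proof (rule nn_integral_cong)
    fix x assume "x \<in> space (lborel_upto t)"
    then have "restrict (x(Suc t := y)) {1..t} = x" for y
      by (auto simp: space_PiM PiE_def extensional_def restrict_def fun_eq_iff)
    then have "(\<integral>\<^sup>+y. chain_density (Suc t) (x(Suc t := y)) * (F (restrict (x(Suc t := y)) {1..t}) * f ((x(Suc t := y)) (Suc t))) \<partial>lborel) =
        (\<integral>\<^sup>+y. chain_density t x * F x * (f y * ennreal (K t (x t) y)) \<partial>lborel)"
      using t by (intro nn_integral_cong) (simp add: chain_density_Suc mult_ac)
    also have "\<dots> = chain_density t x * F x * kernel_op (K t) f (x t)"
      using t by (intro nn_integral_cmult) measurable
    finally show "(\<integral>\<^sup>+y. chain_density (Suc t) (x(Suc t := y)) * (F (restrict (x(Suc t := y)) {1..t}) * f ((x(Suc t := y)) (Suc t))) \<partial>lborel) =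
        chain_density t x * (F x * kernel_op (K t) f (x t))"
      by (simp add: mult.assoc)
  qed
  finally show ?thesis .
qed

lemma X_measurable:
  assumes "k \<in> {1..d}"
  shows "X k \<in> borel_measurable M"
proof -
  have "(\<lambda>\<omega>. (\<lambda>k\<in>{1..d}. X k \<omega>) k) \<in> borel_measurable M"
    using measurable_compose[OF distributed_measurable[OF density] measurable_component_singleton[OF assms]]
    by simp
  then show ?thesis using assms by simp
qed

lemma restrict_X_measurable:
  assumes "J \<subseteq> {1..d}"
  shows "(\<lambda>\<omega>. \<lambda>k\<in>J. X k \<omega>) \<in> measurable M (\<Pi>\<^sub>M k\<in>J. lborel)"
  using assms X_measurable by (intro measurable_restrict) auto

text \<open>Downward induction from \<open>d\<close>, where the law is given; each step integrates
  out the last coordinate.\<close>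

lemma nn_integral_marginal:
  assumes t: "1 \<le> t" "t \<le> d" and F: "F \<in> borel_measurable (lborel_upto t)"
  shows "(\<integral>\<^sup>+\<omega>. F (path t \<omega>) \<partial>M) = (\<integral>\<^sup>+x. chain_density t x * F x \<partial>(lborel_upto t))"
  using t(2,1) F
proof (induction t arbitrary: F rule: inc_induct)
  case base
  then show ?case
    using distributed_nn_integral[OF density base(2)] by (simp only: chain_density_def)
next
  case (step t)
  have "(\<integral>\<^sup>+\<omega>. F (path t \<omega>) \<partial>M) = (\<integral>\<^sup>+\<omega>. F (restrict (path (Suc t) \<omega>) {1..t}) \<partial>M)"
    unfolding restrict_path ..
  also have "\<dots> = (\<integral>\<^sup>+x. chain_density (Suc t) x * F (restrict x {1..t}) \<partial>(lborel_upto (Suc t)))"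
    by (rule step.IH[OF _ measurable_compose[OF restrict_upto step.prems(2)]]) simp
  also have "\<dots> = (\<integral>\<^sup>+x. chain_density t x * (F x * (\<integral>\<^sup>+y. ennreal (K t (x t) y) \<partial>lborel)) \<partial>(lborel_upto t))"
    using nn_integral_last[of t F "\<lambda>_. 1"] step by simp
  also have "\<dots> = (\<integral>\<^sup>+x. chain_density t x * F x \<partial>(lborel_upto t))"
  proof (rule nn_integral_cong)
    fix x
    show "chain_density t x * (F x * (\<integral>\<^sup>+y. ennreal (K t (x t) y) \<partial>lborel)) = chain_density t x * F x"
      using step K_nn_integral[of t "x t"] chain_density_zero[of t x] by (cases "0 < w (x t)") auto
  qed
  finally show ?case .
qed

text \<open>The Markov property for nonnegative functions: \<open>F\<close> may depend on the whole
  past, but the kernel sees only \<open>X t\<close>.\<close>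

lemma nn_integral_step:
  assumes t: "1 \<le> t" "t < d" and F: "F \<in> borel_measurable (lborel_upto t)"
    and f [measurable]: "f \<in> borel_measurable borel"
  shows "(\<integral>\<^sup>+\<omega>. F (path t \<omega>) * f (X (Suc t) \<omega>) \<partial>M) =
    (\<integral>\<^sup>+\<omega>. F (path t \<omega>) * kernel_op (K t) f (X t \<omega>) \<partial>M)"
proof -
  have m1: "(\<lambda>x. F (restrict x {1..t})) \<in> borel_measurable (lborel_upto (Suc t))"
    by (rule measurable_compose[OF restrict_upto F])
  have m2: "(\<lambda>x. F (restrict x {1..t}) * f (x (Suc t))) \<in> borel_measurable (lborel_upto (Suc t))"
    by (intro borel_measurable_times_ennreal m1) measurable
  have Tm: "kernel_op (K t) f \<in> borel_measurable borel"
    using t by measurable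
  have "(\<integral>\<^sup>+\<omega>. F (path t \<omega>) * f (X (Suc t) \<omega>) \<partial>M) =
      (\<integral>\<^sup>+x. chain_density (Suc t) x * (F (restrict x {1..t}) * f (x (Suc t))) \<partial>(lborel_upto (Suc t)))"
    using nn_integral_marginal[OF _ _ m2] t by (simp add: restrict_path)
  also have "\<dots> = (\<integral>\<^sup>+x. chain_density t x * (F x * kernel_op (K t) f (x t)) \<partial>(lborel_upto t))"
    by (rule nn_integral_last[OF t F f])
  also have "\<dots> = (\<integral>\<^sup>+\<omega>. F (path t \<omega>) *
      kernel_op (K t) f (path t \<omega> t) \<partial>M)"
  proof (rule nn_integral_marginal[symmetric])
    show "(\<lambda>x. F x * kernel_op (K t) f (x t)) \<in> borel_measurable (lborel_upto t)"
      using t by (intro borel_measurable_times_ennreal F measurable_compose[OF _ Tm]) measurable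
  qed (use t in auto)
  finally show ?thesis using t by simp
qed

text \<open>The law of \<open>X 1\<close> is read off from the density, and stationarity carries it
  along the chain.\<close>

lemma nn_integral_X:
  assumes "1 \<le> s" "s \<le> d" and f: "f \<in> borel_measurable borel"
  shows "(\<integral>\<^sup>+\<omega>. f (X s \<omega>) \<partial>M) = (\<integral>\<^sup>+x. f x * ennreal (w x) \<partial>lborel)"
  using assms
proof (induction s arbitrary: f rule: nat_induct_at_least)
  case base
  interpret product_sigma_finite "\<lambda>k :: nat. lborel :: real measure" ..
  note [measurable] = base(2)
  have m: "(\<lambda>x. f (x 1)) \<in> borel_measurable (\<Pi>\<^sub>M k\<in>{1..1::nat}. lborel)" by measurable
  have d1: "chain_density 1 x = ennreal (w (x 1))" for x
    by (simp add: chain_density_def)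
  have "(\<integral>\<^sup>+\<omega>. f (X 1 \<omega>) \<partial>M) = (\<integral>\<^sup>+x. chain_density 1 x * f (x 1) \<partial>(\<Pi>\<^sub>M k\<in>{1..1::nat}. lborel))"
    using nn_integral_marginal[OF _ _ m] d_ge_2 by simp
  also have "\<dots> = (\<integral>\<^sup>+x. ennreal (w (x 1)) * f (x 1) \<partial>(\<Pi>\<^sub>M k\<in>{1::nat}. lborel))"
    by (simp only: d1 atLeastAtMost_singleton)
  also have "\<dots> = (\<integral>\<^sup>+x. ennreal (w x) * f x \<partial>lborel)"
    by (rule product_nn_integral_singleton) measurable
  finally show ?case by (simp add: mult.commute)
next
  case (Suc s)
  note [measurable] = Suc.prems(2)
  have "(\<integral>\<^sup>+\<omega>. f (X (Suc s) \<omega>) \<partial>M) = (\<integral>\<^sup>+\<omega>. kernel_op (K s) f (X s \<omega>) \<partial>M)"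
    using nn_integral_step[of s "\<lambda>_. 1" f] Suc by simp
  also have "\<dots> = (\<integral>\<^sup>+z. kernel_op (K s) f z * ennreal (w z) \<partial>lborel)"
  proof (rule Suc.IH)
    have "1 \<le> s" "s < d" using Suc by auto
    note [measurable] = K_measurable[OF this]
    show "kernel_op (K s) f \<in> borel_measurable borel"
      by measurable
  qed (use Suc in auto)
  also have "\<dots> = (\<integral>\<^sup>+x. f x * ennreal (w x) \<partial>lborel)"
    using reversible_kernel.nn_stationary[OF kernel, of s f] Suc by (simp add: mult.commute)
  finally show ?case .
qed

lemma distributed_X:
  assumes "1 \<le> s" "s \<le> d"
  shows "distributed M lborel (X s) (\<lambda>x. ennreal (w x))"
proof -
  have [measurable]: "X s \<in> borel_measurable M" using X_measurable assms by simp
  have "distr M lborel (X s) = density lborel (\<lambda>x. ennreal (w x))"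
  proof (rule measure_eqI)
    fix A assume "A \<in> sets (distr M lborel (X s))"
    then have [measurable]: "A \<in> sets borel" by simp
    have "emeasure (distr M lborel (X s)) A = (\<integral>\<^sup>+x. indicator A x \<partial>distr M lborel (X s))"
      by simp
    also have "\<dots> = (\<integral>\<^sup>+\<omega>. indicator A (X s \<omega>) \<partial>M)"
      by (rule nn_integral_distr) auto
    also have "\<dots> = (\<integral>\<^sup>+x. indicator A x * ennreal (w x) \<partial>lborel)"
      by (rule nn_integral_X[OF assms]) simp
    finally show "emeasure (distr M lborel (X s)) A = emeasure (density lborel (\<lambda>x. ennreal (w x))) A"
      by (simp add: emeasure_density mult.commute)
  qed simp
  then show ?thesis by (simp add: distributed_def)
qed

lemma AE_X:
  assumes "1 \<le> s" "s \<le> d" "AE x in lborel. 0 < w x \<longrightarrow> Q x"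
  shows "AE \<omega> in M. 0 < w (X s \<omega>) \<and> Q (X s \<omega>)"
proof -
  note D = distributed_X[OF assms(1,2)]
  have "AE x in density lborel (\<lambda>x. ennreal (w x)). 0 < w x \<and> Q x"
    using assms(3) by (subst AE_density) (auto elim: eventually_mono)
  then have "AE x in distr M lborel (X s). 0 < w x \<and> Q x"
    unfolding distributed_distr_eq_density[OF D] .
  then show ?thesis
    by (rule AE_distrD[OF distributed_measurable[OF D]])
qed

lemma AE_X_iff:
  assumes "1 \<le> s" "s \<le> d" and Q: "Measurable.pred borel Q"
  shows "(AE \<omega> in M. Q (X s \<omega>)) \<longleftrightarrow> (AE x in lborel. 0 < w x \<longrightarrow> Q x)"
  using distributed_AE2[OF distributed_X[OF assms(1,2)], of Q] Q by simp

section \<open>Conditional expectations of square-integrable functions\<close>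

abbreviation L2 :: "(real \<Rightarrow> real) \<Rightarrow> bool" where
  "L2 \<equiv> reversible_kernel.L2 w"

abbreviation ip :: "(real \<Rightarrow> real) \<Rightarrow> (real \<Rightarrow> real) \<Rightarrow> real" where
  "ip \<equiv> reversible_kernel.ip w"

abbreviation trans :: "nat \<Rightarrow> (real \<Rightarrow> real) \<Rightarrow> real \<Rightarrow> real" where
  "trans s \<equiv> reversible_kernel.P (K s)"

lemma integrable_L2_X:
  assumes "1 \<le> s" "s \<le> d" and g: "L2 g"
  shows "integrable M (\<lambda>\<omega>. g (X s \<omega>))"
proof -
  have m: "g \<in> borel_measurable borel"
    by (rule reversible_kernel.L2_measurable[OF kernel_1 g])
  have one: "L2 (poly 1)" by (rule reversible_kernel.L2_poly[OF kernel_1])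
  have "integrable lborel (\<lambda>x. w x *\<^sub>R g x)"
    using reversible_kernel.L2_product_integrable[OF kernel_1 g one] by (simp add: mult.commute)
  then show ?thesis
    using distributed_integrable[OF distributed_X[OF assms(1,2)], of g] m w_nonneg_chain by simp
qed

lemma ip_expectation:
  assumes "1 \<le> s" "s \<le> d" and g: "L2 f" "L2 g"
  shows "integrable M (\<lambda>\<omega>. f (X s \<omega>) * g (X s \<omega>))"
    and "(\<integral>\<omega>. f (X s \<omega>) * g (X s \<omega>) \<partial>M) = ip f g"
proof -
  have [measurable]: "f \<in> borel_measurable borel" "g \<in> borel_measurable borel"
    using g by (auto intro: reversible_kernel.L2_measurable[OF kernel_1])
  note D = distributed_X[OF assms(1,2)]
  have m: "(\<lambda>x. f x * g x) \<in> borel_measurable lborel" by measurable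
  have i: "integrable lborel (\<lambda>x. w x * (f x * g x))"
    using reversible_kernel.L2_product_integrable[OF kernel_1 g] by (simp add: mult_ac)
  show "integrable M (\<lambda>\<omega>. f (X s \<omega>) * g (X s \<omega>))"
    using distributed_integrable[OF D m] i w_nonneg_chain by simp
  show "(\<integral>\<omega>. f (X s \<omega>) * g (X s \<omega>) \<partial>M) = ip f g"
    using distributed_integral[OF D m] w_nonneg_chain
    by (simp add: reversible_kernel.ip_def[OF kernel_1] mult_ac)
qed

text \<open>The Markov property is available for \<open>ennreal\<close> functions, whereas
  \<open>trans\<close> is a Bochner integral; splitting \<open>g\<close> into positive and negative
  parts connects the two.\<close>

lemma trans_eq_nn_integral:
  assumes "1 \<le> s" "s < d" and g: "L2 g" and y: "integrable lborel (\<lambda>x. g x * K s y x)"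
  shows "trans s g y = enn2real (kernel_op (K s) (\<lambda>x. ennreal (g x)) y)
      - enn2real (kernel_op (K s) (\<lambda>x. ennreal (- g x)) y)"
    and "kernel_op (K s) (\<lambda>x. ennreal (g x)) y < \<infinity>"
    and "kernel_op (K s) (\<lambda>x. ennreal (- g x)) y < \<infinity>"
proof -
  have nn: "0 \<le> K s y x" for x
    by (rule reversible_kernel.k_nonneg[OF kernel[OF assms(1,2)]])
  have e: "ennreal (g x) * ennreal (K s y x) = ennreal (g x * K s y x)"
    "ennreal (- g x) * ennreal (K s y x) = ennreal (- (g x * K s y x))" for x
    using nn by (simp_all add: ennreal_mult'' flip: ennreal_mult'')
  show "trans s g y = enn2real (kernel_op (K s) (\<lambda>x. ennreal (g x)) y)
      - enn2real (kernel_op (K s) (\<lambda>x. ennreal (- g x)) y)"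
    unfolding reversible_kernel.P_def[OF kernel[OF assms(1,2)]] e by (rule real_lebesgue_integral_def[OF y])
  show "kernel_op (K s) (\<lambda>x. ennreal (g x)) y < \<infinity>"
    "kernel_op (K s) (\<lambda>x. ennreal (- g x)) y < \<infinity>"
    unfolding e using y by (auto simp: real_integrable_def less_top)
qed

text \<open>The Markov property for signed \<open>g\<close> on events of the past. Both parts of
  \<open>g\<close> are run through the nonnegative version with a sign \<open>\<sigma>\<close>;
  their kernel images are finite only almost surely.\<close>

lemma integral_step:
  assumes s: "1 \<le> s" "s < d" and g: "L2 g" and B: "B \<in> sets (lborel_upto s)"
  defines "A \<equiv> \<lambda>\<omega>. indicator B (path s \<omega>) :: real"
  shows "(\<integral>\<omega>. A \<omega> * g (X (Suc s) \<omega>) \<partial>M) = (\<integral>\<omega>. A \<omega> * trans s g (X s \<omega>) \<partial>M)"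
proof -
  let ?T = "\<lambda>\<sigma>. kernel_op (K s) (\<lambda>x. ennreal (\<sigma> * g x))"
  have [measurable]: "g \<in> borel_measurable borel"
    by (rule reversible_kernel.L2_measurable[OF kernel_1 g])
  have [measurable]: "X s \<in> borel_measurable M" "X (Suc s) \<in> borel_measurable M"
    using s by (auto intro: X_measurable)
  have Tm [measurable]: "?T \<sigma> \<in> borel_measurable borel" for \<sigma>
    using s by measurable
  have Am [measurable]: "A \<in> borel_measurable M"
    unfolding A_def using s
    by (intro measurable_compose[OF restrict_X_measurable borel_measurable_indicator[OF B]]) auto
  have A01: "0 \<le> A \<omega>" "\<bar>A \<omega>\<bar> \<le> 1" for \<omega>
    by (auto simp: A_def indicator_def)
  have Aint: "integrable M (\<lambda>\<omega>. A \<omega> * f \<omega>)" if "integrable M f" for f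
  proof (rule Bochner_Integration.integrable_bound[OF that])
    have "\<bar>A \<omega>\<bar> * \<bar>f \<omega>\<bar> \<le> 1 * \<bar>f \<omega>\<bar>" for \<omega>
      by (intro mult_right_mono A01(2)) simp
    then show "AE \<omega> in M. norm (A \<omega> * f \<omega>) \<le> norm (f \<omega>)"
      by (simp add: abs_mult)
  qed (use that in measurable)
  have step: "(\<integral>\<^sup>+\<omega>. ennreal (A \<omega>) * ennreal (\<sigma> * g (X (Suc s) \<omega>)) \<partial>M) =
      (\<integral>\<^sup>+\<omega>. ennreal (A \<omega>) * ?T \<sigma> (X s \<omega>) \<partial>M)" for \<sigma>
  proof -
    have "ennreal (A \<omega>) = indicator B (path s \<omega>)" for \<omega>
      by (simp add: A_def indicator_def)
    then show ?thesis
      using nn_integral_step[OF s borel_measurable_indicator[OF B], of "\<lambda>x. ennreal (\<sigma> * g x)"] by simp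
  qed
  have gX: "integrable M (\<lambda>\<omega>. A \<omega> * g (X (Suc s) \<omega>))"
    using s by (intro Aint integrable_L2_X g) auto
  have sgn: "ennreal (A \<omega> * z) = ennreal (A \<omega>) * ennreal (1 * z)"
    "ennreal (- (A \<omega> * z)) = ennreal (A \<omega>) * ennreal (- 1 * z)" for \<omega> z
    using ennreal_mult'[OF A01(1), of \<omega> "1 * z"] ennreal_mult'[OF A01(1), of \<omega> "- 1 * z"] by simp_all
  have eq1: "(\<integral>\<omega>. A \<omega> * g (X (Suc s) \<omega>) \<partial>M) =
      enn2real (\<integral>\<^sup>+\<omega>. ennreal (A \<omega>) * ?T 1 (X s \<omega>) \<partial>M) - enn2real (\<integral>\<^sup>+\<omega>. ennreal (A \<omega>) * ?T (- 1) (X s \<omega>) \<partial>M)"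
    unfolding real_lebesgue_integral_def[OF gX] sgn step ..
  have fin: "(\<integral>\<^sup>+\<omega>. ennreal (A \<omega>) * ?T \<sigma> (X s \<omega>) \<partial>M) < \<infinity>" if "\<sigma> = 1 \<or> \<sigma> = - 1" for \<sigma>
    unfolding step[symmetric] using gX that unfolding real_integrable_def sgn by (auto simp: less_top)
  have AEfin: "AE \<omega> in M. 0 < w (X s \<omega>) \<and> integrable lborel (\<lambda>x. g x * K s (X s \<omega>) x)"
    using s by (intro AE_X reversible_kernel.AE_mult_k_integrable[OF kernel g]) auto
  have real: "integrable M (\<lambda>\<omega>. A \<omega> * enn2real (?T \<sigma> (X s \<omega>)))"
    "(\<integral>\<omega>. A \<omega> * enn2real (?T \<sigma> (X s \<omega>)) \<partial>M) = enn2real (\<integral>\<^sup>+\<omega>. ennreal (A \<omega>) * ?T \<sigma> (X s \<omega>) \<partial>M)"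
    if \<sigma>: "\<sigma> = 1 \<or> \<sigma> = - 1" for \<sigma>
  proof -
    have eq: "(\<integral>\<^sup>+\<omega>. ennreal (A \<omega> * enn2real (?T \<sigma> (X s \<omega>))) \<partial>M) = (\<integral>\<^sup>+\<omega>. ennreal (A \<omega>) * ?T \<sigma> (X s \<omega>) \<partial>M)"
    proof (rule nn_integral_cong_AE, use AEfin in eventually_elim)
      case (elim \<omega>)
      then have "?T \<sigma> (X s \<omega>) < \<infinity>"
        using trans_eq_nn_integral(2,3)[OF s g, of "X s \<omega>"] \<sigma> by auto
      then show ?case
        using A01 by (simp add: ennreal_mult')
    qed
    show "integrable M (\<lambda>\<omega>. A \<omega> * enn2real (?T \<sigma> (X s \<omega>)))"
      using fin[OF \<sigma>] A01 by (intro integrableI_nonneg) (auto simp: eq)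
    show "(\<integral>\<omega>. A \<omega> * enn2real (?T \<sigma> (X s \<omega>)) \<partial>M) = enn2real (\<integral>\<^sup>+\<omega>. ennreal (A \<omega>) * ?T \<sigma> (X s \<omega>) \<partial>M)"
      using A01 by (subst integral_eq_nn_integral) (auto simp: eq)
  qed
  have "enn2real (\<integral>\<^sup>+\<omega>. ennreal (A \<omega>) * ?T 1 (X s \<omega>) \<partial>M) - enn2real (\<integral>\<^sup>+\<omega>. ennreal (A \<omega>) * ?T (- 1) (X s \<omega>) \<partial>M) =
      (\<integral>\<omega>. A \<omega> * enn2real (?T 1 (X s \<omega>)) - A \<omega> * enn2real (?T (- 1) (X s \<omega>)) \<partial>M)"
    using real[of 1] real[of "- 1"] by (subst Bochner_Integration.integral_diff) auto
  also have "\<dots> = (\<integral>\<omega>. A \<omega> * trans s g (X s \<omega>) \<partial>M)"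
  proof (rule integral_cong_AE)
    show "AE \<omega> in M. A \<omega> * enn2real (?T 1 (X s \<omega>)) - A \<omega> * enn2real (?T (- 1) (X s \<omega>)) = A \<omega> * trans s g (X s \<omega>)"
      using AEfin
    proof eventually_elim
      case (elim \<omega>)
      then show ?case
        using trans_eq_nn_integral(1)[OF s g, of "X s \<omega>"] by (simp add: right_diff_distrib)
    qed
    have [measurable]: "trans s g \<in> borel_measurable borel"
      by (rule reversible_kernel.P_measurable[OF kernel[OF s]]) measurable
    show "(\<lambda>\<omega>. A \<omega> * trans s g (X s \<omega>)) \<in> borel_measurable M" by measurable
  qed measurable
  finally show ?thesis unfolding eq1 .
qed

text \<open>Kernels \<open>s\<close>, ..., \<open>s + n - 1\<close> are applied with the latest one
  innermost, so that \<open>iter s n g (X s)\<close> is the conditional expectation of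
  \<open>g (X (s + n))\<close>.\<close>

fun iter :: "nat \<Rightarrow> nat \<Rightarrow> (real \<Rightarrow> real) \<Rightarrow> real \<Rightarrow> real" where
  "iter s 0 g = g"
| "iter s (Suc n) g = trans s (iter (Suc s) n g)"

lemma L2_iter: "1 \<le> s \<Longrightarrow> s + n \<le> d \<Longrightarrow> L2 g \<Longrightarrow> L2 (iter s n g)"
  by (induction n arbitrary: s) (auto intro!: reversible_kernel.L2_P[OF kernel])

lemma ip_iter_1:
  "1 \<le> s \<Longrightarrow> s + n \<le> d \<Longrightarrow> L2 g \<Longrightarrow> ip (iter s n g) (\<lambda>_. 1) = ip g (\<lambda>_. 1)"
proof (induction n arbitrary: s)
  case (Suc n)
  then show ?case
    using reversible_kernel.ip_P_1[OF kernel, of s "iter (Suc s) n g"] L2_iter[of "Suc s" n g] by simp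
qed simp

text \<open>Every operator preserves mean 0, so the contraction applies at each stage and
  contributes its own factor \<open>(\<rho> k)^2\<close>.\<close>

lemma ip_iter_le:
  "1 \<le> s \<Longrightarrow> s + n \<le> d \<Longrightarrow> L2 g \<Longrightarrow> ip g (\<lambda>_. 1) = 0 \<Longrightarrow>
    ip (iter s n g) (iter s n g) \<le> (\<Prod>k\<in>{s..<s + n}. \<rho> k)\<^sup>2 * ip g g"
proof (induction n arbitrary: s)
  case (Suc n)
  let ?g = "iter (Suc s) n g"
  have "ip (iter s (Suc n) g) (iter s (Suc n) g) \<le> (\<rho> s)\<^sup>2 * ip ?g ?g"
    using reversible_kernel.P_contraction[OF kernel, of s ?g] L2_iter[of "Suc s" n g]
      ip_iter_1[of "Suc s" n g] Suc.prems by simp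
  also have "\<dots> \<le> (\<rho> s)\<^sup>2 * ((\<Prod>k\<in>{Suc s..<Suc s + n}. \<rho> k)\<^sup>2 * ip g g)"
    using Suc by (intro mult_left_mono Suc.IH) auto
  also have "\<dots> = (\<Prod>k\<in>{s..<s + Suc n}. \<rho> k)\<^sup>2 * ip g g"
    by (simp add: prod.atLeast_Suc_lessThan power_mult_distrib)
  finally show ?case .
qed simp

text \<open>The operators are undone from the outside in, the degree bound \<open>N\<close> being
  kept throughout.\<close>

lemma iter_poly:
  "1 \<le> s \<Longrightarrow> s + n \<le> d \<Longrightarrow> L2 g \<Longrightarrow> degree p \<le> N \<Longrightarrow>
    AE y in lborel. 0 < w y \<longrightarrow> iter s n g y = poly p y \<Longrightarrow>
    \<exists>p'. degree p' \<le> N \<and> (AE x in lborel. 0 < w x \<longrightarrow> g x = poly p' x)"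
proof (induction n arbitrary: s p)
  case 0
  then show ?case by auto
next
  case (Suc n)
  have k: "1 \<le> s" "s < d" and L: "L2 (iter (Suc s) n g)"
    using Suc.prems L2_iter[of "Suc s" n g] by auto
  obtain p' where "degree p' \<le> N" "AE x in lborel. 0 < w x \<longrightarrow> iter (Suc s) n g x = poly p' x"
    using reversible_kernel.P_poly_imp_poly[OF kernel[OF k] L, of p N] Suc.prems by auto
  then show ?case using Suc.IH[of "Suc s" p'] Suc.prems by auto
qed

lemma integral_iter:
  "1 \<le> s \<Longrightarrow> s + n \<le> d \<Longrightarrow> L2 g \<Longrightarrow> B \<in> sets (lborel_upto s) \<Longrightarrow>
    (\<integral>\<omega>. indicator B (path s \<omega>) * g (X (s + n) \<omega>) \<partial>M) =
    (\<integral>\<omega>. indicator B (path s \<omega>) * iter s n g (X s \<omega>) \<partial>M)"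
proof (induction n arbitrary: s B)
  case (Suc n)
  let ?r = "\<lambda>x :: nat \<Rightarrow> real. restrict x {1..s}"
  \<comment> \<open>An event of the path up to \<open>s\<close> is read as one of the path up to
    \<open>Suc s\<close>, where the induction hypothesis starts.\<close>
  define B' where "B' = ?r -` B \<inter> space (lborel_upto (Suc s))"
  have B': "B' \<in> sets (lborel_upto (Suc s))"
    unfolding B'_def by (rule measurable_sets[OF restrict_upto Suc.prems(4)])
  have ind: "indicator B' (path (Suc s) \<omega>) = (indicator B (path s \<omega>) :: real)" for \<omega>
    using restrict_path[where t = s and \<omega> = \<omega>] by (auto simp: B'_def indicator_def space_PiM)
  have "(\<integral>\<omega>. indicator B (path s \<omega>) * g (X (Suc s + n) \<omega>) \<partial>M) =
      (\<integral>\<omega>. indicator B (path s \<omega>) * iter (Suc s) n g (X (Suc s) \<omega>) \<partial>M)"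
    using Suc.IH[OF _ _ _ B'] Suc.prems(2,3) unfolding ind by simp
  also have "\<dots> = (\<integral>\<omega>. indicator B (path s \<omega>) * trans s (iter (Suc s) n g) (X s \<omega>) \<partial>M)"
    using Suc.prems L2_iter[of "Suc s" n g] by (intro integral_step) auto
  finally show ?case by (simp only: iter.simps add_Suc add_Suc_right)
qed simp

text \<open>The test events of the coordinates in \<open>J\<close> belong to the full past up to
  \<open>s\<close>, for which \<open>integral_iter\<close> is stated.\<close>

lemma sigma_rv_sets:
  assumes J: "J \<subseteq> {1..s}" and A: "A \<in> sets (sigma_rv M J X)"
  obtains B where "B \<in> sets (lborel_upto s)"
    "\<And>\<omega>. \<omega> \<in> space M \<Longrightarrow> \<omega> \<in> A \<longleftrightarrow> (path s \<omega>) \<in> B"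
proof -
  have "(\<lambda>\<omega>. \<lambda>k\<in>J. X k \<omega>) \<in> space M \<rightarrow> space (\<Pi>\<^sub>M k\<in>J. borel :: real measure)"
    by (auto simp: space_PiM)
  with A obtain C where C: "C \<in> sets (\<Pi>\<^sub>M k\<in>J. borel :: real measure)"
      "A = (\<lambda>\<omega>. \<lambda>k\<in>J. X k \<omega>) -` C \<inter> space M"
    unfolding sigma_rv_def by (auto simp: sets_vimage_algebra2)
  have "sets (\<Pi>\<^sub>M k\<in>J. borel) = sets (\<Pi>\<^sub>M k\<in>J. lborel :: real measure)"
    by (intro sets_PiM_cong) auto
  with C have C': "C \<in> sets (\<Pi>\<^sub>M k\<in>J. lborel :: real measure)" by simp
  have res: "(\<lambda>x. restrict x J) \<in> measurable (lborel_upto s) (\<Pi>\<^sub>M k\<in>J. lborel)"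
    by (rule measurable_restrict_subset[OF J])
  have r: "restrict (path s \<omega>) J = (\<lambda>k\<in>J. X k \<omega>)" for \<omega>
    using J by (auto simp: restrict_def fun_eq_iff)
  show thesis
  proof (rule that[OF measurable_sets[OF res C']])
    fix \<omega> assume "\<omega> \<in> space M"
    then show "\<omega> \<in> A \<longleftrightarrow> (path s \<omega>) \<in> (\<lambda>x. restrict x J) -` C \<inter> space (lborel_upto s)"
      using r[of \<omega>] by (auto simp: C space_PiM)
  qed
qed

text \<open>Conditioning on part of the past gives the same result as on all of it:
  \<open>s \<in> J\<close> makes the candidate measurable, and the averaging property holds on every
  event of the full past.\<close>

lemma real_cond_exp_iter:
  assumes s: "1 \<le> s" "s + n \<le> d" and J: "J \<subseteq> {1..s}" "s \<in> J" and g: "L2 g"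
  shows "AE \<omega> in M. real_cond_exp M (sigma_rv M J X) (\<lambda>\<omega>. g (X (s + n) \<omega>)) \<omega> = iter s n g (X s \<omega>)"
proof -
  let ?F = "sigma_rv M J X"
  have "(\<lambda>\<omega>. \<lambda>k\<in>J. X k \<omega>) \<in> measurable M (\<Pi>\<^sub>M k\<in>J. borel)"
    using J s X_measurable by (intro measurable_restrict) auto
  then have "subalgebra M ?F"
    unfolding subalgebra_def sigma_rv_def
    by (auto simp: sets_vimage_algebra2 space_PiM intro: measurable_sets)
  then interpret finite_measure_subalgebra M ?F
    by unfold_locales
  have pullL2: "L2 (iter s n g)" by (rule L2_iter[OF s g])
  have "X s \<in> borel_measurable ?F"
  proof -
    have "(\<lambda>\<omega>. \<lambda>k\<in>J. X k \<omega>) \<in> measurable ?F (\<Pi>\<^sub>M k\<in>J. borel)"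
      unfolding sigma_rv_def by (rule measurable_vimage_algebra1) (auto simp: space_PiM)
    from measurable_compose[OF this measurable_component_singleton[OF J(2)]] show ?thesis
      using J(2) by simp
  qed
  moreover have "iter s n g \<in> borel_measurable borel"
    by (rule reversible_kernel.L2_measurable[OF kernel_1 pullL2])
  ultimately have meas: "(\<lambda>\<omega>. iter s n g (X s \<omega>)) \<in> borel_measurable ?F"
    by (rule measurable_compose)
  show ?thesis
  proof (rule real_cond_exp_charact[OF _ _ _ meas])
    show "integrable M (\<lambda>\<omega>. g (X (s + n) \<omega>))" "integrable M (\<lambda>\<omega>. iter s n g (X s \<omega>))"
      using s g pullL2 by (auto intro: integrable_L2_X)
    fix A assume "A \<in> sets ?F"
    then obtain B where B: "B \<in> sets (lborel_upto s)"
      "\<And>\<omega>. \<omega> \<in> space M \<Longrightarrow> \<omega> \<in> A \<longleftrightarrow> (path s \<omega>) \<in> B"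
      using sigma_rv_sets[OF J(1)] by blast
    have ind: "(LINT \<omega>:A|M. f \<omega>) = (\<integral>\<omega>. indicator B (path s \<omega>) * f \<omega> \<partial>M)" for f :: "'a \<Rightarrow> real"
      unfolding set_lebesgue_integral_def
      by (intro Bochner_Integration.integral_cong refl) (simp add: B(2) indicator_def)
    show "(LINT \<omega>:A|M. g (X (s + n) \<omega>)) = (LINT \<omega>:A|M. iter s n g (X s \<omega>))"
      unfolding ind by (rule integral_iter[OF s g B(1)])
  qed
qed

end

section \<open>The distribution of the paper\<close>

lemma f_N_pos_imp_S:
  assumes "0 < f_N q x"
  shows "x \<in> S q"
proof (cases "q = 1")
  case False
  with assms have "\<bar>x\<bar> < 2 / sqrt (1 - q)" by (auto simp: f_N_def split: if_splits)
  then show ?thesis using False by (auto simp: S_def)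
qed (simp add: S_def)

text \<open>Only the endpoints of \<open>S q\<close> are exceptional, and they form a null
  set.\<close>

lemma AE_S_f_N_pos:
  assumes q: "- 1 < q" "q \<le> 1"
  shows "AE x in lborel. x \<in> S q \<longrightarrow> 0 < f_N q x"
proof (cases "q = 1")
  case True
  then show ?thesis by (simp add: f_N_1_pos)
next
  case False
  with q have q1: "\<bar>q\<bar> < 1" by auto
  let ?b = "2 / sqrt (1 - q)"
  have "AE x in lborel. x \<noteq> ?b \<and> x \<noteq> - ?b"
    by (intro AE_conjI AE_lborel_singleton)
  then show ?thesis
  proof eventually_elim
    case (elim x)
    show ?case
    proof
      assume "x \<in> S q"
      then have "\<bar>x\<bar> < ?b" using elim False by (auto simp: S_def)
      then have "\<bar>sqrt (1 - q) * x\<bar> < 2" using q1 by (simp add: abs_mult field_simps)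
      then show "0 < f_N q x" using f_N_pos_iff_lt_1(1)[OF q1] by simp
    qed
  qed
qed

text \<open>The equality is pointwise. If some \<open>f_N q (x k)\<close> is 0, both sides vanish:
  through the initial factor for \<open>k = 1\<close>, otherwise through the factor leading into
  \<open>x k\<close>, which contains \<open>f_N q (x k)\<close>.\<close>

lemma qN_density_eq:
  assumes q: "- 1 < q" "q \<le> 1" and d: "1 \<le> d"
  shows "qN_density d \<rho> q x = f_N q (x 1) * (\<Prod>i\<in>{1..<d}. qkernel q (\<rho> i) (x i) (x (i + 1)))"
proof (cases "\<forall>i\<in>{1..d}. 0 < f_N q (x i)")
  case True
  then have "(\<Prod>i\<in>{1..<d}. f_CN q (\<rho> i) (x i) (x (i + 1))) =
      (\<Prod>i\<in>{1..<d}. qkernel q (\<rho> i) (x i) (x (i + 1)))"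
    by (intro prod.cong refl) (simp add: qkernel_def)
  then show ?thesis
    using True f_N_pos_imp_S by (auto simp: qN_density_def)
next
  case False
  then obtain k where k: "k \<in> {1..d}" "f_N q (x k) = 0"
    using f_N_nonneg[OF q] by (metis less_eq_real_def)
  have q1: "q \<noteq> 1" using k f_N_1_pos[of "x k"] by auto
  have "qN_density d \<rho> q x = 0 \<and> f_N q (x 1) * (\<Prod>i\<in>{1..<d}. qkernel q (\<rho> i) (x i) (x (i + 1))) = 0"
  proof (cases "k = 1")
    case True
    then show ?thesis using k by (simp add: qN_density_def)
  next
    case False
    then have i: "k - 1 \<in> {1..<d}" "k - 1 + 1 = k" using k by auto
    have "f_CN q r y (x k) = 0" "qkernel q r y (x k) = 0" for r y
      using k q1 by (simp_all add: f_CN_def qkernel_def)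
    then have "\<exists>i\<in>{1..<d}. f_CN q (\<rho> i) (x i) (x (i + 1)) = 0"
      "\<exists>i\<in>{1..<d}. qkernel q (\<rho> i) (x i) (x (i + 1)) = 0"
      using i by (metis)+
    then have "(\<Prod>i\<in>{1..<d}. f_CN q (\<rho> i) (x i) (x (i + 1))) = 0"
      "(\<Prod>i\<in>{1..<d}. qkernel q (\<rho> i) (x i) (x (i + 1))) = 0"
      by (auto intro: prod_zero)
    then show ?thesis unfolding qN_density_def by (simp only: mult_zero_right if_cancel)
  qed
  then show ?thesis by simp
qed

lemma degree_map_poly_le:
  assumes "f 0 = 0"
  shows "degree (map_poly f p) \<le> degree p"
  using assms by (intro degree_le) (simp add: coeff_map_poly coeff_eq_0)

lemma poly_map_poly_Re: "Re (poly p (complex_of_real x)) = poly (map_poly Re p) x"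
  by (induction p) (auto simp: map_poly_pCons)

lemma poly_map_poly_Im: "Im (poly p (complex_of_real x)) = poly (map_poly Im p) x"
  by (induction p) (auto simp: map_poly_pCons)

lemma poly_map_poly_of_real: "poly (map_poly complex_of_real p) (complex_of_real x) = complex_of_real (poly p x)"
  by (induction p) (auto simp: map_poly_pCons)

theorem proposition3:
  fixes M :: "'a measure" and X :: "nat \<Rightarrow> 'a \<Rightarrow> real"
    and q :: real and \<rho> :: "nat \<Rightarrow> real" and d i m n :: nat
    and j :: "nat \<Rightarrow> nat" and g :: "real \<Rightarrow> complex"
    and Y :: "'a \<Rightarrow> complex"
  assumes "prob_space M"
    and "-1 < q" and "q \<le> 1"
    and "\<And>k. 1 \<le> k \<Longrightarrow> k < d \<Longrightarrow> \<rho> k \<in> {-1<..<1} - {0}"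
    and "qN_distributed M d \<rho> q X"
    and "g \<in> L q"
    and "1 \<le> m" and "1 \<le> j 1" and "strict_mono_on {1..m} j"
    and "j m < i" and "i \<le> d"
  defines "Y \<equiv> complex_cond_exp M (sigma_rv M (j ` {1..m}) X) (\<lambda>\<omega>. g (X i \<omega>))"
  shows "((\<exists>p :: complex poly. degree p \<le> n \<and>
              (AE \<omega> in M. Y \<omega> = poly p (complex_of_real (X (j m) \<omega>))))
          \<longrightarrow> (\<exists>p :: complex poly. degree p \<le> n \<and>
              (AE x in lborel. x \<in> S q \<longrightarrow> g x = poly p (complex_of_real x))))
       \<and> ((\<integral>\<omega>. g (X i \<omega>) \<partial>M) = 0
          \<longrightarrow> (\<integral>\<omega>. (cmod (Y \<omega>))^2 \<partial>M)
              \<le> (\<Prod>k\<in>{j m..i - 1}. \<rho> k)^2 * (\<integral>\<omega>. (cmod (g (X i \<omega>)))^2 \<partial>M))"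
proof -
  note q = assms(2,3)
  define s l J where "s = j m" and "l = i - j m" and "J = j ` {1..m}"
  have mono: "j a \<le> j b" if "1 \<le> a" "a \<le> b" "b \<le> m" for a b
    using strict_mono_onD[OF assms(9), of a b] that by (cases "a = b") auto
  have s: "1 \<le> s" "s + l \<le> d" and i: "i = s + l" and l: "0 < l"
    using mono[of 1 m] assms(7,8,10,11) by (auto simp: s_def l_def)
  have J: "J \<subseteq> {1..s}" "s \<in> J"
    using mono[of 1] mono[of _ m] assms(7,8) by (force simp: J_def s_def)+
  have prod: "(\<Prod>k\<in>{j m..i - 1}. \<rho> k) = (\<Prod>k\<in>{s..<s + l}. \<rho> k)"
    using l by (intro prod.cong) (auto simp: s_def i)
  interpret reversible_chain M d X "f_N q" "\<lambda>i. qkernel q (\<rho> i)" \<rho> "qherm_poly q"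
  proof (intro reversible_chain.intro reversible_chain_axioms.intro)
    show "prob_space M" by fact
    show "reversible_kernel (f_N q) (qkernel q (\<rho> s)) (\<rho> s) (qherm_poly q)" if "1 \<le> s" "s < d" for s
      using assms(4)[OF that] by (intro reversible_kernel_qkernel q) auto
    show "qkernel q (\<rho> s) y x = 0" if "\<not> 0 < f_N q y" for s y x
      using that by (simp add: qkernel_def)
    show "2 \<le> d" using s l by simp
    show "distributed M (\<Pi>\<^sub>M k\<in>{1..d}. lborel) (\<lambda>\<omega>. \<lambda>k\<in>{1..d}. X k \<omega>)
      (\<lambda>x. ennreal (f_N q (x 1) * (\<Prod>i\<in>{1..<d}. qkernel q (\<rho> i) (x i) (x (i + 1)))))"
      using assms(5) s l qN_density_eq[OF q, of d \<rho>] by (simp add: qN_distributed_def)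
  qed
  note L2_def = reversible_kernel.L2_def[OF kernel_1]
  have [measurable]: "g \<in> borel_measurable borel" using assms(6) by (simp add: L_def)
  have [measurable]: "X i \<in> borel_measurable M" "X s \<in> borel_measurable M"
    using s by (auto intro!: X_measurable simp: i)
  have gint: "integrable lborel (\<lambda>x. (cmod (g x))\<^sup>2 * f_N q x)"
    using assms(6) by (simp add: L_def)
  \<comment> \<open>Used for \<open>f = Re\<close> and \<open>f = Im\<close>; the kernels are real,
    so the two parts of \<open>g\<close> are transported separately.\<close>
  have Lpart: "L2 (\<lambda>x. f (g x))" if "f \<in> borel_measurable borel" "\<And>z. (f z)\<^sup>2 \<le> (cmod z)\<^sup>2" for f
    unfolding L2_def
  proof
    show m: "(\<lambda>x. f (g x)) \<in> borel_measurable borel" using that(1) by measurable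
    show "integrable lborel (\<lambda>x. (f (g x))\<^sup>2 * f_N q x)"
      using gint
    proof (rule Bochner_Integration.integrable_bound)
      show "AE x in lborel. norm ((f (g x))\<^sup>2 * f_N q x) \<le> norm ((cmod (g x))\<^sup>2 * f_N q x)"
        using that(2) w_nonneg_chain by (auto simp: abs_mult intro!: mult_right_mono)
    qed (use m in measurable)
  qed
  have LR: "L2 (\<lambda>x. Re (g x))" and LI: "L2 (\<lambda>x. Im (g x))"
    by (auto intro!: Lpart simp: cmod_power2)
  define u v where "u = iter s l (\<lambda>x. Re (g x))" and "v = iter s l (\<lambda>x. Im (g x))"
  have Lu: "L2 u" and Lv: "L2 v"
    unfolding u_def v_def by (intro L2_iter s LR LI)+
  have [measurable]: "u \<in> borel_measurable borel" "v \<in> borel_measurable borel"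
    using Lu Lv by (auto simp: L2_def)
  have Yeq: "Y \<omega> = Complex (real_cond_exp M (sigma_rv M J X) (\<lambda>\<omega>. Re (g (X i \<omega>))) \<omega>)
      (real_cond_exp M (sigma_rv M J X) (\<lambda>\<omega>. Im (g (X i \<omega>))) \<omega>)" for \<omega>
    by (simp add: Y_def complex_cond_exp_def J_def)
  have Y: "AE \<omega> in M. Y \<omega> = Complex (u (X s \<omega>)) (v (X s \<omega>))"
    using real_cond_exp_iter[OF s J LR] real_cond_exp_iter[OF s J LI]
    unfolding i[symmetric] by eventually_elim (simp add: Yeq u_def v_def)
  show ?thesis
  proof (intro conjI impI)
    assume "\<exists>p :: complex poly. degree p \<le> n \<and> (AE \<omega> in M. Y \<omega> = poly p (complex_of_real (X (j m) \<omega>)))"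
    then obtain p :: "complex poly" where p: "degree p \<le> n"
      "AE \<omega> in M. Y \<omega> = poly p (complex_of_real (X s \<omega>))"
      unfolding s_def by blast
    have "AE \<omega> in M. u (X s \<omega>) = poly (map_poly Re p) (X s \<omega>)"
      using Y p(2) by eventually_elim (metis complex.sel(1) poly_map_poly_Re)
    \<comment> \<open>\<open>X s\<close> has density \<open>f_N q\<close>, so an almost sure
      identity in \<open>X s\<close> is one almost everywhere on the support.\<close>
    then have "AE x in lborel. 0 < f_N q x \<longrightarrow> u x = poly (map_poly Re p) x"
      using s by (subst (asm) AE_X_iff) auto
    from iter_poly[OF s LR order.trans[OF degree_map_poly_le[of Re] p(1)] this[unfolded u_def]]
    obtain a where a: "degree a \<le> n" "AE x in lborel. 0 < f_N q x \<longrightarrow> Re (g x) = poly a x" by auto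
    have "AE \<omega> in M. v (X s \<omega>) = poly (map_poly Im p) (X s \<omega>)"
      using Y p(2) by eventually_elim (metis complex.sel(2) poly_map_poly_Im)
    then have "AE x in lborel. 0 < f_N q x \<longrightarrow> v x = poly (map_poly Im p) x"
      using s by (subst (asm) AE_X_iff) auto
    from iter_poly[OF s LI order.trans[OF degree_map_poly_le[of Im] p(1)] this[unfolded v_def]]
    obtain b where b: "degree b \<le> n" "AE x in lborel. 0 < f_N q x \<longrightarrow> Im (g x) = poly b x" by auto
    \<comment> \<open>The real polynomials found for the two parts of \<open>g\<close>,
      recombined.\<close>
    let ?p = "map_poly complex_of_real a + smult \<i> (map_poly complex_of_real b)"
    have "degree ?p \<le> n"
      using a(1) b(1) degree_map_poly_le[of complex_of_real a] degree_map_poly_le[of complex_of_real b]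
        degree_smult_le[of \<i> "map_poly complex_of_real b"]
      by (intro degree_add_le) simp_all
    moreover have "AE x in lborel. x \<in> S q \<longrightarrow> g x = poly ?p (complex_of_real x)"
      using a(2) b(2) AE_S_f_N_pos[OF q]
      by eventually_elim (auto simp: complex_eq_iff poly_map_poly_of_real)
    ultimately show "\<exists>p :: complex poly. degree p \<le> n \<and>
        (AE x in lborel. x \<in> S q \<longrightarrow> g x = poly p (complex_of_real x))" by blast
  next
    assume mean: "(\<integral>\<omega>. g (X i \<omega>) \<partial>M) = 0"
    have id: "1 \<le> i" "i \<le> d" using s i by auto
    \<comment> \<open>Integrability is what allows the complex mean to be split into the means of
      the real and imaginary parts.\<close>
    have gX: "integrable M (\<lambda>\<omega>. g (X i \<omega>))"
    proof (rule Bochner_Integration.integrable_bound)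
      show "integrable M (\<lambda>\<omega>. \<bar>Re (g (X i \<omega>))\<bar> + \<bar>Im (g (X i \<omega>))\<bar>)"
        using integrable_L2_X[OF id LR] integrable_L2_X[OF id LI] by simp
      show "AE \<omega> in M. norm (g (X i \<omega>)) \<le> norm (\<bar>Re (g (X i \<omega>))\<bar> + \<bar>Im (g (X i \<omega>))\<bar>)"
        by (rule AE_I2) (simp add: cmod_le)
    qed measurable
    have one: "L2 (\<lambda>_. 1)"
      using reversible_kernel.L2_poly[OF kernel_1, of "[:1:]"] by (simp add: poly_pCons[abs_def])
    have R0: "ip (\<lambda>x. Re (g x)) (\<lambda>_. 1) = 0"
      using ip_expectation(2)[OF id LR one] integral_Re[OF gX] mean by simp
    have I0: "ip (\<lambda>x. Im (g x)) (\<lambda>_. 1) = 0"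
      using ip_expectation(2)[OF id LI one] integral_Im[OF gX] mean by simp
    have sq: "(cmod z)\<^sup>2 = Re z * Re z + Im z * Im z" for z
      by (simp add: cmod_power2 flip: power2_eq_square)
    let ?r = "(\<Prod>k\<in>{s..<s + l}. \<rho> k)\<^sup>2"
    have sd: "s \<le> d" using s by simp
    have [measurable]: "Y \<in> borel_measurable M"
    proof -
      have "Y = (\<lambda>\<omega>. complex_of_real (real_cond_exp M (sigma_rv M J X) (\<lambda>\<omega>. Re (g (X i \<omega>))) \<omega>)
        + \<i> * complex_of_real (real_cond_exp M (sigma_rv M J X) (\<lambda>\<omega>. Im (g (X i \<omega>))) \<omega>))"
        by (rule ext) (simp add: Yeq complex_eq_iff)
      then show ?thesis by simp
    qed
    have "(\<integral>\<omega>. (cmod (Y \<omega>))\<^sup>2 \<partial>M) = (\<integral>\<omega>. u (X s \<omega>) * u (X s \<omega>) + v (X s \<omega>) * v (X s \<omega>) \<partial>M)"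
    proof (rule integral_cong_AE)
      show "AE \<omega> in M. (cmod (Y \<omega>))\<^sup>2 = u (X s \<omega>) * u (X s \<omega>) + v (X s \<omega>) * v (X s \<omega>)"
        using Y by eventually_elim (simp only: sq complex.sel)
    qed measurable
    also have "\<dots> = ip u u + ip v v"
      using ip_expectation[OF s(1) sd Lu Lu] ip_expectation[OF s(1) sd Lv Lv] by simp
    also have "\<dots> \<le> ?r * ip (\<lambda>x. Re (g x)) (\<lambda>x. Re (g x)) + ?r * ip (\<lambda>x. Im (g x)) (\<lambda>x. Im (g x))"
      unfolding u_def v_def by (intro add_mono ip_iter_le s LR LI R0 I0)
    also have "\<dots> = ?r * (\<integral>\<omega>. (cmod (g (X i \<omega>)))\<^sup>2 \<partial>M)"
    proof -
      have "(\<integral>\<omega>. (cmod (g (X i \<omega>)))\<^sup>2 \<partial>M) = ip (\<lambda>x. Re (g x)) (\<lambda>x. Re (g x)) + ip (\<lambda>x. Im (g x)) (\<lambda>x. Im (g x))"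
        unfolding sq using ip_expectation[OF id LR LR] ip_expectation[OF id LI LI] by simp
      then show ?thesis by (simp add: distrib_left)
    qed
    finally show "(\<integral>\<omega>. (cmod (Y \<omega>))^2 \<partial>M)
        \<le> (\<Prod>k\<in>{j m..i - 1}. \<rho> k)^2 * (\<integral>\<omega>. (cmod (g (X i \<omega>)))^2 \<partial>M)"
      unfolding prod .
  qed
qed

end
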